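(* Fix a real number $\alpha \neq 0$. If $\Omega \subset \mathbb{R}^2$ is a bounded domain with Lipschitz boundary, then $$\lambda_1\big(\Omega;\alpha/L(\Omega)\big)\, A(\Omega) < \alpha .$$ Moreover, equality holds in the limit for rectangular domains that degenerate to a line segment: if $(\Omega_j)_{j\ge 1}$ is a sequence of open rectangles with side lengths $a_j \geq b_j > 0$ such that $b_j/a_j \to 0$ as $j\to\infty$, then $$\lambda_1\big(\Omega_j;\alpha/L(\Omega_j)\big)\, A(\Omega_j) \to \alpha \qquad \text{as } j \to \infty .$$
   Context: A domain is a nonempty connected open set. $A(\Omega)$ denotes the area of $\Omega$ and $L(\Omega)$ denotes the perimeter, i.e. the length of the boundary $\partial\Omega$. For a bounded domain $\Omega \subset \mathbb{R}^2$ with Lipschitz boundary and a real parameter $\beta$, the Robin eigenvalues $\lambda_k(\Omega;\beta)$, $k=1,2,\dots$, are the eigenvalues (in increasing order, counted with multiplicity) of the problem $-\Delta u = \lambda u$ in $\Omega$, $\frac{\partial u}{\partial \nu} + \beta u = 0$ on $\partial\Omega$, where $\nu$ is the outward unit normal. The problem is understood in the weak sense, with Rayleigh quotient $$Q[u] = \frac{\int_\Omega |\nabla u|^2\,dx + \beta \int_{\partial\Omega} u^2 \, ds}{\int_\Omega u^2\,dx}, \qquad u \in H^1(\Omega)\setminus\{0\},$$ where $u$ on $\partial\Omega$ is understood as the trace. In particular, $\lambda_1(\Omega;\beta) = \min_{u} Q[u]$. The quantity $\lambda_k(\Omega;\alpha/L(\Omega))A(\Omega)$ is invariant under scaling of $\Omega$.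 *)

theory Defs
  imports "HOL-Analysis.Analysis"
begin

(* One-dimensional Hausdorff measure. With the plain diameter as gauge it agrees with
   arc length on rectifiable curves, so it is the arclength element ds on the boundary. *)

definition hausdorff1_delta :: "real \<Rightarrow> 'a::metric_space set \<Rightarrow> ennreal" where
  "hausdorff1_delta \<delta> E =
     (INF C\<in>{C :: nat \<Rightarrow> 'a set. E \<subseteq> (\<Union>i. C i) \<and> (\<forall>i. bounded (C i) \<and> diameter (C i) \<le> \<delta>)}.
        \<Sum>i. ennreal (diameter (C i)))"

definition hausdorff1_outer :: "'a::metric_space set \<Rightarrow> ennreal" where
  "hausdorff1_outer E = (SUP \<delta>\<in>{0<..}. hausdorff1_delta \<delta> E)"

definition length_measure :: "'a::metric_space measure" where
  "length_measure = measure_of UNIV (sets borel) hausdorff1_outer"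

definition area :: "(real^2) set \<Rightarrow> real" where
  "area \<Omega> = measure lborel \<Omega>"

definition perimeter :: "(real^2) set \<Rightarrow> real" where
  "perimeter \<Omega> = measure length_measure (frontier \<Omega>)"

(* Near each boundary point, in suitable orthonormal coordinates (s, t) centred there, the
   set is the region above the graph of a Lipschitz function \<gamma>. Since \<Omega> is open and \<gamma> is
   continuous, this also forces the boundary to be the graph itself inside the chart. *)

definition lipschitz_boundary :: "(real^2) set \<Rightarrow> bool" where
  "lipschitz_boundary \<Omega> \<longleftrightarrow>
     (\<forall>p\<in>frontier \<Omega>. \<exists>e f :: real^2. \<exists>r>0. \<exists>h>0. \<exists>\<gamma> :: real \<Rightarrow> real. \<exists>C.
        norm e = 1 \<and> norm f = 1 \<and> e \<bullet> f = 0 \<and> C-lipschitz_on UNIV \<gamma> \<and>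
        (\<forall>s t. \<bar>s\<bar> < r \<longrightarrow> \<bar>t\<bar> < h \<longrightarrow> (p + s *\<^sub>R e + t *\<^sub>R f \<in> \<Omega> \<longleftrightarrow> \<gamma> s < t)))"

definition bounded_lipschitz_domain :: "(real^2) set \<Rightarrow> bool" where
  "bounded_lipschitz_domain \<Omega> \<longleftrightarrow>
     open \<Omega> \<and> connected \<Omega> \<and> \<Omega> \<noteq> {} \<and> bounded \<Omega> \<and> lipschitz_boundary \<Omega>"

definition C1_grad :: "(real^2 \<Rightarrow> real) \<Rightarrow> (real^2 \<Rightarrow> real^2) \<Rightarrow> bool" where
  "C1_grad \<phi> D \<longleftrightarrow> (\<forall>x. GDERIV \<phi> x :> D x) \<and> continuous_on UNIV D"

definition square_integrable_on ::
    "'a measure \<Rightarrow> 'a set \<Rightarrow> ('a \<Rightarrow> 'b::euclidean_space) \<Rightarrow> bool" where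
  "square_integrable_on M S u \<longleftrightarrow>
     set_borel_measurable M S u \<and> set_integrable M S (\<lambda>x. (norm (u x))\<^sup>2)"

definition tendsto_L2 ::
    "'a measure \<Rightarrow> 'a set \<Rightarrow> (nat \<Rightarrow> 'a \<Rightarrow> 'b::euclidean_space) \<Rightarrow> ('a \<Rightarrow> 'b) \<Rightarrow> bool" where
  "tendsto_L2 M S v u \<longleftrightarrow>
     (\<forall>n. square_integrable_on M S (\<lambda>x. v n x - u x)) \<and>
     (\<lambda>n. LINT x:S|M. (norm (v n x - u x))\<^sup>2) \<longlonglongrightarrow> 0"

(* u lies in H^1(\<Omega>) and G is its weak gradient. Elements of H^1 are given by Borel
   representatives; the values of u and G outside \<Omega> are irrelevant. *)

definition H1_grad :: "(real^2) set \<Rightarrow> (real^2 \<Rightarrow> real) \<Rightarrow> (real^2 \<Rightarrow> real^2) \<Rightarrow> bool" where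
  "H1_grad \<Omega> u G \<longleftrightarrow>
     square_integrable_on lborel \<Omega> u \<and> square_integrable_on lborel \<Omega> G \<and>
     (\<forall>\<phi> D. C1_grad \<phi> D \<longrightarrow> compact (closure {x. \<phi> x \<noteq> 0}) \<longrightarrow> closure {x. \<phi> x \<noteq> 0} \<subseteq> \<Omega> \<longrightarrow>
        (LINT x:\<Omega>|lborel. u x *\<^sub>R D x) = - (LINT x:\<Omega>|lborel. \<phi> x *\<^sub>R G x))"

(* u lies in H^1(\<Omega>), G is its weak gradient and g its boundary trace. The trace operator is
   the continuous extension of \<phi> \<mapsto> \<phi> restricted to the boundary from C^1 up to the
   boundary to H^1(\<Omega>), with values in L^2 of the boundary; its graph is the closure of the
   graph of that restriction. On a bounded Lipschitz domain every u in H^1(\<Omega>) has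
   such a g, unique up to null sets of the boundary. *)

definition H1_grad_trace ::
    "(real^2) set \<Rightarrow> (real^2 \<Rightarrow> real) \<Rightarrow> (real^2 \<Rightarrow> real^2) \<Rightarrow> (real^2 \<Rightarrow> real) \<Rightarrow> bool" where
  "H1_grad_trace \<Omega> u G g \<longleftrightarrow>
     H1_grad \<Omega> u G \<and> square_integrable_on length_measure (frontier \<Omega>) g \<and>
     (\<exists>\<phi> D. (\<forall>n::nat. C1_grad (\<phi> n) (D n)) \<and>
        tendsto_L2 lborel \<Omega> \<phi> u \<and> tendsto_L2 lborel \<Omega> D G \<and>
        tendsto_L2 length_measure (frontier \<Omega>) \<phi> g)"

(* Weak form of -\<Delta>u = \<mu>u in \<Omega>, du/d\<nu> + \<beta>u = 0 on the boundary; nontriviality of u is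
   imposed separately, through linear independence. *)

definition robin_weak_solution :: "(real^2) set \<Rightarrow> real \<Rightarrow> real \<Rightarrow> (real^2 \<Rightarrow> real) \<Rightarrow> bool" where
  "robin_weak_solution \<Omega> \<beta> \<mu> u \<longleftrightarrow>
     (\<exists>G g. H1_grad_trace \<Omega> u G g \<and>
        (\<forall>v H h. H1_grad_trace \<Omega> v H h \<longrightarrow>
           (LINT x:\<Omega>|lborel. G x \<bullet> H x) + \<beta> * (LINT x:frontier \<Omega>|length_measure. g x * h x)
             = \<mu> * (LINT x:\<Omega>|lborel. u x * v x)))"

definition lin_indep_ae :: "(real^2) set \<Rightarrow> nat \<Rightarrow> (nat \<Rightarrow> real^2 \<Rightarrow> real) \<Rightarrow> bool" where
  "lin_indep_ae \<Omega> k u \<longleftrightarrow>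
     (\<forall>c :: nat \<Rightarrow> real. (AE x in lborel. x \<in> \<Omega> \<longrightarrow> (\<Sum>i<k. c i * u i x) = 0) \<longrightarrow> (\<forall>i<k. c i = 0))"

(* The k-th eigenvalue (k \<ge> 1) in increasing order, counted with multiplicity: the least t
   such that there are k linearly independent eigenfunctions with eigenvalues at most t
   (on a bounded Lipschitz domain the spectrum is discrete, so the infimum is attained). *)

definition robin_eigenvalue :: "nat \<Rightarrow> (real^2) set \<Rightarrow> real \<Rightarrow> real" where
  "robin_eigenvalue k \<Omega> \<beta> =
     Inf {t. \<exists>\<mu> u. lin_indep_ae \<Omega> k u \<and> (\<forall>i<k. \<mu> i \<le> t \<and> robin_weak_solution \<Omega> \<beta> (\<mu> i) (u i))}"

definition open_rectangle :: "(real^2) set \<Rightarrow> real \<Rightarrow> real \<Rightarrow> bool" where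
  "open_rectangle R a b \<longleftrightarrow>
     (\<exists>p e f. norm e = 1 \<and> norm f = 1 \<and> e \<bullet> f = 0 \<and>
        R = {p + s *\<^sub>R e + t *\<^sub>R f | s t. 0 < s \<and> s < a \<and> 0 < t \<and> t < b})"

end

theory Submission
  imports Defs "HOL-Complex_Analysis.Great_Picard"
begin

text \<open>Write \<open>\<beta> = \<alpha> / L\<close>. The constant function \<open>1\<close> has energy \<open>\<beta> L = \<alpha>\<close> and mass \<open>A\<close>, so
  the infimum of the Rayleigh quotient is at most \<open>\<alpha> / A\<close>. If it were equal to \<open>\<alpha> / A\<close>, the constant
  would be a minimiser and hence a weak solution; testing the weak equation with a nonnegative
  bump inside the domain leaves \<open>0 = \<lambda> \<integral> \<psi>\<close> with \<open>\<lambda> = \<alpha> / A \<noteq> 0\<close>, a contradiction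
  (\<open>robin_eigenvalue_strict_upper_bound\<close>).

  The eigenvalue is defined through weak eigenfunctions and not as the infimum of the quotient, so
  the weight of the proof is that the infimum is attained
  (\<open>minimizer_exists\<close>, \<open>robin_eigenvalue_eq_bottom\<close>). Since elements of the Sobolev space with trace
  are limits of continuously differentiable functions, all estimates are made for the latter.
  In graph coordinates every estimate integrates an elementary inequality along vertical fibres:
  \<open>trace_inequality\<close> bounds the boundary term by a small multiple of the Dirichlet integral plus a
  multiple of the mass, which makes the Robin form coercive for either sign of \<open>\<beta>\<close>;
  \<open>strip_inequality\<close> says that little mass sits near the boundary. The latter reduces Rellich's
  compactness theorem (\<open>rellich_C1\<close>) to the Poincare inequality on the squares of a fine grid. A
  minimising sequence thus has a subsequence that is Cauchy in the mean, the parallelogram law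
  makes it Cauchy in energy and trace as well, and its limit is a minimiser.

  For a rectangle with sides \<open>a \<ge> b\<close> the same fibre inequalities, with fibres across the
  rectangle from one long side to the other, compare the mass with the integral over a long side
  up to a factor \<open>1 + \<kappa>\<close> and an error in the derivative across. Choosing \<open>\<kappa>\<close> of order
  \<open>b / a\<close> lets the Dirichlet integral absorb the error; the short sides contribute only to lower
  order. This gives lower bounds for \<open>\<lambda> A\<close> that tend to \<open>\<alpha>\<close> as \<open>b / a\<close> tends to zero.

  All boundary integrals refer to one-dimensional Hausdorff measure. Caratheodory's criterion
  shows that it is a Borel measure, it is Lebesgue measure on the line, and Lipschitz maps
  distort it by at most the Lipschitz constant; this is all that is used of arc length.\<close>

section \<open>Arc length as a Borel measure\<close>

lemma hausdorff1_delta_le_cover: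
  assumes "E \<subseteq> (\<Union>i. C i)" "\<And>i. bounded (C i)" "\<And>i. diameter (C i) \<le> \<delta>"
  shows "hausdorff1_delta \<delta> E \<le> (\<Sum>i. ennreal (diameter (C i)))"
  unfolding hausdorff1_delta_def by (rule INF_lower) (use assms in auto)

lemma hausdorff1_delta_mono: "E \<subseteq> F \<Longrightarrow> hausdorff1_delta \<delta> E \<le> hausdorff1_delta \<delta> F"
  unfolding hausdorff1_delta_def by (rule INF_superset_mono) auto

lemma hausdorff1_delta_antimono: "\<delta> \<le> \<delta>' \<Longrightarrow> hausdorff1_delta \<delta>' E \<le> hausdorff1_delta \<delta> E"
  unfolding hausdorff1_delta_def by (rule INF_superset_mono) (auto intro: order_trans)

lemma hausdorff1_delta_empty: "\<delta> \<ge> 0 \<Longrightarrow> hausdorff1_delta \<delta> {} = 0"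
  using hausdorff1_delta_le_cover[of "{}" "\<lambda>_. {}" \<delta>] by simp

lemma hausdorff1_delta_le_outer: "\<delta> > 0 \<Longrightarrow> hausdorff1_delta \<delta> E \<le> hausdorff1_outer E"
  unfolding hausdorff1_outer_def by (rule SUP_upper) auto

lemma hausdorff1_outer_le:
  assumes "\<And>\<delta>. \<delta> > 0 \<Longrightarrow> hausdorff1_delta \<delta> E \<le> X"
  shows "hausdorff1_outer E \<le> X"
  unfolding hausdorff1_outer_def by (rule SUP_least) (use assms in auto)

lemma hausdorff1_delta_subadditive:
  fixes A :: "nat \<Rightarrow> 'a::metric_space set"
  shows "hausdorff1_delta \<delta> (\<Union>i. A i) \<le> (\<Sum>i. hausdorff1_delta \<delta> (A i))"
proof (rule ennreal_le_epsilon)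
  fix e :: real assume fin: "(\<Sum>i. hausdorff1_delta \<delta> (A i)) < top" and e: "0 < e"
  let ?P = "\<lambda>E C. E \<subseteq> (\<Union>i. C i) \<and> (\<forall>i. bounded (C i) \<and> diameter (C i) \<le> \<delta>)"
  have "\<exists>C. ?P (A n) C \<and> (\<Sum>i. ennreal (diameter (C i))) \<le> hausdorff1_delta \<delta> (A n) + e * (1/2) ^ Suc n" for n
  proof -
    have "hausdorff1_delta \<delta> (A n) < top"
      using fin ennreal_suminf_lessD by blast
    then have "hausdorff1_delta \<delta> (A n) < hausdorff1_delta \<delta> (A n) + e * (1/2) ^ Suc n"
      using e by (auto simp: ennreal_zero_less_mult_iff less_top)
    then show ?thesis
      unfolding hausdorff1_delta_def INF_less_iff using less_imp_le by blast
  qed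
  then obtain C where C: "\<And>n. ?P (A n) (C n)"
    and le: "\<And>n. (\<Sum>i. ennreal (diameter (C n i))) \<le> hausdorff1_delta \<delta> (A n) + e * (1/2) ^ Suc n"
    by metis
  let ?D = "\<lambda>k. case_prod C (prod_decode k)"
  have "hausdorff1_delta \<delta> (\<Union>i. A i) \<le> (\<Sum>k. ennreal (diameter (?D k)))"
  proof (rule hausdorff1_delta_le_cover)
    show "(\<Union>i. A i) \<subseteq> (\<Union>k. ?D k)"
    proof
      fix x assume "x \<in> (\<Union>i. A i)"
      then obtain i j where "x \<in> C i j" using C by blast
      then have "x \<in> ?D (prod_encode (i, j))" by simp
      then show "x \<in> (\<Union>k. ?D k)" by (rule UN_I[OF UNIV_I])
    qed
  qed (use C in \<open>auto split: prod.split\<close>)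
  also have "\<dots> = (\<Sum>n. \<Sum>i. ennreal (diameter (C n i)))"
    using suminf_ennreal_2dimen[of "\<lambda>n. \<Sum>i. ennreal (diameter (C n i))" "\<lambda>p. ennreal (diameter (case_prod C p))"]
    by simp
  also have "\<dots> \<le> (\<Sum>n. hausdorff1_delta \<delta> (A n) + e * (1/2) ^ Suc n)"
    by (rule suminf_le) (use le in auto)
  also have "\<dots> = (\<Sum>n. hausdorff1_delta \<delta> (A n)) + (\<Sum>n. ennreal e * (ennreal (1/2)) ^ Suc n)"
    using e by (subst suminf_add) (auto simp: ennreal_mult simp del: power_Suc simp flip: ennreal_power)
  also have "(\<Sum>n. ennreal e * (ennreal (1/2)) ^ Suc n) = ennreal e"
  proof -
    have "(\<Sum>n. ennreal ((1/2) ^ Suc n)) = ennreal 1"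
      using power_half_series by (intro suminf_ennreal_eq) auto
    then have *: "(\<Sum>n. ennreal (1/2) ^ Suc n) = 1" by (subst ennreal_power) auto
    show ?thesis unfolding ennreal_suminf_cmult * by simp
  qed
  finally show "hausdorff1_delta \<delta> (\<Union>i. A i) \<le> (\<Sum>i. hausdorff1_delta \<delta> (A i)) + ennreal e" .
qed

lemma outer_measure_space_hausdorff1:
  "outer_measure_space (Pow UNIV) (hausdorff1_outer :: 'a::metric_space set \<Rightarrow> ennreal)"
proof -
  have "hausdorff1_outer ({} :: 'a set) = 0"
    using hausdorff1_outer_le[of "{} :: 'a set" 0] by (simp add: hausdorff1_delta_empty)
  moreover have "hausdorff1_outer (E :: 'a set) \<le> hausdorff1_outer F" if "E \<subseteq> F" for E F
    unfolding hausdorff1_outer_def by (rule SUP_mono) (use hausdorff1_delta_mono[OF that] in auto)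
  moreover have "hausdorff1_outer (\<Union>i. A i) \<le> (\<Sum>i. hausdorff1_outer (A i))" for A :: "nat \<Rightarrow> 'a set"
  proof (rule hausdorff1_outer_le)
    fix \<delta> :: real assume "\<delta> > 0"
    then have "(\<Sum>i. hausdorff1_delta \<delta> (A i)) \<le> (\<Sum>i. hausdorff1_outer (A i))"
      by (intro suminf_le) (auto intro: hausdorff1_delta_le_outer)
    then show "hausdorff1_delta \<delta> (\<Union>i. A i) \<le> (\<Sum>i. hausdorff1_outer (A i))"
      using hausdorff1_delta_subadditive[of \<delta> A] by simp
  qed
  ultimately show ?thesis
    unfolding outer_measure_space_def positive_def increasing_def countably_subadditive_def by auto
qed

lemma hausdorff1_outer_mono: "E \<subseteq> F \<Longrightarrow> hausdorff1_outer E \<le> hausdorff1_outer F"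
  using outer_measure_space_hausdorff1 by (auto simp: outer_measure_space_def increasing_def)

lemma hausdorff1_outer_empty [simp]: "hausdorff1_outer {} = 0"
  using outer_measure_space_hausdorff1 by (auto simp: outer_measure_space_def positive_def)

lemma hausdorff1_outer_UN: "hausdorff1_outer (\<Union>i::nat. A i) \<le> (\<Sum>i. hausdorff1_outer (A i))"
proof -
  \<comment> \<open>Countable subadditivity is defined by disjoint families, so the sets are first made disjoint.\<close>
  have "hausdorff1_outer (\<Union>i. disjointed A i) \<le> (\<Sum>i. hausdorff1_outer (disjointed A i))"
    using outer_measure_space_hausdorff1 disjoint_family_disjointed[of A]
    by (auto simp: outer_measure_space_def countably_subadditive_def simp del: UN_disjointed_eq)
  also have "\<dots> \<le> (\<Sum>i. hausdorff1_outer (A i))"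
    by (intro suminf_le hausdorff1_outer_mono disjointed_subset) auto
  finally show ?thesis by (simp add: UN_disjointed_eq)
qed

lemma hausdorff1_outer_Un: "hausdorff1_outer (A \<union> B) \<le> hausdorff1_outer A + hausdorff1_outer B"
proof -
  have eq: "A \<union> B = (\<Union>i. if i = (0::nat) then A else if i = 1 then B else {})" (is "_ = (\<Union>i. ?C i)")
    by (auto split: if_splits)
  have "hausdorff1_outer (A \<union> B) \<le> (\<Sum>i. hausdorff1_outer (?C i))"
    unfolding eq by (rule hausdorff1_outer_UN)
  also have "\<dots> = (\<Sum>i\<in>{0,1}. hausdorff1_outer (?C i))"
    by (rule suminf_finite) auto
  finally show ?thesis by simp
qed

text \<open>Once the covering sets are smaller than the distance of \<open>A\<close> and \<open>B\<close>, none of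
  them meets both.\<close>

lemma hausdorff1_outer_separated:
  fixes A B :: "'a::metric_space set"
  assumes d: "d > 0" and sep: "\<And>x y. x \<in> A \<Longrightarrow> y \<in> B \<Longrightarrow> d \<le> dist x y"
  shows "hausdorff1_outer A + hausdorff1_outer B \<le> hausdorff1_outer (A \<union> B)"
proof -
  have small: "hausdorff1_delta \<delta> A + hausdorff1_delta \<delta> B \<le> hausdorff1_delta \<delta> (A \<union> B)"
    if \<delta>: "0 < \<delta>" "\<delta> < d" for \<delta>
    unfolding hausdorff1_delta_def[of \<delta> "A \<union> B"]
  proof (rule INF_greatest)
    fix C :: "nat \<Rightarrow> 'a set"
    assume "C \<in> {C. A \<union> B \<subseteq> (\<Union>i. C i) \<and> (\<forall>i. bounded (C i) \<and> diameter (C i) \<le> \<delta>)}"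
    then have C: "A \<union> B \<subseteq> (\<Union>i. C i)" "\<And>i. bounded (C i)" "\<And>i. diameter (C i) \<le> \<delta>" by auto
    define CA where "CA i = (if C i \<inter> A = {} then {} else C i)" for i
    define CB where "CB i = (if C i \<inter> B = {} then {} else C i)" for i
    have disj: "CA i = {} \<or> CB i = {}" for i
    proof (rule ccontr)
      assume "\<not> ?thesis"
      then obtain x y where "x \<in> A" "x \<in> C i" "y \<in> B" "y \<in> C i"
        by (auto simp: CA_def CB_def split: if_splits)
      then have "d \<le> diameter (C i)"
        using sep diameter_bounded_bound[OF C(2)] order_trans by blast
      then show False using C(3)[of i] \<delta> by simp
    qed
    have sum: "ennreal (diameter (CA i)) + ennreal (diameter (CB i)) \<le> ennreal (diameter (C i))" for i
      using disj[of i]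
    proof
      assume "CA i = {}" then show ?thesis by (simp add: CB_def)
    next
      assume "CB i = {}" then show ?thesis by (simp add: CA_def)
    qed
    have "hausdorff1_delta \<delta> A \<le> (\<Sum>i. ennreal (diameter (CA i)))"
      by (rule hausdorff1_delta_le_cover) (use C \<delta> in \<open>force simp: CA_def\<close>)+
    moreover have "hausdorff1_delta \<delta> B \<le> (\<Sum>i. ennreal (diameter (CB i)))"
      by (rule hausdorff1_delta_le_cover) (use C \<delta> in \<open>force simp: CB_def\<close>)+
    ultimately have "hausdorff1_delta \<delta> A + hausdorff1_delta \<delta> B
        \<le> (\<Sum>i. ennreal (diameter (CA i))) + (\<Sum>i. ennreal (diameter (CB i)))"
      by (rule add_mono)
    also have "\<dots> = (\<Sum>i. ennreal (diameter (CA i)) + ennreal (diameter (CB i)))"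
      by (rule suminf_add) auto
    also have "\<dots> \<le> (\<Sum>i. ennreal (diameter (C i)))"
      by (rule suminf_le) (use sum in auto)
    finally show "hausdorff1_delta \<delta> A + hausdorff1_delta \<delta> B \<le> (\<Sum>i. ennreal (diameter (C i)))" .
  qed
  have "hausdorff1_outer A + hausdorff1_outer B
      = (SUP \<delta>\<in>{0<..}. hausdorff1_delta \<delta> A + hausdorff1_delta \<delta> B)"
    unfolding hausdorff1_outer_def
  proof (rule SUP_add_directed_ennreal[symmetric])
    fix i j :: real assume "i \<in> {0<..}" "j \<in> {0<..}"
    then show "\<exists>k\<in>{0<..}. hausdorff1_delta i A + hausdorff1_delta j B
        \<le> hausdorff1_delta k A + hausdorff1_delta k B"
      by (intro bexI[of _ "min i j"] add_mono hausdorff1_delta_antimono) auto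
  qed
  also have "\<dots> \<le> hausdorff1_outer (A \<union> B)"
  proof (rule SUP_least)
    fix \<delta> :: real assume "\<delta> \<in> {0<..}"
    define \<delta>' where "\<delta>' = min \<delta> (d/2)"
    have \<delta>': "0 < \<delta>'" "\<delta>' < d" "\<delta>' \<le> \<delta>"
      using d \<open>\<delta> \<in> {0<..}\<close> by (auto simp: \<delta>'_def)
    have "hausdorff1_delta \<delta> A + hausdorff1_delta \<delta> B \<le> hausdorff1_delta \<delta>' A + hausdorff1_delta \<delta>' B"
      by (intro add_mono hausdorff1_delta_antimono \<delta>')
    also have "\<dots> \<le> hausdorff1_delta \<delta>' (A \<union> B)" by (rule small) (use \<delta>' in auto)
    also have "\<dots> \<le> hausdorff1_outer (A \<union> B)" by (rule hausdorff1_delta_le_outer) (use \<delta>' in auto)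
    finally show "hausdorff1_delta \<delta> A + hausdorff1_delta \<delta> B \<le> hausdorff1_outer (A \<union> B)" .
  qed
  finally show ?thesis .
qed

lemma suminf_ennreal_tail:
  fixes f :: "nat \<Rightarrow> ennreal"
  assumes "(\<Sum>i. f i) < top" "e > 0"
  shows "\<exists>n. (\<Sum>i. f (i + n)) \<le> ennreal e"
proof -
  have f: "f i = ennreal (enn2real (f i))" for i
    using ennreal_suminf_lessD[OF assms(1), of i] by simp
  have "summable (\<lambda>i. enn2real (f i))"
    by (rule summable_suminf_not_top) (use assms f in \<open>auto simp flip: f\<close>)
  then obtain N where "\<And>n. n \<ge> N \<Longrightarrow> norm (\<Sum>i. enn2real (f (i + n))) < e"
    using suminf_exist_split[OF assms(2)] by blast
  then have *: "(\<Sum>i. enn2real (f (i + N))) < e" by force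
  have "(\<Sum>i. f (i + N)) = (\<Sum>i. ennreal (enn2real (f (i + N))))"
    using f by simp
  also have "\<dots> = ennreal (\<Sum>i. enn2real (f (i + N)))"
    by (rule suminf_ennreal2)
       (use \<open>summable (\<lambda>i. enn2real (f i))\<close> summable_iff_shift[of "\<lambda>i. enn2real (f i)"] in auto)
  finally show ?thesis using * by (intro exI[of _ N]) (auto intro: ennreal_leI)
qed

text \<open>Caratheodory's criterion: slice \<open>A - F\<close> by the distance from \<open>F\<close>. Slices that are not
  adjacent have positive distance, so the slices have a convergent total length, and what
  lies very close to \<open>F\<close> is negligible.\<close>

lemma hausdorff1_outer_split_closed:
  fixes A F :: "'a::metric_space set"
  assumes F: "closed F"
  shows "hausdorff1_outer (A \<inter> F) + hausdorff1_outer (A - F) \<le> hausdorff1_outer A"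
proof (cases "F = {} \<or> hausdorff1_outer A = top")
  case True then show ?thesis by auto
next
  case False
  then have Fne: "F \<noteq> {}" and fin: "hausdorff1_outer A < top" by (auto simp: less_top)
  define D where "D n = {x\<in>A. 1 / real (Suc n) \<le> infdist x F}" for n
  define R where "R n = {x\<in>A. 1 / real (Suc (Suc n)) \<le> infdist x F \<and> infdist x F < 1 / real (Suc n)}" for n
  have infd: "infdist x F - infdist y F \<le> dist x y" for x y
    using infdist_triangle[of x F y] by simp
  have lin: "sum (\<lambda>k. hausdorff1_outer (R (2 * k + j))) {..<N}
      \<le> hausdorff1_outer (\<Union>k<N. R (2 * k + j))" for N j
  proof (induction N)
    case (Suc N)
    let ?U = "\<Union>k<N. R (2 * k + j)"
    \<comment> \<open>For \<open>N = 0\<close> the union is empty and any positive gap will do.\<close>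
    define gap where "gap = (if N > 0 then 1 / real (2 * N + j) - 1 / real (Suc (2 * N + j)) else 1)"
    have "sum (\<lambda>k. hausdorff1_outer (R (2 * k + j))) {..<Suc N}
        \<le> hausdorff1_outer ?U + hausdorff1_outer (R (2 * N + j))"
      using Suc by (simp add: add_right_mono)
    also have "\<dots> \<le> hausdorff1_outer (?U \<union> R (2 * N + j))"
    proof (rule hausdorff1_outer_separated)
      show "0 < gap" by (auto simp: gap_def intro!: divide_strict_left_mono mult_pos_pos)
      fix x y assume x: "x \<in> ?U" and y: "y \<in> R (2 * N + j)"
      then obtain k where k: "k < N" "x \<in> R (2 * k + j)" by auto
      have "1 / real (2 * N + j) \<le> 1 / real (Suc (Suc (2 * k + j)))"
        using k by (intro divide_left_mono) auto
      then have "1 / real (2 * N + j) \<le> infdist x F" using k by (auto simp: R_def)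
      moreover have "infdist y F < 1 / real (Suc (2 * N + j))" using y by (auto simp: R_def)
      ultimately show "gap \<le> dist x y"
        using infd[of x y] k by (auto simp: gap_def)
    qed
    also have "?U \<union> R (2 * N + j) = (\<Union>k<Suc N. R (2 * k + j))"
      by (auto simp: less_Suc_eq)
    finally show ?case .
  qed simp
  have sumfin: "(\<Sum>k. hausdorff1_outer (R (2 * k + j))) \<le> hausdorff1_outer A" for j
  proof (rule suminf_le_const)
    fix N
    have "hausdorff1_outer (\<Union>k<N. R (2 * k + j)) \<le> hausdorff1_outer A"
      by (rule hausdorff1_outer_mono) (auto simp: R_def)
    then show "sum (\<lambda>k. hausdorff1_outer (R (2 * k + j))) {..<N} \<le> hausdorff1_outer A"
      using lin[of j N] by simp
  qed auto
  define f where "f k = hausdorff1_outer (R (2 * k)) + hausdorff1_outer (R (2 * k + 1))" for k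
  have "(\<Sum>k. f k) = (\<Sum>k. hausdorff1_outer (R (2 * k))) + (\<Sum>k. hausdorff1_outer (R (2 * k + 1)))"
    unfolding f_def by (rule suminf_add[symmetric]) auto
  also have "\<dots> \<le> hausdorff1_outer A + hausdorff1_outer A"
    using sumfin[of 0] sumfin[of 1] by (intro add_mono) auto
  finally have ffin: "(\<Sum>k. f k) < top"
    using fin by (auto simp: ennreal_add_eq_top less_top[symmetric] top_unique)
  have cover: "A - F \<subseteq> D (2 * n) \<union> ((\<Union>k. R (2 * (k + n))) \<union> (\<Union>k. R (2 * (k + n) + 1)))" for n
  proof
    fix x assume x: "x \<in> A - F"
    then have "0 < infdist x F"
      using F Fne by (simp add: infdist_pos_not_in_closed)
    then obtain j0 where "inverse (real (Suc j0)) < infdist x F"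
      using reals_Archimedean by blast
    then have ex: "1 / real (Suc j0) \<le> infdist x F" by (simp add: inverse_eq_divide)
    define j where "j = (LEAST j. 1 / real (Suc j) \<le> infdist x F)"
    have j: "1 / real (Suc j) \<le> infdist x F" unfolding j_def using ex by (rule LeastI[of "\<lambda>j. 1 / real (Suc j) \<le> infdist x F"])
    show "x \<in> D (2 * n) \<union> ((\<Union>k. R (2 * (k + n))) \<union> (\<Union>k. R (2 * (k + n) + 1)))"
    proof (cases "j \<le> 2 * n")
      case True
      then have "1 / real (Suc (2 * n)) \<le> 1 / real (Suc j)" by (intro divide_left_mono) auto
      then show ?thesis using j x by (auto simp: D_def)
    next
      case False
      then obtain i where i: "j = Suc (i + 2 * n)" by (metis add.commute less_iff_Suc_add not_le)
      then have "\<not> 1 / real (Suc (i + 2 * n)) \<le> infdist x F"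
        using not_less_Least[of "i + 2 * n" "\<lambda>j. 1 / real (Suc j) \<le> infdist x F"] by (simp add: j_def)
      then have R: "x \<in> R (i + 2 * n)" using j i x by (auto simp: R_def)
      have "i = 2 * (i div 2) \<or> i = 2 * (i div 2) + 1" by presburger
      then have "x \<in> R (2 * (i div 2 + n)) \<or> x \<in> R (2 * (i div 2 + n) + 1)"
      proof
        assume "i = 2 * (i div 2)"
        then have "i + 2 * n = 2 * (i div 2 + n)" by presburger
        then show ?thesis using R by metis
      next
        assume "i = 2 * (i div 2) + 1"
        then have "i + 2 * n = 2 * (i div 2 + n) + 1" by presburger
        then show ?thesis using R by metis
      qed
      then show ?thesis by blast
    qed
  qed
  have near: "hausdorff1_outer (A - F) \<le> hausdorff1_outer (D (2 * n)) + (\<Sum>k. f (k + n))" for n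
  proof -
    have "hausdorff1_outer (A - F) \<le> hausdorff1_outer (D (2 * n)) +
        (hausdorff1_outer (\<Union>k. R (2 * (k + n))) + hausdorff1_outer (\<Union>k. R (2 * (k + n) + 1)))"
      using hausdorff1_outer_mono[OF cover[of n]] hausdorff1_outer_Un order_trans add_left_mono by meson
    also have "\<dots> \<le> hausdorff1_outer (D (2 * n)) +
        ((\<Sum>k. hausdorff1_outer (R (2 * (k + n)))) + (\<Sum>k. hausdorff1_outer (R (2 * (k + n) + 1))))"
      by (intro add_mono hausdorff1_outer_UN order_refl)
    also have "(\<Sum>k. hausdorff1_outer (R (2 * (k + n)))) + (\<Sum>k. hausdorff1_outer (R (2 * (k + n) + 1)))
        = (\<Sum>k. f (k + n))"
      unfolding f_def by (rule suminf_add) auto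
    finally show ?thesis .
  qed
  have far: "hausdorff1_outer (A \<inter> F) + hausdorff1_outer (D n) \<le> hausdorff1_outer A" for n
  proof -
    have "hausdorff1_outer (A \<inter> F) + hausdorff1_outer (D n) \<le> hausdorff1_outer (A \<inter> F \<union> D n)"
    proof (rule hausdorff1_outer_separated)
      fix x y assume "x \<in> A \<inter> F" "y \<in> D n"
      then show "1 / real (Suc n) \<le> dist x y"
        using infdist_le[of x F y] by (auto simp: D_def dist_commute)
    qed simp
    also have "\<dots> \<le> hausdorff1_outer A" by (rule hausdorff1_outer_mono) (auto simp: D_def)
    finally show ?thesis .
  qed
  show ?thesis
  proof (rule ennreal_le_epsilon)
    fix e :: real assume "0 < e"
    then obtain n where n: "(\<Sum>k. f (k + n)) \<le> ennreal e" using suminf_ennreal_tail[OF ffin] by blast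
    have "hausdorff1_outer (A \<inter> F) + hausdorff1_outer (A - F)
        \<le> hausdorff1_outer (A \<inter> F) + (hausdorff1_outer (D (2 * n)) + ennreal e)"
      using near[of n] n by (intro add_left_mono) (meson add_left_mono order_trans)
    also have "\<dots> \<le> hausdorff1_outer A + ennreal e"
      using far[of "2 * n"] by (simp add: add.assoc[symmetric] add_right_mono)
    finally show "hausdorff1_outer (A \<inter> F) + hausdorff1_outer (A - F) \<le> hausdorff1_outer A + ennreal e" .
  qed
qed

lemma sets_length_measure [simp, measurable_cong]: "sets length_measure = sets borel"
  using sigma_algebra.sets_measure_of_eq[of UNIV "sets borel"] sets.sigma_algebra_axioms[of borel]
  by (simp add: length_measure_def)

lemma space_length_measure [simp]: "space length_measure = UNIV"
  by (simp add: length_measure_def space_measure_of_conv)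

text \<open>The value of \<open>measure_of\<close> is the given set function only if that is countably additive on
  the Borel sets. They are generated by the closed sets, which satisfy Caratheodory's criterion.\<close>

lemma emeasure_length_measure:
  fixes A :: "'a::metric_space set"
  assumes A: "A \<in> sets borel"
  shows "emeasure length_measure A = hausdorff1_outer A"
proof -
  let ?H = "hausdorff1_outer :: 'a set \<Rightarrow> ennreal"
  let ?L = "lambda_system UNIV (Pow UNIV) ?H"
  interpret P: sigma_algebra UNIV "Pow UNIV :: 'a set set" by (rule sigma_algebra_Pow)
  have ms: "measure_space UNIV ?L ?H"
    by (rule P.caratheodory_lemma[OF outer_measure_space_hausdorff1])
  then interpret L: sigma_algebra UNIV ?L by (simp add: measure_space_def)
  have "F \<in> ?L" if "closed F" for F
  proof -
    have "?H (E \<inter> F) + ?H (E - F) = ?H E" for E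
    proof (rule antisym)
      show "?H E \<le> ?H (E \<inter> F) + ?H (E - F)"
        using hausdorff1_outer_Un[of "E \<inter> F" "E - F"] by (simp add: Int_Diff_Un)
    qed (rule hausdorff1_outer_split_closed[OF that])
    then show ?thesis unfolding P.lambda_system_eq by auto
  qed
  then have "sets (borel :: 'a measure) \<subseteq> ?L"
    unfolding borel_eq_closed
    by (metis L.sigma_sets_subset mem_Collect_eq sets_measure_of subsetI top_greatest Pow_UNIV)
  then have "measure_space UNIV (sets (borel :: 'a measure)) ?H"
    using measure_down[OF ms _ ] sets.sigma_algebra_axioms[of "borel :: 'a measure"] by simp
  then show ?thesis
    using A unfolding length_measure_def measure_space_def
    by (intro emeasure_measure_of_sigma) auto
qed

subsection \<open>Lipschitz images and the real line\<close>

lemma hausdorff1_outer_lipschitz_image: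
  fixes f :: "'a::metric_space \<Rightarrow> 'b::metric_space"
  assumes K: "K > 0" and lip: "\<And>x y. x \<in> E \<Longrightarrow> y \<in> E \<Longrightarrow> dist (f x) (f y) \<le> K * dist x y"
  shows "hausdorff1_outer (f ` E) \<le> ennreal K * hausdorff1_outer E"
proof (rule hausdorff1_outer_le)
  fix \<delta> :: real assume \<delta>: "\<delta> > 0"
  have "hausdorff1_delta \<delta> (f ` E) \<le> ennreal K * hausdorff1_delta (\<delta> / K) E"
  proof -
    have "hausdorff1_delta \<delta> (f ` E) \<le> ennreal K * (\<Sum>i. ennreal (diameter (C i)))"
      if C: "E \<subseteq> (\<Union>i. C i)" "\<And>i. bounded (C i)" "\<And>i. diameter (C i) \<le> \<delta> / K" for C :: "nat \<Rightarrow> 'a set"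
    proof -
      have dist: "dist u v \<le> K * diameter (C i)" if uv: "u \<in> f ` (C i \<inter> E)" "v \<in> f ` (C i \<inter> E)" for i u v
      proof -
        obtain x y where "u = f x" "v = f y" "x \<in> C i" "y \<in> C i" "x \<in> E" "y \<in> E" using uv by auto
        then have "dist u v \<le> K * dist x y" "dist x y \<le> diameter (C i)"
          using lip diameter_bounded_bound[OF C(2)] by auto
        then show ?thesis using K by (meson mult_left_mono less_imp_le order_trans)
      qed
      have diam0: "0 \<le> K * diameter (C i)" for i using K diameter_ge_0[OF C(2)] by simp
      have diam: "diameter (f ` (C i \<inter> E)) \<le> K * diameter (C i)" for i
      proof (cases "f ` (C i \<inter> E) = {}")
        case False
        then show ?thesis
          unfolding diameter_def[of "f ` (C i \<inter> E)"] using dist[of _ i] by (auto intro!: cSUP_least)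
      qed (use diam0 in simp)
      have bdd: "bounded (f ` (C i \<inter> E))" for i
        unfolding bounded_two_points using dist by blast
      have "hausdorff1_delta \<delta> (f ` E) \<le> (\<Sum>i. ennreal (diameter (f ` (C i \<inter> E))))"
      proof (rule hausdorff1_delta_le_cover)
        show "f ` E \<subseteq> (\<Union>i. f ` (C i \<inter> E))" using C(1) by blast
        fix i
        have "K * diameter (C i) \<le> \<delta>" using C(3)[of i] K by (simp add: field_simps)
        then show "diameter (f ` (C i \<inter> E)) \<le> \<delta>" using diam[of i] by simp
      qed (rule bdd)
      also have "\<dots> \<le> (\<Sum>i. ennreal K * ennreal (diameter (C i)))"
        using diam K diameter_ge_0[OF C(2)]
        by (intro suminf_le) (auto simp: ennreal_mult[symmetric] intro!: ennreal_leI)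
      finally show ?thesis by simp
    qed
    then have "hausdorff1_delta \<delta> (f ` E) / ennreal K \<le> hausdorff1_delta (\<delta> / K) E"
      using K unfolding hausdorff1_delta_def[of "\<delta> / K"]
      by (intro INF_greatest) (auto intro!: divide_le_posI_ennreal simp: mult.commute)
    then have "ennreal K * (hausdorff1_delta \<delta> (f ` E) / ennreal K) \<le> ennreal K * hausdorff1_delta (\<delta> / K) E"
      by (rule mult_left_mono) simp
    moreover have "ennreal K * (hausdorff1_delta \<delta> (f ` E) / ennreal K) = hausdorff1_delta \<delta> (f ` E)"
      using K by (simp add: ennreal_times_divide mult.commute[of "ennreal K"] mult_divide_eq_ennreal)
    ultimately show ?thesis by simp
  qed
  also have "\<dots> \<le> ennreal K * hausdorff1_outer E"
    using \<delta> K by (intro mult_left_mono hausdorff1_delta_le_outer) auto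
  finally show "hausdorff1_delta \<delta> (f ` E) \<le> ennreal K * hausdorff1_outer E" .
qed

text \<open>A bounded set of reals lies in a closed interval whose length is the diameter of the set.\<close>

lemma lborel_le_hausdorff1:
  fixes E :: "real set"
  assumes E: "E \<in> sets borel"
  shows "emeasure lborel E \<le> hausdorff1_outer E"
proof -
  have "emeasure lborel E \<le> (\<Sum>i. ennreal (diameter (C i)))"
    if C: "E \<subseteq> (\<Union>i. C i)" "\<And>i. bounded (C i)" for C :: "nat \<Rightarrow> real set"
  proof -
    have "\<exists>J\<in>sets borel. C i \<subseteq> J \<and> emeasure lborel J \<le> ennreal (diameter (C i))" for i
    proof (cases "C i = {}")
      case False
      let ?K = "closure (C i)"
      have K: "compact ?K" "?K \<noteq> {}" using C(2)[of i] False by auto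
      obtain a where a: "a \<in> ?K" "\<And>x. x \<in> ?K \<Longrightarrow> a \<le> x" using compact_attains_inf[OF K] by auto
      obtain b where b: "b \<in> ?K" "\<And>x. x \<in> ?K \<Longrightarrow> x \<le> b" using compact_attains_sup[OF K] by auto
      have "b - a \<le> diameter ?K"
        using diameter_bounded_bound[OF bounded_closure[OF C(2)] b(1) a(1)] by (simp add: dist_real_def)
      then have "b - a \<le> diameter (C i)" by (simp add: diameter_closure C(2))
      moreover have "a \<le> b" using a b by auto
      moreover have "C i \<subseteq> {a..b}" using a b closure_subset[of "C i"] by auto
      ultimately show ?thesis by (intro bexI[of _ "{a..b}"]) (auto intro: ennreal_leI)
    qed (auto intro!: bexI[of _ "{}"])
    then obtain J where J: "\<And>i. J i \<in> sets borel" "\<And>i. C i \<subseteq> J i"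
      "\<And>i. emeasure lborel (J i) \<le> ennreal (diameter (C i))" by metis
    have "emeasure lborel E \<le> emeasure lborel (\<Union>i. J i)"
      using C(1) J by (intro emeasure_mono) (auto, blast)
    also have "\<dots> \<le> (\<Sum>i. emeasure lborel (J i))"
      by (rule emeasure_subadditive_countably) (use J in auto)
    also have "\<dots> \<le> (\<Sum>i. ennreal (diameter (C i)))"
      by (intro suminf_le) (use J in auto)
    finally show ?thesis .
  qed
  then have "emeasure lborel E \<le> hausdorff1_delta 1 E"
    unfolding hausdorff1_delta_def by (intro INF_greatest) auto
  also have "\<dots> \<le> hausdorff1_outer E" by (rule hausdorff1_delta_le_outer) simp
  finally show ?thesis .
qed

lemma hausdorff1_interval_le:
  fixes l u :: real
  assumes lu: "l \<le> u"
  shows "hausdorff1_outer {l<..<u} \<le> ennreal (u - l)"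
proof (rule hausdorff1_outer_le)
  fix \<delta> :: real assume \<delta>: "\<delta> > 0"
  obtain n where n: "(u - l) / \<delta> < real n" "n > 0"
    using reals_Archimedean2[of "max 1 ((u - l) / \<delta>)"] by auto
  define w where "w = (u - l) / real n"
  have w: "0 \<le> w" "w \<le> \<delta>" "real n * w = u - l"
    using n \<delta> lu by (auto simp: w_def field_simps)
  define C where "C i = (if i < n then {l + real i * w .. l + (real i + 1) * w} else {})" for i
  have diam: "diameter (C i) = (if i < n then w else 0)" for i
    using w by (auto simp: C_def algebra_simps)
  have "hausdorff1_delta \<delta> {l<..<u} \<le> (\<Sum>i. ennreal (diameter (C i)))"
  proof (rule hausdorff1_delta_le_cover)
    show "{l<..<u} \<subseteq> (\<Union>i. C i)"
    proof
      fix x assume x: "x \<in> {l<..<u}"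
      then have "w > 0" using w n lu by (auto simp: w_def)
      define i where "i = nat \<lfloor>(x - l) / w\<rfloor>"
      have i: "real i \<le> (x - l) / w" "(x - l) / w < real i + 1"
        using x \<open>w > 0\<close> by (auto simp: i_def of_nat_nat)
      have "real i * w \<le> x - l" using i \<open>w > 0\<close> by (simp add: pos_le_divide_eq)
      then have "real i * w < real n * w" using x w(3) by auto
      then have "i < n" using \<open>w > 0\<close> by simp
      then have "x \<in> C i" using i \<open>w > 0\<close> by (auto simp: C_def field_simps)
      then show "x \<in> (\<Union>i. C i)" by blast
    qed
    show "diameter (C i) \<le> \<delta>" for i using w \<delta> by (simp add: diam)
  qed (simp add: C_def)
  also have "\<dots> = (\<Sum>i<n. ennreal w)"
    unfolding diam by (subst suminf_finite[of "{..<n}"]) auto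
  also have "\<dots> = ennreal (u - l)"
    using w by (simp add: ennreal_of_nat_eq_real_of_nat ennreal_mult'[symmetric])
  finally show "hausdorff1_delta \<delta> {l<..<u} \<le> ennreal (u - l)" .
qed

text \<open>Fixes the normalisation: with the diameter as gauge no constant enters, and boundary
  integrals can be compared with Lebesgue integrals over a parameter.\<close>

lemma length_measure_real: "(length_measure :: real measure) = lborel"
proof (rule lborel_eqI[symmetric])
  fix l u :: real assume "\<And>b. b \<in> Basis \<Longrightarrow> l \<bullet> b \<le> u \<bullet> b"
  then have lu: "l \<le> u" by simp
  then have "hausdorff1_outer {l<..<u} = ennreal (u - l)"
    using lborel_le_hausdorff1[of "{l<..<u}"] hausdorff1_interval_le[of l u] by (simp add: antisym)
  then show "emeasure length_measure (box l u) = ennreal (\<Prod>b\<in>Basis. (u - l) \<bullet> b)"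
    using lu by (simp add: emeasure_length_measure box_real)
qed simp

lemma hausdorff1_outer_real: "E \<in> sets borel \<Longrightarrow> hausdorff1_outer E = emeasure lborel (E :: real set)"
  using emeasure_length_measure[of E] by (simp add: length_measure_real)

text \<open>Arc length integrals along a curve are compared with integrals over the parameter;
  the two estimates coincide for a straight line parametrised by arc length.\<close>

lemma nn_integral_length_le_param:
  fixes T :: "real \<Rightarrow> 'b::metric_space"
  assumes K: "K > 0" and lip: "\<And>x y. x \<in> I \<Longrightarrow> y \<in> I \<Longrightarrow> dist (T x) (T y) \<le> K * dist x y"
    and [measurable]: "T \<in> borel_measurable borel" "I \<in> sets borel" "\<Gamma> \<in> sets borel"
    and sub: "\<Gamma> \<subseteq> T ` I"
    and F: "F \<in> borel_measurable borel"
  shows "(\<integral>\<^sup>+x\<in>\<Gamma>. F x \<partial>length_measure) \<le> ennreal K * (\<integral>\<^sup>+s\<in>I. F (T s) \<partial>lborel)"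
proof -
  note F[measurable]
  let ?M = "density length_measure (indicator \<Gamma>)"
  let ?N = "density (distr (density lborel (indicator I)) borel T) (\<lambda>_. ennreal K)"
  have le: "emeasure ?M A \<le> emeasure ?N A" if "A \<in> sets ?M" for A
  proof -
    have A[measurable]: "A \<in> sets borel" using that by simp
    have [measurable]: "T -` A \<in> sets borel" using measurable_sets[OF assms(3) A] by simp
    have "emeasure ?M A = hausdorff1_outer (\<Gamma> \<inter> A)"
      by (simp add: emeasure_density nn_integral_indicator' emeasure_length_measure flip: indicator_inter_arith
           emeasure_length_measure)
    also have "\<dots> \<le> hausdorff1_outer (T ` (I \<inter> T -` A))"
      by (rule hausdorff1_outer_mono) (use sub in auto)
    also have "\<dots> \<le> ennreal K * hausdorff1_outer (I \<inter> T -` A)"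
      by (rule hausdorff1_outer_lipschitz_image[OF K]) (use lip in auto)
    also have "hausdorff1_outer (I \<inter> T -` A) = emeasure lborel (I \<inter> T -` A)"
      by (rule hausdorff1_outer_real) simp
    also have "ennreal K * emeasure lborel (I \<inter> T -` A) = emeasure ?N A"
      by (simp add: emeasure_density emeasure_distr nn_integral_cmult_indicator flip: indicator_inter_arith)
    finally show ?thesis .
  qed
  have "(\<integral>\<^sup>+x\<in>\<Gamma>. F x \<partial>length_measure) = (\<integral>\<^sup>+x. F x \<partial>?M)"
    by (subst nn_integral_density) (auto simp: mult.commute)
  also have "\<dots> \<le> (\<integral>\<^sup>+x. F x \<partial>?N)"
    by (rule nn_integral_mono_measure) (use le in \<open>auto simp: le_measure\<close>)
  also have "\<dots> = ennreal K * (\<integral>\<^sup>+s\<in>I. F (T s) \<partial>lborel)"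
    by (simp add: nn_integral_density nn_integral_distr nn_integral_cmult mult.commute)
  finally show ?thesis .
qed

lemma nn_integral_param_le_length:
  fixes T :: "real \<Rightarrow> 'b::metric_space"
  assumes exp: "\<And>x y. x \<in> I \<Longrightarrow> y \<in> I \<Longrightarrow> dist x y \<le> dist (T x) (T y)"
    and [measurable]: "T \<in> borel_measurable borel" "I \<in> sets borel" "\<Gamma> \<in> sets borel"
    and sub: "T ` I \<subseteq> \<Gamma>"
    and F: "F \<in> borel_measurable borel"
  shows "(\<integral>\<^sup>+s\<in>I. F (T s) \<partial>lborel) \<le> (\<integral>\<^sup>+x\<in>\<Gamma>. F x \<partial>length_measure)"
proof -
  note F[measurable]
  let ?M = "density length_measure (indicator \<Gamma>)"
  let ?N = "distr (density lborel (indicator I)) borel T"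
  have inj: "inj_on T I" using exp by (force simp: inj_on_def)
  have le: "emeasure ?N A \<le> emeasure ?M A" if "A \<in> sets ?N" for A
  proof -
    have A[measurable]: "A \<in> sets borel" using that by simp
    have [measurable]: "T -` A \<in> sets borel" using measurable_sets[OF assms(2) A] by simp
    let ?E = "I \<inter> T -` A"
    have "emeasure ?N A = emeasure lborel ?E"
      by (simp add: emeasure_density emeasure_distr flip: indicator_inter_arith)
    also have "\<dots> = hausdorff1_outer ?E" by (rule hausdorff1_outer_real[symmetric]) simp
    also have "?E = inv_into I T ` (T ` ?E)" using inj by (force simp: image_image)
    also have "hausdorff1_outer \<dots> \<le> ennreal 1 * hausdorff1_outer (T ` ?E)"
      by (rule hausdorff1_outer_lipschitz_image) (use exp inj in auto)
    also have "\<dots> \<le> hausdorff1_outer (\<Gamma> \<inter> A)"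
      using sub by (auto intro!: hausdorff1_outer_mono)
    also have "\<dots> = emeasure ?M A"
      by (simp add: emeasure_density nn_integral_indicator' emeasure_length_measure flip: indicator_inter_arith
           emeasure_length_measure)
    finally show ?thesis .
  qed
  have "(\<integral>\<^sup>+s\<in>I. F (T s) \<partial>lborel) = (\<integral>\<^sup>+x. F x \<partial>?N)"
    by (simp add: nn_integral_density nn_integral_distr mult.commute)
  also have "\<dots> \<le> (\<integral>\<^sup>+x. F x \<partial>?M)"
    by (rule nn_integral_mono_measure) (use le in \<open>auto simp: le_measure\<close>)
  also have "\<dots> = (\<integral>\<^sup>+x\<in>\<Gamma>. F x \<partial>length_measure)"
    by (subst nn_integral_density) (auto simp: mult.commute)
  finally show ?thesis .
qed

section \<open>Lipschitz graph coordinates\<close>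

definition orthoframe :: "real^2 \<Rightarrow> real^2 \<Rightarrow> bool" where
  "orthoframe e f \<longleftrightarrow> norm e = 1 \<and> norm f = 1 \<and> e \<bullet> f = 0"

text \<open>The height \<open>t\<close> is measured from the graph, which becomes the line \<open>t = 0\<close>; the fibres
  \<open>s = const\<close> are straight and run at unit speed in the direction \<open>f\<close>.\<close>

definition chart :: "real^2 \<Rightarrow> real^2 \<Rightarrow> real^2 \<Rightarrow> (real \<Rightarrow> real) \<Rightarrow> real \<Rightarrow> real \<Rightarrow> real^2" where
  "chart p e f \<gamma> s t = p + s *\<^sub>R e + (\<gamma> s + t) *\<^sub>R f"

text \<open>The image of \<open>I \<times> J\<close> under the chart, described through the inverse coordinates so that
  openness and measurability can be read off.\<close>

definition chart_box ::
    "real^2 \<Rightarrow> real^2 \<Rightarrow> real^2 \<Rightarrow> (real \<Rightarrow> real) \<Rightarrow> real set \<Rightarrow> real set \<Rightarrow> (real^2) set" where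
  "chart_box p e f \<gamma> I J = {x. (x - p) \<bullet> e \<in> I \<and> (x - p) \<bullet> f - \<gamma> ((x - p) \<bullet> e) \<in> J}"

lemma orthoframe_inner:
  assumes "orthoframe e f"
  shows "e \<bullet> e = 1" "f \<bullet> f = 1" "e \<bullet> f = 0" "f \<bullet> e = 0"
  using assms by (auto simp: orthoframe_def norm_eq_1 inner_commute)

lemma orthoframe_expand:
  assumes "orthoframe e f"
  shows "(x \<bullet> e) *\<^sub>R e + (x \<bullet> f) *\<^sub>R f = x"
proof -
  define a b c d where "a = e $ 1" "b = e $ 2" "c = f $ 1" "d = f $ 2"
  note abcd = this
  have r: "a\<^sup>2 + b\<^sup>2 = 1" "c\<^sup>2 + d\<^sup>2 = 1" "a * c + b * d = 0"
    using orthoframe_inner[OF assms] by (auto simp: inner_vec_def sum_2 abcd power2_eq_square)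
  have ac: "a\<^sup>2 + c\<^sup>2 = 1"
  proof -
    have "(a * c)\<^sup>2 = (b * d)\<^sup>2" using r(3) by (simp add: add_eq_0_iff)
    moreover have "b\<^sup>2 = 1 - a\<^sup>2" "d\<^sup>2 = 1 - c\<^sup>2" using r by auto
    ultimately have "a\<^sup>2 * c\<^sup>2 = (1 - a\<^sup>2) * (1 - c\<^sup>2)" by (simp add: power_mult_distrib)
    then show ?thesis by (simp add: algebra_simps)
  qed
  have bd: "b\<^sup>2 + d\<^sup>2 = 1" using r ac by simp
  have "(a * b + c * d)\<^sup>2 = 0"
  proof -
    have "a * c = - (b * d)" using r by simp
    then have ab: "(a * c) * (b * d) = - (b\<^sup>2 * d\<^sup>2)" by (simp add: power2_eq_square)
    have "(a * b + c * d)\<^sup>2 = a\<^sup>2 * b\<^sup>2 + c\<^sup>2 * d\<^sup>2 + 2 * ((a * c) * (b * d))"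
      by (simp add: power2_eq_square algebra_simps)
    also have "\<dots> = a\<^sup>2 * b\<^sup>2 + c\<^sup>2 * d\<^sup>2 - 2 * (b\<^sup>2 * d\<^sup>2)" unfolding ab by simp
    also have "\<dots> = (1 - b\<^sup>2) * b\<^sup>2 + (1 - d\<^sup>2) * d\<^sup>2 - 2 * (b\<^sup>2 * d\<^sup>2)"
    proof -
      have "a\<^sup>2 = 1 - b\<^sup>2" "c\<^sup>2 = 1 - d\<^sup>2" using r by auto
      then show ?thesis by (simp only:)
    qed
    also have "\<dots> = (b\<^sup>2 + d\<^sup>2) - (b\<^sup>2 + d\<^sup>2)\<^sup>2" by (simp add: power2_eq_square algebra_simps)
    finally show ?thesis by (simp add: bd)
  qed
  then have off: "a * b + c * d = 0" by simp
  have "(x \<bullet> e) * a + (x \<bullet> f) * c = x $ 1 * (a\<^sup>2 + c\<^sup>2) + x $ 2 * (a * b + c * d)"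
    by (simp add: inner_vec_def sum_2 abcd power2_eq_square algebra_simps)
  moreover have "(x \<bullet> e) * b + (x \<bullet> f) * d = x $ 1 * (a * b + c * d) + x $ 2 * (b\<^sup>2 + d\<^sup>2)"
    by (simp add: inner_vec_def sum_2 abcd power2_eq_square algebra_simps)
  ultimately show ?thesis by (simp add: vec_eq_iff forall_2 ac bd off flip: abcd)
qed

lemma norm_orthoframe:
  assumes "orthoframe e f"
  shows "(norm x)\<^sup>2 = (x \<bullet> e)\<^sup>2 + (x \<bullet> f)\<^sup>2"
proof -
  have "(norm x)\<^sup>2 = x \<bullet> ((x \<bullet> e) *\<^sub>R e + (x \<bullet> f) *\<^sub>R f)"
    unfolding orthoframe_expand[OF assms] by (rule power2_norm_eq_inner)
  then show ?thesis by (simp add: inner_add_right power2_eq_square)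
qed

lemma chart_coords:
  assumes "orthoframe e f"
  shows "(chart p e f \<gamma> s t - p) \<bullet> e = s" "(chart p e f \<gamma> s t - p) \<bullet> f = \<gamma> s + t"
  by (simp_all add: chart_def inner_add_left orthoframe_inner[OF assms])

lemma chart_inverse:
  assumes "orthoframe e f"
  shows "chart p e f \<gamma> ((x - p) \<bullet> e) ((x - p) \<bullet> f - \<gamma> ((x - p) \<bullet> e)) = x"
  using orthoframe_expand[OF assms, of "x - p"] by (simp add: chart_def algebra_simps)

lemma chart_in_box:
  assumes "orthoframe e f"
  shows "chart p e f \<gamma> s t \<in> chart_box p e f \<gamma> I J \<longleftrightarrow> s \<in> I \<and> t \<in> J"
  by (simp add: chart_box_def chart_coords[OF assms])

lemma chart_box_image:
  assumes "orthoframe e f"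
  shows "chart_box p e f \<gamma> I J = {chart p e f \<gamma> s t |s t. s \<in> I \<and> t \<in> J}"
  using chart_inverse[OF assms, of p \<gamma>] chart_in_box[OF assms, of p \<gamma> _ _ I J]
  by (auto simp: chart_box_def; metis)

lemma open_chart_box:
  assumes "continuous_on UNIV \<gamma>" "open I" "open J"
  shows "open (chart_box p e f \<gamma> I J)"
proof -
  have c: "continuous_on UNIV (\<lambda>x. (x - p) \<bullet> e)" by (intro continuous_intros)
  have d: "continuous_on UNIV (\<lambda>x. (x - p) \<bullet> f - \<gamma> ((x - p) \<bullet> e))"
    by (intro continuous_intros continuous_on_compose2[OF assms(1)]) auto
  show ?thesis
    using open_vimage[OF assms(2) c] open_vimage[OF assms(3) d]
    by (simp add: chart_box_def vimage_def Collect_conj_eq open_Int)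
qed

lemma borel_chart_box [measurable]:
  assumes [measurable]: "\<gamma> \<in> borel_measurable borel" "I \<in> sets borel" "J \<in> sets borel"
  shows "chart_box p e f \<gamma> I J \<in> sets borel"
  unfolding chart_box_def by measurable

lemma borel_measurable_chart [measurable]:
  assumes [measurable]: "\<gamma> \<in> borel_measurable borel" "s \<in> borel_measurable M" "t \<in> borel_measurable M"
  shows "(\<lambda>x. chart p e f \<gamma> (s x) (t x)) \<in> borel_measurable M"
  unfolding chart_def by measurable

subsection \<open>Area in orthonormal and graph coordinates\<close>

lemma lborel_orthogonal_distr:
  fixes R :: "real^2 \<Rightarrow> real^2"
  assumes R: "orthogonal_transformation R"
  shows "distr lborel borel R = lborel"
proof (rule lborel_eqI[symmetric])
  fix l u :: "real^2"
  assume le: "\<And>b. b \<in> Basis \<Longrightarrow> l \<bullet> b \<le> u \<bullet> b"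
  obtain S where S: "orthogonal_transformation S" "\<And>x. S (R x) = x" "\<And>x. R (S x) = x"
    using orthogonal_transformation_inv[OF R] orthogonal_transformation_bij[OF R]
    by (metis bij_inv_eq_iff)
  have lin: "linear R" using R by (rule orthogonal_transformation_linear)
  have cont: "continuous_on UNIV R" using lin by (simp add: linear_continuous_on linear_linear)
  have meas: "R \<in> borel_measurable borel" by (rule borel_measurable_continuous_onI[OF cont])
  have eq: "R -` box l u = S ` box l u" using S by (auto simp: image_iff) metis
  have op: "open (R -` box l u)" using cont by (intro open_vimage) auto
  have "emeasure (distr lborel borel R) (box l u) = emeasure lborel (R -` box l u)"
    by (subst emeasure_distr) (use meas in auto)
  also have "\<dots> = ennreal (measure lebesgue (S ` box l u))"
  proof -
    have m: "S ` box l u \<in> lmeasurable" by (rule measurable_orthogonal_image[OF S(1)]) simp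
    have "emeasure lborel (R -` box l u) = emeasure lebesgue (R -` box l u)" using op by simp
    then show ?thesis using m unfolding eq by (simp add: emeasure_eq_measure2 fmeasurableD2)
  qed
  also have "\<dots> = ennreal (measure lebesgue (box l u))"
    by (subst measure_orthogonal_image[OF S(1)]) auto
  also have "\<dots> = (\<Prod>b\<in>Basis. (u - l) \<bullet> b)"
    using le by (simp add: measure_lborel_box_eq)
  finally show "emeasure (distr lborel borel R) (box l u) = ennreal (\<Prod>b\<in>Basis. (u - l) \<bullet> b)" .
qed simp

lemma lborel_pair_axes:
  "distr (lborel \<Otimes>\<^sub>M lborel) borel (\<lambda>(s, t). s *\<^sub>R axis 1 1 + t *\<^sub>R axis 2 1 :: real^2) = lborel"
proof (rule lborel_eqI[symmetric])
  let ?g = "\<lambda>(s, t). s *\<^sub>R axis 1 1 + t *\<^sub>R axis 2 1 :: real^2"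
  fix l u :: "real^2"
  assume le: "\<And>b. b \<in> Basis \<Longrightarrow> l \<bullet> b \<le> u \<bullet> b"
  have le2: "l $ i \<le> u $ i" for i using le[of "axis i 1"] by (simp add: inner_axis axis_in_Basis_iff)
  have "?g -` box l u \<inter> space (lborel \<Otimes>\<^sub>M lborel) = {l $ 1 <..< u $ 1} \<times> {l $ 2 <..< u $ 2}"
    by (auto simp: mem_box_cart forall_2 axis_def space_pair_measure)
  then have "emeasure (distr (lborel \<Otimes>\<^sub>M lborel) borel ?g) (box l u)
      = emeasure (lborel \<Otimes>\<^sub>M lborel) ({l $ 1 <..< u $ 1} \<times> {l $ 2 <..< u $ 2})"
    by (subst emeasure_distr) (auto simp: split_beta')
  also have "\<dots> = ennreal (u $ 1 - l $ 1) * ennreal (u $ 2 - l $ 2)"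
    using le2 by (subst lborel.emeasure_pair_measure_Times) auto
  also have "\<dots> = ennreal (\<Prod>b\<in>Basis. (u - l) \<bullet> b)"
  proof -
    have B: "(Basis :: (real^2) set) = {axis 1 1, axis 2 1}"
      by (auto simp: Basis_vec_def exhaust_2 UNIV_2)
    have "axis 1 (1::real) \<noteq> (axis 2 1 :: real^2)" by (simp add: axis_eq_axis)
    then have "(\<Prod>b\<in>Basis. (u - l) \<bullet> b) = (u $ 1 - l $ 1) * (u $ 2 - l $ 2)"
      unfolding B by (simp add: inner_axis)
    then show ?thesis using le2 by (simp add: ennreal_mult)
  qed
  finally show "emeasure (distr (lborel \<Otimes>\<^sub>M lborel) borel ?g) (box l u) = ennreal (\<Prod>b\<in>Basis. (u - l) \<bullet> b)" .
qed simp

lemma nn_integral_orthoframe: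
  fixes F :: "real^2 \<Rightarrow> ennreal"
  assumes ef: "orthoframe e f" and F[measurable]: "F \<in> borel_measurable borel"
  shows "(\<integral>\<^sup>+x. F x \<partial>lborel) = (\<integral>\<^sup>+s. \<integral>\<^sup>+t. F (p + s *\<^sub>R e + t *\<^sub>R f) \<partial>lborel \<partial>lborel)"
proof -
  define R where "R x = (x $ 1) *\<^sub>R e + (x $ 2) *\<^sub>R f" for x :: "real^2"
  have lin: "linear R" by (rule linearI) (simp_all add: R_def algebra_simps)
  have "norm (R x) = norm x" for x
  proof -
    have "(norm (R x))\<^sup>2 = (x $ 1)\<^sup>2 + (x $ 2)\<^sup>2"
      unfolding norm_orthoframe[OF ef] R_def by (simp add: inner_add_left orthoframe_inner[OF ef])
    also have "\<dots> = (norm x)\<^sup>2"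
      unfolding power2_norm_eq_inner by (simp add: inner_vec_def sum_2 power2_eq_square)
    finally show ?thesis by simp
  qed
  then have R: "orthogonal_transformation R" using lin by (simp add: orthogonal_transformation)
  have Rm[measurable]: "R \<in> borel_measurable borel"
    using lin by (intro borel_measurable_continuous_onI) (simp add: linear_continuous_on linear_linear)
  have "(\<integral>\<^sup>+x. F x \<partial>lborel) = (\<integral>\<^sup>+x. F x \<partial>distr lborel borel ((+) p))"
    by (simp add: lborel_distr_plus)
  also have "\<dots> = (\<integral>\<^sup>+x. F (p + x) \<partial>lborel)" by (simp add: nn_integral_distr)
  also have "\<dots> = (\<integral>\<^sup>+x. F (p + x) \<partial>distr lborel borel R)" by (simp add: lborel_orthogonal_distr[OF R])
  also have "\<dots> = (\<integral>\<^sup>+x. F (p + R x) \<partial>lborel)" by (simp add: nn_integral_distr)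
  also have "\<dots> = (\<integral>\<^sup>+x. F (p + R x) \<partial>distr (lborel \<Otimes>\<^sub>M lborel) borel
      (\<lambda>(s, t). s *\<^sub>R axis 1 1 + t *\<^sub>R axis 2 1 :: real^2))"
    by (simp add: lborel_pair_axes)
  also have "\<dots> = (\<integral>\<^sup>+z. F (p + R (fst z *\<^sub>R axis 1 1 + snd z *\<^sub>R axis 2 1)) \<partial>(lborel \<Otimes>\<^sub>M lborel))"
    by (subst nn_integral_distr) (auto simp: split_beta')
  also have "\<dots> = (\<integral>\<^sup>+s. \<integral>\<^sup>+t. F (p + R (s *\<^sub>R axis 1 1 + t *\<^sub>R axis 2 1)) \<partial>lborel \<partial>lborel)"
    by (subst lborel.nn_integral_fst[symmetric]) auto
  also have "\<dots> = (\<integral>\<^sup>+s. \<integral>\<^sup>+t. F (p + s *\<^sub>R e + t *\<^sub>R f) \<partial>lborel \<partial>lborel)"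
    by (simp add: R_def axis_def add.assoc)
  finally show ?thesis .
qed

text \<open>For fixed \<open>s\<close> the passage from heights above the axis to heights above the graph is a
  translation, so Fubini's theorem gives Jacobian one without differentiating \<open>\<gamma>\<close>.\<close>

lemma nn_integral_chart:
  fixes F :: "real^2 \<Rightarrow> ennreal"
  assumes ef: "orthoframe e f" and F[measurable]: "F \<in> borel_measurable borel"
    and [measurable]: "\<gamma> \<in> borel_measurable borel"
  shows "(\<integral>\<^sup>+x. F x \<partial>lborel) = (\<integral>\<^sup>+s. \<integral>\<^sup>+t. F (chart p e f \<gamma> s t) \<partial>lborel \<partial>lborel)"
proof -
  have "(\<integral>\<^sup>+t. F (p + s *\<^sub>R e + t *\<^sub>R f) \<partial>lborel) = (\<integral>\<^sup>+t. F (chart p e f \<gamma> s t) \<partial>lborel)" for s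
    by (subst nn_integral_real_affine[where c=1 and t="\<gamma> s"]) (auto simp: chart_def)
  then show ?thesis unfolding nn_integral_orthoframe[OF ef F, of p] by simp
qed

lemma nn_integral_chart_box:
  fixes F :: "real^2 \<Rightarrow> ennreal"
  assumes ef: "orthoframe e f" and [measurable]: "F \<in> borel_measurable borel"
    "\<gamma> \<in> borel_measurable borel" "I \<in> sets borel" "J \<in> sets borel"
  shows "(\<integral>\<^sup>+x\<in>chart_box p e f \<gamma> I J. F x \<partial>lborel)
    = (\<integral>\<^sup>+s\<in>I. \<integral>\<^sup>+t\<in>J. F (chart p e f \<gamma> s t) \<partial>lborel \<partial>lborel)"
proof -
  have "(\<integral>\<^sup>+x\<in>chart_box p e f \<gamma> I J. F x \<partial>lborel) = (\<integral>\<^sup>+s. \<integral>\<^sup>+t. F (chart p e f \<gamma> s t)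
      * indicator (chart_box p e f \<gamma> I J) (chart p e f \<gamma> s t) \<partial>lborel \<partial>lborel)"
    by (rule nn_integral_chart[OF ef]) auto
  also have "\<dots> = (\<integral>\<^sup>+s. \<integral>\<^sup>+t. (F (chart p e f \<gamma> s t) * indicator J t) * indicator I s \<partial>lborel \<partial>lborel)"
    by (intro nn_integral_cong) (auto simp: chart_in_box[OF ef] split: split_indicator)
  also have "\<dots> = (\<integral>\<^sup>+s\<in>I. \<integral>\<^sup>+t\<in>J. F (chart p e f \<gamma> s t) \<partial>lborel \<partial>lborel)"
    by (intro nn_integral_cong) (simp add: nn_integral_multc)
  finally show ?thesis .
qed

section \<open>One-dimensional estimates along fibres\<close>

text \<open>The Cauchy-Schwarz inequality for the fundamental theorem of calculus. As an inequality
  between nonnegative integrals it can be integrated over a family of fibres.\<close>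

lemma increment_sq_le_integral:
  fixes g g' :: "real \<Rightarrow> real"
  assumes g: "\<And>t. (g has_real_derivative g' t) (at t)" and g': "continuous_on UNIV g'"
    and x: "x \<in> {0..l}" and y: "y \<in> {0..l}"
  shows "ennreal ((g x - g y)\<^sup>2) \<le> ennreal l * (\<integral>\<^sup>+t\<in>{0<..<l}. ennreal ((g' t)\<^sup>2) \<partial>lborel)"
  using x y
proof (induction y x rule: linorder_wlog)
  case (sym x y)
  then show ?case by (simp add: power2_commute)
next
  case (le y x)
  show ?case
  proof (cases "x = y")
    case False
    have cont: "continuous_on {-1..l+1} (\<lambda>t. (g' t)\<^sup>2)"
      by (intro continuous_intros continuous_on_subset[OF g']) auto
    then obtain H where H: "\<And>t. t \<in> {-1..l+1} \<Longrightarrow> (H has_vector_derivative (g' t)\<^sup>2) (at t within {-1..l+1})"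
      using antiderivative_continuous[OF cont] by blast
    have Hd: "(H has_real_derivative (g' t)\<^sup>2) (at t)" if "0 \<le> t" "t \<le> l" for t
    proof -
      have "(H has_vector_derivative (g' t)\<^sup>2) (at t within {-1<..<l+1})"
        by (rule has_vector_derivative_within_subset[OF H]) (use that in auto)
      then show ?thesis
        using at_within_open[of t "{-1<..<l+1}"] that by (simp add: has_real_derivative_iff_has_vector_derivative)
    qed
    then have Hcont: "continuous_on {0..l} H"
      by (meson DERIV_isCont atLeastAtMost_iff continuous_at_imp_continuous_on)
    define c where "c = (g x - g y) / (x - y)"
    define k where "k t = H t - 2 * c * g t + c\<^sup>2 * t" for t
    \<comment> \<open>The derivative of \<open>k\<close> is the square of \<open>g' - c\<close>; this is Cauchy-Schwarz.\<close>
    have "k y \<le> k x"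
    proof (rule DERIV_nonneg_imp_increasing_open[of y x k])
      show "y \<le> x" by fact
      fix t assume t: "y < t" "t < x"
      then have "(H has_real_derivative (g' t)\<^sup>2) (at t)"
        using le by (intro Hd) auto
      then have "(k has_real_derivative (g' t)\<^sup>2 - 2 * c * g' t + c\<^sup>2) (at t)"
        unfolding k_def by (auto intro!: derivative_eq_intros g)
      moreover have "(g' t)\<^sup>2 - 2 * c * g' t + c\<^sup>2 = (g' t - c)\<^sup>2" by (simp add: power2_eq_square algebra_simps)
      ultimately show "\<exists>z. DERIV k t :> z \<and> 0 \<le> z" by auto
    next
      have "continuous_on UNIV g" using g by (intro DERIV_continuous_on) auto
      then show "continuous_on {y..x} k"
        unfolding k_def using le Hcont by (intro continuous_intros) (auto elim: continuous_on_subset)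
    qed
    moreover have inc: "g x - g y = c * (x - y)" using False by (simp add: c_def)
    moreover have "2 * c * (g x - g y) - c\<^sup>2 * (x - y) = c\<^sup>2 * (x - y)"
      unfolding inc by (simp add: power2_eq_square)
    ultimately have "c\<^sup>2 * (x - y) \<le> H x - H y" by (simp add: k_def algebra_simps)
    then have "(x - y) * (c\<^sup>2 * (x - y)) \<le> (x - y) * (H x - H y)"
      using le by (intro mult_left_mono) auto
    then have "(g x - g y)\<^sup>2 \<le> (x - y) * (H x - H y)"
      unfolding inc by (simp add: power2_eq_square mult_ac)
    moreover have mono: "H s \<le> H t" if "s \<in> {0..l}" "t \<in> {0..l}" "s \<le> t" for s t
    proof (rule DERIV_nonneg_imp_increasing_open[of s t H])
      show "s \<le> t" by (rule that)
    next
      fix u assume "s < u" "u < t"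
      then show "\<exists>z. DERIV H u :> z \<and> 0 \<le> z"
        using Hd[of u] that by (intro exI[of _ "(g' u)\<^sup>2"]) auto
    next
      show "continuous_on {s..t} H" using that Hcont by (auto elim: continuous_on_subset)
    qed
    moreover have "(x - y) * (H x - H y) \<le> l * (H l - H 0)"
      using mono[of x l] mono[of 0 y] mono[of y x] le by (intro mult_mono) auto
    ultimately have "(g x - g y)\<^sup>2 \<le> l * (H l - H 0)" by linarith
    moreover have "(\<integral>\<^sup>+t\<in>{0<..<l}. ennreal ((g' t)\<^sup>2) \<partial>lborel) = ennreal (H l - H 0)"
    proof -
      have [measurable]: "g' \<in> borel_measurable borel" using g' by (rule borel_measurable_continuous_onI)
      have "(\<integral>\<^sup>+t\<in>{0<..<l}. ennreal ((g' t)\<^sup>2) \<partial>lborel) = (\<integral>\<^sup>+t\<in>{0..l}. ennreal ((g' t)\<^sup>2) \<partial>lborel)"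
      proof (rule nn_integral_cong_AE)
        show "AE t in lborel. ennreal ((g' t)\<^sup>2) * indicator {0<..<l} t = ennreal ((g' t)\<^sup>2) * indicator {0..l} t"
          using AE_lborel_singleton[of 0] AE_lborel_singleton[of l]
          by eventually_elim (auto split: split_indicator)
      qed
      also have "\<dots> = ennreal (H l - H 0)"
        by (rule nn_integral_FTC_Icc) (use Hd le in \<open>auto simp: has_real_derivative_iff_has_vector_derivative[symmetric] intro: has_field_derivative_at_within\<close>)
      finally show ?thesis .
    qed
    moreover have "0 \<le> l" "H 0 \<le> H l" using le mono[of 0 l] by auto
    ultimately show ?thesis by (simp add: ennreal_mult[symmetric] ennreal_leI)
  qed simp
qed

text \<open>A small \<open>\<kappa>\<close> keeps the factor of \<open>b\<^sup>2\<close> close to one. The sharp constant for thin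
  rectangles depends on this.\<close>

lemma sq_le_weighted:
  fixes a b \<kappa> :: real
  assumes "\<kappa> > 0"
  shows "a\<^sup>2 \<le> (1 + \<kappa>) * b\<^sup>2 + (1 + 1 / \<kappa>) * (a - b)\<^sup>2"
proof -
  have "0 \<le> (\<kappa> * b - (a - b))\<^sup>2 / \<kappa>" using assms by simp
  also have "\<dots> = (1 + \<kappa>) * b\<^sup>2 + (1 + 1 / \<kappa>) * (a - b)\<^sup>2 - a\<^sup>2"
    using assms by (simp add: power2_eq_square field_simps)
  finally show ?thesis by simp
qed

context
  fixes g g' :: "real \<Rightarrow> real" and l \<kappa> y :: real
  assumes g: "\<And>t. (g has_real_derivative g' t) (at t)" and g': "continuous_on UNIV g'"
    and l: "l > 0" and y: "y \<in> {0..l}" and \<kappa>: "\<kappa> > 0"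
begin

lemma g_measurable: "g \<in> borel_measurable borel" "g' \<in> borel_measurable borel"
  using g g' by (auto intro!: borel_measurable_continuous_onI DERIV_continuous_on)

lemma ennreal_sq_le_weighted:
  assumes "a \<in> {0..l}" "b \<in> {0..l}"
  shows "ennreal ((g a)\<^sup>2) \<le> ennreal (1 + \<kappa>) * ennreal ((g b)\<^sup>2)
    + ennreal (1 + 1 / \<kappa>) * (ennreal l * (\<integral>\<^sup>+t\<in>{0<..<l}. ennreal ((g' t)\<^sup>2) \<partial>lborel))"
proof -
  have "ennreal ((g a)\<^sup>2) \<le> ennreal (1 + \<kappa>) * ennreal ((g b)\<^sup>2) + ennreal (1 + 1 / \<kappa>) * ennreal ((g a - g b)\<^sup>2)"
    using sq_le_weighted[OF \<kappa>, of "g a" "g b"] \<kappa>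
    by (simp add: ennreal_mult[symmetric] ennreal_plus[symmetric] ennreal_leI del: ennreal_plus)
  also have "\<dots> \<le> ennreal (1 + \<kappa>) * ennreal ((g b)\<^sup>2)
      + ennreal (1 + 1 / \<kappa>) * (ennreal l * (\<integral>\<^sup>+t\<in>{0<..<l}. ennreal ((g' t)\<^sup>2) \<partial>lborel))"
    by (intro add_left_mono mult_left_mono increment_sq_le_integral[OF g g'] assms) auto
  finally show ?thesis .
qed

text \<open>Averaging the weighted inequality over the second point bounds a value by the integral of
  the square; integrating it over the first point bounds the integral by a value.\<close>

lemma fibre_trace:
  "ennreal ((g y)\<^sup>2) \<le> ennreal ((1 + \<kappa>) / l) * (\<integral>\<^sup>+t\<in>{0<..<l}. ennreal ((g t)\<^sup>2) \<partial>lborel)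
     + ennreal ((1 + 1 / \<kappa>) * l) * (\<integral>\<^sup>+t\<in>{0<..<l}. ennreal ((g' t)\<^sup>2) \<partial>lborel)"
proof -
  note [measurable] = g_measurable
  let ?I = "\<integral>\<^sup>+t\<in>{0<..<l}. ennreal ((g' t)\<^sup>2) \<partial>lborel"
  let ?N = "\<integral>\<^sup>+t\<in>{0<..<l}. ennreal ((g t)\<^sup>2) \<partial>lborel"
  let ?c = "ennreal (1 + 1 / \<kappa>) * (ennreal l * ?I)"
  have "ennreal l * ennreal ((g y)\<^sup>2) = (\<integral>\<^sup>+t\<in>{0<..<l}. ennreal ((g y)\<^sup>2) \<partial>lborel)"
    using l by (subst nn_integral_cmult_indicator) (auto simp: mult.commute)
  also have "\<dots> \<le> (\<integral>\<^sup>+t. ennreal (1 + \<kappa>) * (ennreal ((g t)\<^sup>2) * indicator {0<..<l} t) + ?c * indicator {0<..<l} t \<partial>lborel)"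
    using ennreal_sq_le_weighted[OF y]
    by (intro nn_integral_mono) (auto split: split_indicator)
  also have "\<dots> = ennreal (1 + \<kappa>) * ?N + ?c * ennreal l"
    using l by (simp add: nn_integral_add nn_integral_cmult nn_integral_cmult_indicator)
  finally have "ennreal (1 / l) * (ennreal l * ennreal ((g y)\<^sup>2)) \<le> ennreal (1 / l) * (ennreal (1 + \<kappa>) * ?N + ?c * ennreal l)"
    by (rule mult_left_mono) simp
  also have "ennreal (1 / l) * (ennreal l * ennreal ((g y)\<^sup>2)) = ennreal ((g y)\<^sup>2)"
    using l by (simp add: mult.assoc[symmetric] ennreal_mult[symmetric])
  also have "ennreal (1 / l) * (ennreal (1 + \<kappa>) * ?N + ?c * ennreal l)
      = (ennreal (1 / l) * ennreal (1 + \<kappa>)) * ?N + (ennreal (1 / l) * ennreal l) * (ennreal (1 + 1 / \<kappa>) * ennreal l) * ?I"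
    by (simp add: distrib_left mult_ac)
  also have "\<dots> = ennreal ((1 + \<kappa>) / l) * ?N + ennreal ((1 + 1 / \<kappa>) * l) * ?I"
    using l \<kappa> by (simp add: ennreal_mult[symmetric] del: ennreal_plus)
  finally show ?thesis .
qed

lemma fibre_norm:
  "(\<integral>\<^sup>+t\<in>{0<..<l}. ennreal ((g t)\<^sup>2) \<partial>lborel) \<le> ennreal ((1 + \<kappa>) * l) * ennreal ((g y)\<^sup>2)
     + ennreal ((1 + 1 / \<kappa>) * l\<^sup>2) * (\<integral>\<^sup>+t\<in>{0<..<l}. ennreal ((g' t)\<^sup>2) \<partial>lborel)"
proof -
  note [measurable] = g_measurable
  let ?I = "\<integral>\<^sup>+t\<in>{0<..<l}. ennreal ((g' t)\<^sup>2) \<partial>lborel"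
  let ?c = "ennreal (1 + \<kappa>) * ennreal ((g y)\<^sup>2) + ennreal (1 + 1 / \<kappa>) * (ennreal l * ?I)"
  have "(\<integral>\<^sup>+t\<in>{0<..<l}. ennreal ((g t)\<^sup>2) \<partial>lborel) \<le> (\<integral>\<^sup>+t. ?c * indicator {0<..<l} t \<partial>lborel)"
    using ennreal_sq_le_weighted[OF _ y]
    by (intro nn_integral_mono) (auto split: split_indicator)
  also have "\<dots> = ?c * ennreal l" using l by (simp add: nn_integral_cmult_indicator)
  also have "\<dots> = (ennreal (1 + \<kappa>) * ennreal l) * ennreal ((g y)\<^sup>2) + (ennreal (1 + 1 / \<kappa>) * (ennreal l * ennreal l)) * ?I"
    by (simp only: distrib_left mult_ac)
  also have "\<dots> = ennreal ((1 + \<kappa>) * l) * ennreal ((g y)\<^sup>2) + ennreal ((1 + 1 / \<kappa>) * l\<^sup>2) * ?I"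
    using l \<kappa> by (simp add: ennreal_mult[symmetric] power2_eq_square del: ennreal_plus)
  finally show ?thesis .
qed

end

subsection \<open>Estimates in a chart\<close>

lemma C1_gradD:
  assumes "C1_grad \<phi> D"
  shows "(\<phi> has_derivative (\<lambda>h. h \<bullet> D x)) (at x)" "continuous_on UNIV D" "continuous_on UNIV \<phi>"
proof -
  show *: "(\<phi> has_derivative (\<lambda>h. h \<bullet> D x)) (at x)" for x
    using assms by (auto simp: C1_grad_def gderiv_def)
  show "continuous_on UNIV D" using assms by (simp add: C1_grad_def)
  show "continuous_on UNIV \<phi>"
    using * by (meson continuous_at_imp_continuous_on has_derivative_continuous)
qed

lemma C1_grad_measurable:
  assumes "C1_grad \<phi> D"
  shows "\<phi> \<in> borel_measurable borel" "D \<in> borel_measurable borel"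
  using C1_gradD[OF assms] by (auto intro: borel_measurable_continuous_onI)

lemma C1_grad_along_line:
  assumes "C1_grad \<phi> D"
  shows "((\<lambda>t. \<phi> (q + t *\<^sub>R f)) has_real_derivative D (q + t *\<^sub>R f) \<bullet> f) (at t)"
proof -
  have "((\<lambda>t. q + t *\<^sub>R f) has_derivative (\<lambda>h. h *\<^sub>R f)) (at t)"
    by (auto intro!: derivative_eq_intros)
  from has_derivative_compose[OF this C1_gradD(1)[OF assms]]
  show ?thesis by (simp add: has_field_derivative_def inner_commute mult_commute_abs)
qed

lemma C1_grad_along_fibre:
  assumes "C1_grad \<phi> D"
  shows "((\<lambda>t. \<phi> (chart p e f \<gamma> s t)) has_real_derivative D (chart p e f \<gamma> s t) \<bullet> f) (at t)"
    "continuous_on UNIV (\<lambda>t. D (chart p e f \<gamma> s t) \<bullet> f)"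
proof -
  have eq: "chart p e f \<gamma> s t = (p + s *\<^sub>R e + \<gamma> s *\<^sub>R f) + t *\<^sub>R f" for t
    by (simp add: chart_def algebra_simps)
  show "((\<lambda>t. \<phi> (chart p e f \<gamma> s t)) has_real_derivative D (chart p e f \<gamma> s t) \<bullet> f) (at t)"
    unfolding eq by (rule C1_grad_along_line[OF assms])
  show "continuous_on UNIV (\<lambda>t. D (chart p e f \<gamma> s t) \<bullet> f)"
    unfolding eq by (intro continuous_intros continuous_on_compose2[OF C1_gradD(2)[OF assms]]) auto
qed

text \<open>Only the derivative along the fibres enters. For rectangles this keeps the two
  directions apart.\<close>

context
  fixes p e f :: "real^2" and \<gamma> :: "real \<Rightarrow> real" and I :: "real set" and l :: real
    and \<phi> :: "real^2 \<Rightarrow> real" and D :: "real^2 \<Rightarrow> real^2"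
  assumes ef: "orthoframe e f" and \<gamma>: "\<gamma> \<in> borel_measurable borel" and I: "I \<in> sets borel"
    and l: "l > 0" and C1: "C1_grad \<phi> D"
begin

lemma chart_trace:
  assumes y: "y \<in> {0..l}" and \<kappa>: "\<kappa> > 0"
  shows "(\<integral>\<^sup>+s\<in>I. ennreal ((\<phi> (chart p e f \<gamma> s y))\<^sup>2) \<partial>lborel)
    \<le> ennreal ((1 + \<kappa>) / l) * (\<integral>\<^sup>+x\<in>chart_box p e f \<gamma> I {0<..<l}. ennreal ((\<phi> x)\<^sup>2) \<partial>lborel)
      + ennreal ((1 + 1 / \<kappa>) * l) * (\<integral>\<^sup>+x\<in>chart_box p e f \<gamma> I {0<..<l}. ennreal ((D x \<bullet> f)\<^sup>2) \<partial>lborel)"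
proof -
  note [measurable] = C1_grad_measurable[OF C1] \<gamma> I
  have "(\<integral>\<^sup>+s\<in>I. ennreal ((\<phi> (chart p e f \<gamma> s y))\<^sup>2) \<partial>lborel)
    \<le> (\<integral>\<^sup>+s. ennreal ((1 + \<kappa>) / l) * ((\<integral>\<^sup>+t\<in>{0<..<l}. ennreal ((\<phi> (chart p e f \<gamma> s t))\<^sup>2) \<partial>lborel) * indicator I s)
        + ennreal ((1 + 1 / \<kappa>) * l) * ((\<integral>\<^sup>+t\<in>{0<..<l}. ennreal ((D (chart p e f \<gamma> s t) \<bullet> f)\<^sup>2) \<partial>lborel) * indicator I s) \<partial>lborel)"
    using fibre_trace[OF C1_grad_along_fibre[OF C1] l y \<kappa>]
    by (intro nn_integral_mono) (auto split: split_indicator)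
  also have "\<dots> = ennreal ((1 + \<kappa>) / l) * (\<integral>\<^sup>+s\<in>I. (\<integral>\<^sup>+t\<in>{0<..<l}. ennreal ((\<phi> (chart p e f \<gamma> s t))\<^sup>2) \<partial>lborel) \<partial>lborel)
      + ennreal ((1 + 1 / \<kappa>) * l) * (\<integral>\<^sup>+s\<in>I. (\<integral>\<^sup>+t\<in>{0<..<l}. ennreal ((D (chart p e f \<gamma> s t) \<bullet> f)\<^sup>2) \<partial>lborel) \<partial>lborel)"
    by (simp add: nn_integral_add nn_integral_cmult)
  finally show ?thesis by (simp add: nn_integral_chart_box[OF ef])
qed

lemma chart_norm:
  assumes y: "y \<in> {0..l}" and \<kappa>: "\<kappa> > 0"
  shows "(\<integral>\<^sup>+x\<in>chart_box p e f \<gamma> I {0<..<l}. ennreal ((\<phi> x)\<^sup>2) \<partial>lborel)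
    \<le> ennreal ((1 + \<kappa>) * l) * (\<integral>\<^sup>+s\<in>I. ennreal ((\<phi> (chart p e f \<gamma> s y))\<^sup>2) \<partial>lborel)
      + ennreal ((1 + 1 / \<kappa>) * l\<^sup>2) * (\<integral>\<^sup>+x\<in>chart_box p e f \<gamma> I {0<..<l}. ennreal ((D x \<bullet> f)\<^sup>2) \<partial>lborel)"
proof -
  note [measurable] = C1_grad_measurable[OF C1] \<gamma> I
  have "(\<integral>\<^sup>+s\<in>I. (\<integral>\<^sup>+t\<in>{0<..<l}. ennreal ((\<phi> (chart p e f \<gamma> s t))\<^sup>2) \<partial>lborel) \<partial>lborel)
    \<le> (\<integral>\<^sup>+s. ennreal ((1 + \<kappa>) * l) * (ennreal ((\<phi> (chart p e f \<gamma> s y))\<^sup>2) * indicator I s)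
        + ennreal ((1 + 1 / \<kappa>) * l\<^sup>2) * ((\<integral>\<^sup>+t\<in>{0<..<l}. ennreal ((D (chart p e f \<gamma> s t) \<bullet> f)\<^sup>2) \<partial>lborel) * indicator I s) \<partial>lborel)"
    using fibre_norm[OF C1_grad_along_fibre[OF C1] l y \<kappa>]
    by (intro nn_integral_mono) (auto split: split_indicator)
  also have "\<dots> = ennreal ((1 + \<kappa>) * l) * (\<integral>\<^sup>+s\<in>I. ennreal ((\<phi> (chart p e f \<gamma> s y))\<^sup>2) \<partial>lborel)
      + ennreal ((1 + 1 / \<kappa>) * l\<^sup>2) * (\<integral>\<^sup>+s\<in>I. (\<integral>\<^sup>+t\<in>{0<..<l}. ennreal ((D (chart p e f \<gamma> s t) \<bullet> f)\<^sup>2) \<partial>lborel) \<partial>lborel)"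
    by (simp add: nn_integral_add nn_integral_cmult)
  finally show ?thesis by (simp add: nn_integral_chart_box[OF ef])
qed

text \<open>The trace estimate over the full height \<open>l\<close> holds at every height below \<open>\<delta>\<close>; integrating
  over these heights produces the factor \<open>\<delta>\<close>.\<close>

lemma chart_strip:
  assumes \<delta>: "0 < \<delta>" "\<delta> \<le> l"
  shows "(\<integral>\<^sup>+x\<in>chart_box p e f \<gamma> I {0<..<\<delta>}. ennreal ((\<phi> x)\<^sup>2) \<partial>lborel)
    \<le> ennreal \<delta> * (ennreal (2 / l) * (\<integral>\<^sup>+x\<in>chart_box p e f \<gamma> I {0<..<l}. ennreal ((\<phi> x)\<^sup>2) \<partial>lborel)
      + ennreal (2 * l) * (\<integral>\<^sup>+x\<in>chart_box p e f \<gamma> I {0<..<l}. ennreal ((D x \<bullet> f)\<^sup>2) \<partial>lborel))"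
proof -
  note [measurable] = C1_grad_measurable[OF C1] \<gamma> I
  have "(\<integral>\<^sup>+s\<in>I. (\<integral>\<^sup>+t\<in>{0<..<\<delta>}. ennreal ((\<phi> (chart p e f \<gamma> s t))\<^sup>2) \<partial>lborel) \<partial>lborel)
    \<le> (\<integral>\<^sup>+s. ennreal \<delta> * (ennreal (2 / l) * ((\<integral>\<^sup>+t\<in>{0<..<l}. ennreal ((\<phi> (chart p e f \<gamma> s t))\<^sup>2) \<partial>lborel) * indicator I s)
        + ennreal (2 * l) * ((\<integral>\<^sup>+t\<in>{0<..<l}. ennreal ((D (chart p e f \<gamma> s t) \<bullet> f)\<^sup>2) \<partial>lborel) * indicator I s)) \<partial>lborel)"
  proof (intro nn_integral_mono)
    fix s :: real
    let ?c = "ennreal (2 / l) * (\<integral>\<^sup>+t\<in>{0<..<l}. ennreal ((\<phi> (chart p e f \<gamma> s t))\<^sup>2) \<partial>lborel)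
      + ennreal (2 * l) * (\<integral>\<^sup>+t\<in>{0<..<l}. ennreal ((D (chart p e f \<gamma> s t) \<bullet> f)\<^sup>2) \<partial>lborel)"
    have "(\<integral>\<^sup>+t\<in>{0<..<\<delta>}. ennreal ((\<phi> (chart p e f \<gamma> s t))\<^sup>2) \<partial>lborel) \<le> (\<integral>\<^sup>+t. ?c * indicator {0<..<\<delta>} t \<partial>lborel)"
      using fibre_trace[OF C1_grad_along_fibre[OF C1] l, where \<kappa>=1] \<delta>
      by (intro nn_integral_mono) (auto split: split_indicator)
    also have "\<dots> = ennreal \<delta> * ?c"
      using \<delta> by (subst nn_integral_cmult_indicator) (auto simp: mult.commute)
    finally show "(\<integral>\<^sup>+t\<in>{0<..<\<delta>}. ennreal ((\<phi> (chart p e f \<gamma> s t))\<^sup>2) \<partial>lborel) * indicator I s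
      \<le> ennreal \<delta> * (ennreal (2 / l) * ((\<integral>\<^sup>+t\<in>{0<..<l}. ennreal ((\<phi> (chart p e f \<gamma> s t))\<^sup>2) \<partial>lborel) * indicator I s)
        + ennreal (2 * l) * ((\<integral>\<^sup>+t\<in>{0<..<l}. ennreal ((D (chart p e f \<gamma> s t) \<bullet> f)\<^sup>2) \<partial>lborel) * indicator I s))"
      by (auto split: split_indicator)
  qed
  also have "\<dots> = ennreal \<delta> * (ennreal (2 / l) * (\<integral>\<^sup>+s\<in>I. (\<integral>\<^sup>+t\<in>{0<..<l}. ennreal ((\<phi> (chart p e f \<gamma> s t))\<^sup>2) \<partial>lborel) \<partial>lborel)
      + ennreal (2 * l) * (\<integral>\<^sup>+s\<in>I. (\<integral>\<^sup>+t\<in>{0<..<l}. ennreal ((D (chart p e f \<gamma> s t) \<bullet> f)\<^sup>2) \<partial>lborel) \<partial>lborel))"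
    by (simp add: nn_integral_add nn_integral_cmult)
  finally show ?thesis by (simp add: nn_integral_chart_box[OF ef])
qed

end

section \<open>Trace and strip inequalities on a Lipschitz domain\<close>

text \<open>A Lipschitz chart prepared for integration: the window follows the graph, so the part of the
  domain in it is a union of full fibres, and the part of the boundary in it is covered by a curve
  with Lipschitz constant \<open>K\<close>.\<close>

definition boundary_chart ::
    "(real^2) set \<Rightarrow> real^2 \<Rightarrow> real^2 \<Rightarrow> real^2 \<Rightarrow> (real \<Rightarrow> real) \<Rightarrow> real \<Rightarrow> real \<Rightarrow> real \<Rightarrow> bool" where
  "boundary_chart \<Omega> p e f \<gamma> r h K \<longleftrightarrow>
     orthoframe e f \<and> continuous_on UNIV \<gamma> \<and> 0 < h \<and> 0 < K \<and>
     p \<in> chart_box p e f \<gamma> {-r<..<r} {-h<..<h} \<and>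
     chart_box p e f \<gamma> {-r<..<r} {0<..<h} \<subseteq> \<Omega> \<and>
     \<Omega> \<inter> chart_box p e f \<gamma> {-r<..<r} {-h<..<h} \<subseteq> chart_box p e f \<gamma> {-r<..<r} {0<..<h} \<and>
     frontier \<Omega> \<inter> chart_box p e f \<gamma> {-r<..<r} {-h<..<h} \<subseteq> (\<lambda>s. chart p e f \<gamma> s 0) ` {-r<..<r} \<and>
     (\<forall>s s'. dist (chart p e f \<gamma> s 0) (chart p e f \<gamma> s' 0) \<le> K * dist s s')"

text \<open>The window in the definition of a Lipschitz boundary is a rectangle in the frame. As
  the graph passes through \<open>p\<close> with slope at most \<open>C\<close>, a window of half the height that follows the
  graph stays inside the rectangle over a short enough interval.\<close>

lemma lipschitz_boundary_chart:
  assumes op: "open \<Omega>" and lip: "lipschitz_boundary \<Omega>" and p: "p \<in> frontier \<Omega>"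
  shows "\<exists>e f \<gamma> r h K. boundary_chart \<Omega> p e f \<gamma> r h K"
proof -
  obtain e f r h \<gamma> C where ef: "norm e = 1" "norm f = 1" "e \<bullet> f = 0" and rh: "r > 0" "h > 0"
    and L: "C-lipschitz_on UNIV \<gamma>"
    and graph: "\<And>s t. \<bar>s\<bar> < r \<Longrightarrow> \<bar>t\<bar> < h \<Longrightarrow> (p + s *\<^sub>R e + t *\<^sub>R f \<in> \<Omega> \<longleftrightarrow> \<gamma> s < t)"
    using lip p unfolding lipschitz_boundary_def by metis
  have of: "orthoframe e f" using ef by (simp add: orthoframe_def)
  have C: "C \<ge> 0" using L by (rule lipschitz_on_nonneg)
  have cont: "continuous_on UNIV \<gamma>" using L by (rule lipschitz_on_continuous_on)
  have Ldist: "\<bar>\<gamma> s - \<gamma> s'\<bar> \<le> C * \<bar>s - s'\<bar>" for s s'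
    using lipschitz_onD[OF L, of s s'] by (simp add: dist_real_def)
  have in\<Omega>: "x \<in> \<Omega> \<longleftrightarrow> \<gamma> ((x - p) \<bullet> e) < (x - p) \<bullet> f" if "\<bar>(x - p) \<bullet> e\<bar> < r" "\<bar>(x - p) \<bullet> f\<bar> < h" for x
    using graph[OF that] orthoframe_expand[OF of, of "x - p"] by (simp add: algebra_simps)
  have below: "x \<notin> closure \<Omega>"
    if x: "\<bar>(x - p) \<bullet> e\<bar> < r" "\<bar>(x - p) \<bullet> f\<bar> < h" "(x - p) \<bullet> f < \<gamma> ((x - p) \<bullet> e)" for x
  proof -
    let ?U = "{x. \<bar>(x - p) \<bullet> e\<bar> < r} \<inter> {x. \<bar>(x - p) \<bullet> f\<bar> < h} \<inter> {x. (x - p) \<bullet> f < \<gamma> ((x - p) \<bullet> e)}"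
    have "continuous_on UNIV (\<lambda>x. \<gamma> ((x - p) \<bullet> e))"
      by (intro continuous_on_compose2[OF cont] continuous_intros) auto
    then have "open ?U" by (intro open_Int open_Collect_less continuous_intros)
    moreover have "?U \<inter> \<Omega> = {}" using in\<Omega> by force
    ultimately have "?U \<inter> closure \<Omega> = {}" by (simp add: open_Int_closure_eq_empty)
    then show ?thesis using x by blast
  qed
  have front: "(x - p) \<bullet> f = \<gamma> ((x - p) \<bullet> e)"
    if "\<bar>(x - p) \<bullet> e\<bar> < r" "\<bar>(x - p) \<bullet> f\<bar> < h" "x \<in> frontier \<Omega>" for x
  proof -
    have "x \<notin> \<Omega>" "x \<in> closure \<Omega>" using that(3) op by (auto simp: frontier_def interior_open)
    then show ?thesis
      using in\<Omega>[OF that(1,2)] below[OF that(1,2)] by (metis linorder_neqE_linordered_idom)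
  qed
  have \<gamma>0: "\<gamma> 0 = 0" using front[of p] rh p by simp
  define r' where "r' = min r (h / (2 * (C + 1)))"
  define h' where "h' = h / 2"
  have r': "0 < r'" "r' \<le> r" using rh C by (auto simp: r'_def)
  have small: "\<bar>\<gamma> s\<bar> < h / 2" if "\<bar>s\<bar> < r'" for s
  proof -
    have "\<bar>\<gamma> s\<bar> \<le> C * \<bar>s\<bar>" using Ldist[of s 0] \<gamma>0 by simp
    also have "\<dots> \<le> (C + 1) * \<bar>s\<bar>" by (simp add: mult_right_mono)
    also have "\<dots> < (C + 1) * (h / (2 * (C + 1)))" using that C by (intro mult_strict_left_mono) (auto simp: r'_def)
    also have "\<dots> = h / 2" using C by (simp add: field_simps)
    finally show ?thesis .
  qed
  have box: "\<bar>(x - p) \<bullet> e\<bar> < r" "\<bar>(x - p) \<bullet> f\<bar> < h"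
    if "x \<in> chart_box p e f \<gamma> {-r'<..<r'} {-h'<..<h'}" for x
  proof -
    have s: "\<bar>(x - p) \<bullet> e\<bar> < r'"
      and t: "(x - p) \<bullet> f - \<gamma> ((x - p) \<bullet> e) < h / 2" "- (h / 2) < (x - p) \<bullet> f - \<gamma> ((x - p) \<bullet> e)"
      using that by (auto simp: chart_box_def h'_def)
    show "\<bar>(x - p) \<bullet> e\<bar> < r" using s r' by linarith
    show "\<bar>(x - p) \<bullet> f\<bar> < h" using t small[OF s] by linarith
  qed
  have "boundary_chart \<Omega> p e f \<gamma> r' h' (1 + C)"
    unfolding boundary_chart_def
  proof (intro conjI allI)
    show "p \<in> chart_box p e f \<gamma> {-r'<..<r'} {-h'<..<h'}" using r' rh by (simp add: chart_box_def \<gamma>0 h'_def)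
    show "chart_box p e f \<gamma> {-r'<..<r'} {0<..<h'} \<subseteq> \<Omega>"
    proof
      fix x assume x: "x \<in> chart_box p e f \<gamma> {-r'<..<r'} {0<..<h'}"
      then have "x \<in> chart_box p e f \<gamma> {-r'<..<r'} {-h'<..<h'}" using rh by (auto simp: chart_box_def h'_def)
      from in\<Omega>[OF box[OF this]] x show "x \<in> \<Omega>" by (simp add: chart_box_def)
    qed
    show "\<Omega> \<inter> chart_box p e f \<gamma> {-r'<..<r'} {-h'<..<h'} \<subseteq> chart_box p e f \<gamma> {-r'<..<r'} {0<..<h'}"
      using in\<Omega> box by (auto simp: chart_box_def)
    show "frontier \<Omega> \<inter> chart_box p e f \<gamma> {-r'<..<r'} {-h'<..<h'} \<subseteq> (\<lambda>s. chart p e f \<gamma> s 0) ` {-r'<..<r'}"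
    proof
      fix x assume x: "x \<in> frontier \<Omega> \<inter> chart_box p e f \<gamma> {-r'<..<r'} {-h'<..<h'}"
      then have "(x - p) \<bullet> f = \<gamma> ((x - p) \<bullet> e)" using front box by blast
      then have "x = chart p e f \<gamma> ((x - p) \<bullet> e) 0" using chart_inverse[OF of, of p \<gamma> x] by simp
      then show "x \<in> (\<lambda>s. chart p e f \<gamma> s 0) ` {-r'<..<r'}" using x by (auto simp: chart_box_def)
    qed
    fix s s' :: real
    have "dist (chart p e f \<gamma> s 0) (chart p e f \<gamma> s' 0) = norm ((s - s') *\<^sub>R e + (\<gamma> s - \<gamma> s') *\<^sub>R f)"
      by (simp add: chart_def dist_norm algebra_simps)
    also have "\<dots> \<le> \<bar>s - s'\<bar> + \<bar>\<gamma> s - \<gamma> s'\<bar>"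
      using norm_triangle_ineq[of "(s - s') *\<^sub>R e" "(\<gamma> s - \<gamma> s') *\<^sub>R f"] ef by simp
    also have "\<dots> \<le> (1 + C) * dist s s'" using Ldist[of s s'] by (simp add: dist_real_def distrib_right)
    finally show "dist (chart p e f \<gamma> s 0) (chart p e f \<gamma> s' 0) \<le> (1 + C) * dist s s'" .
  qed (use of cont rh C in \<open>auto simp: h'_def\<close>)
  then show ?thesis by blast
qed

lemma boundary_atlas:
  assumes "bounded_lipschitz_domain \<Omega>"
  obtains P e f \<gamma> r h K where "finite P"
    "frontier \<Omega> \<subseteq> (\<Union>p\<in>P. chart_box p (e p) (f p) (\<gamma> p) {-r p<..<r p} {-h p<..<h p})"
    "\<And>p. p \<in> P \<Longrightarrow> boundary_chart \<Omega> p (e p) (f p) (\<gamma> p) (r p) (h p) (K p)"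
proof -
  have "open \<Omega>" "lipschitz_boundary \<Omega>" "bounded \<Omega>"
    using assms by (auto simp: bounded_lipschitz_domain_def)
  then have "\<forall>p\<in>frontier \<Omega>. \<exists>e f \<gamma> r h K. boundary_chart \<Omega> p e f \<gamma> r h K"
    using lipschitz_boundary_chart by blast
  then obtain e f \<gamma> r h K where ch: "\<And>p. p \<in> frontier \<Omega> \<Longrightarrow> boundary_chart \<Omega> p (e p) (f p) (\<gamma> p) (r p) (h p) (K p)"
    by metis
  define B where "B p = chart_box p (e p) (f p) (\<gamma> p) {-r p<..<r p} {-h p<..<h p}" for p
  have "compact (frontier \<Omega>)" using \<open>bounded \<Omega>\<close> by (rule compact_frontier_bounded)
  moreover have "open (B p)" if "p \<in> frontier \<Omega>" for p
    using ch[OF that] by (auto simp: B_def boundary_chart_def intro!: open_chart_box)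
  moreover have "frontier \<Omega> \<subseteq> (\<Union>p\<in>frontier \<Omega>. B p)"
    using ch by (force simp: B_def boundary_chart_def)
  ultimately obtain P where P: "P \<subseteq> frontier \<Omega>" "finite P" "frontier \<Omega> \<subseteq> (\<Union>p\<in>P. B p)"
    by (rule compactE_image)
  show ?thesis using that[OF P(2), of e f \<gamma> r h K] P ch unfolding B_def by blast
qed

lemma nn_integral_le_finite_cover:
  assumes "finite P" and cover: "A \<subseteq> (\<Union>p\<in>P. B p)" and B: "\<And>p. p \<in> P \<Longrightarrow> A \<inter> B p \<in> sets M"
    and f: "f \<in> borel_measurable M"
  shows "(\<integral>\<^sup>+x\<in>A. f x \<partial>M) \<le> (\<Sum>p\<in>P. \<integral>\<^sup>+x\<in>A \<inter> B p. f x \<partial>M)"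
proof -
  have "(\<integral>\<^sup>+x\<in>A. f x \<partial>M) \<le> (\<integral>\<^sup>+x. (\<Sum>p\<in>P. f x * indicator (A \<inter> B p) x) \<partial>M)"
  proof (rule nn_integral_mono)
    fix x
    show "f x * indicator A x \<le> (\<Sum>p\<in>P. f x * indicator (A \<inter> B p) x)"
    proof (cases "x \<in> A")
      case True
      then obtain p where p: "p \<in> P" "x \<in> B p" using cover by blast
      then show ?thesis
        using member_le_sum[of p P "\<lambda>p. f x * indicator (A \<inter> B p) x"] \<open>finite P\<close> True by simp
    qed simp
  qed
  also have "\<dots> = (\<Sum>p\<in>P. \<integral>\<^sup>+x\<in>A \<inter> B p. f x \<partial>M)"
    by (rule nn_integral_sum) (use B f in measurable)
  finally show ?thesis .
qed

lemma nn_integral_mono_set: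
  fixes f g :: "'a \<Rightarrow> ennreal"
  assumes "A \<subseteq> B" "\<And>x. x \<in> A \<Longrightarrow> f x \<le> g x"
  shows "(\<integral>\<^sup>+x\<in>A. f x \<partial>M) \<le> (\<integral>\<^sup>+x\<in>B. g x \<partial>M)"
  by (rule nn_integral_mono) (use assms in \<open>auto split: split_indicator\<close>)

lemma inner_unit_sq_le:
  fixes v f :: "'a::real_inner"
  assumes "norm f = 1"
  shows "ennreal ((v \<bullet> f)\<^sup>2) \<le> ennreal ((norm v)\<^sup>2)"
proof -
  have "\<bar>v \<bullet> f\<bar> \<le> norm v" using Cauchy_Schwarz_ineq2[of v f] assms by simp
  then have "(v \<bullet> f)\<^sup>2 \<le> (norm v)\<^sup>2" by (metis abs_le_square_iff abs_norm_cancel)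
  then show ?thesis by (rule ennreal_leI)
qed

lemma domain_borel:
  assumes "bounded_lipschitz_domain \<Omega>"
  shows "\<Omega> \<in> sets borel" "frontier \<Omega> \<in> sets borel"
  using assms by (auto simp: bounded_lipschitz_domain_def)

text \<open>Integrating the fibre estimate over a chart bounds the boundary values by a layer of
  width \<open>l\<close>. The free choice of \<open>l\<close> makes the gradient term as small as desired.\<close>

theorem trace_inequality:
  assumes \<Omega>: "bounded_lipschitz_domain \<Omega>"
  obtains C l0 where "C > 0" "l0 > 0"
    "\<And>l \<phi> D. \<lbrakk>0 < l; l \<le> l0; C1_grad \<phi> D\<rbrakk> \<Longrightarrow>
      (\<integral>\<^sup>+x\<in>frontier \<Omega>. ennreal ((\<phi> x)\<^sup>2) \<partial>length_measure)
      \<le> ennreal (C / l) * (\<integral>\<^sup>+x\<in>\<Omega>. ennreal ((\<phi> x)\<^sup>2) \<partial>lborel)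
        + ennreal (C * l) * (\<integral>\<^sup>+x\<in>\<Omega>. ennreal ((norm (D x))\<^sup>2) \<partial>lborel)"
proof -
  obtain P e f \<gamma> r h K where P: "finite P"
    and cover: "frontier \<Omega> \<subseteq> (\<Union>p\<in>P. chart_box p (e p) (f p) (\<gamma> p) {-r p<..<r p} {-h p<..<h p})"
    and chart: "\<And>p. p \<in> P \<Longrightarrow> boundary_chart \<Omega> p (e p) (f p) (\<gamma> p) (r p) (h p) (K p)"
    by (rule boundary_atlas[OF \<Omega>]) (rule that, assumption+)
  define l0 where "l0 = Min (insert 1 (h ` P))"
  define C where "C = 1 + (\<Sum>p\<in>P. 2 * K p)"
  have K: "K p > 0" and h: "h p > 0" if "p \<in> P" for p using chart[OF that] by (auto simp: boundary_chart_def)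
  have "0 \<le> (\<Sum>p\<in>P. 2 * K p)" using K by (intro sum_nonneg) (auto simp: less_imp_le)
  then have "C > 0" by (simp add: C_def)
  moreover have "l0 > 0" using P h by (simp add: l0_def)
  moreover have "(\<integral>\<^sup>+x\<in>frontier \<Omega>. ennreal ((\<phi> x)\<^sup>2) \<partial>length_measure)
      \<le> ennreal (C / l) * (\<integral>\<^sup>+x\<in>\<Omega>. ennreal ((\<phi> x)\<^sup>2) \<partial>lborel)
        + ennreal (C * l) * (\<integral>\<^sup>+x\<in>\<Omega>. ennreal ((norm (D x))\<^sup>2) \<partial>lborel)"
    if l: "0 < l" "l \<le> l0" and C1: "C1_grad \<phi> D" for l \<phi> D
  proof -
    let ?N = "\<integral>\<^sup>+x\<in>\<Omega>. ennreal ((\<phi> x)\<^sup>2) \<partial>lborel" and ?D = "\<integral>\<^sup>+x\<in>\<Omega>. ennreal ((norm (D x))\<^sup>2) \<partial>lborel"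
    let ?B = "\<lambda>p. chart_box p (e p) (f p) (\<gamma> p) {-r p<..<r p} {-h p<..<h p}"
    note [measurable] = C1_grad_measurable[OF C1] domain_borel[OF \<Omega>]
    have \<gamma>[measurable]: "\<gamma> p \<in> borel_measurable borel" if "p \<in> P" for p
      using chart[OF that] by (auto simp: boundary_chart_def intro: borel_measurable_continuous_onI)
    have piece: "(\<integral>\<^sup>+x\<in>frontier \<Omega> \<inter> ?B p. ennreal ((\<phi> x)\<^sup>2) \<partial>length_measure)
        \<le> ennreal (K p) * (ennreal (2 / l) * ?N + ennreal (2 * l) * ?D)" if p: "p \<in> P" for p
    proof -
      note [measurable] = \<gamma>[OF p]
      note ch = chart[OF p, unfolded boundary_chart_def]
      have lh: "l \<le> h p" using l P p by (auto simp: l0_def)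
      have "(\<integral>\<^sup>+x\<in>frontier \<Omega> \<inter> ?B p. ennreal ((\<phi> x)\<^sup>2) \<partial>length_measure)
        \<le> ennreal (K p) * (\<integral>\<^sup>+s\<in>{-r p<..<r p}. ennreal ((\<phi> (chart p (e p) (f p) (\<gamma> p) s 0))\<^sup>2) \<partial>lborel)"
        by (rule nn_integral_length_le_param) (use ch in auto)
      also have "\<dots> \<le> ennreal (K p) *
          (ennreal ((1 + 1) / l) * (\<integral>\<^sup>+x\<in>chart_box p (e p) (f p) (\<gamma> p) {-r p<..<r p} {0<..<l}. ennreal ((\<phi> x)\<^sup>2) \<partial>lborel)
           + ennreal ((1 + 1 / 1) * l) * (\<integral>\<^sup>+x\<in>chart_box p (e p) (f p) (\<gamma> p) {-r p<..<r p} {0<..<l}. ennreal ((D x \<bullet> f p)\<^sup>2) \<partial>lborel))"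
        by (intro mult_left_mono chart_trace) (use ch l C1 in auto)
      also have "\<dots> \<le> ennreal (K p) * (ennreal (2 / l) * ?N + ennreal (2 * l) * ?D)"
      proof -
        have sub: "chart_box p (e p) (f p) (\<gamma> p) {-r p<..<r p} {0<..<l} \<subseteq> \<Omega>"
          using ch lh by (auto simp: chart_box_def)
        have "norm (f p) = 1" using ch by (simp add: orthoframe_def)
        then show ?thesis
          using sub by (simp only: one_add_one div_by_1)
            (intro mult_left_mono add_mono nn_integral_mono_set inner_unit_sq_le order_refl; simp)
      qed
      finally show ?thesis .
    qed
    have "(\<integral>\<^sup>+x\<in>frontier \<Omega>. ennreal ((\<phi> x)\<^sup>2) \<partial>length_measure)
      \<le> (\<Sum>p\<in>P. \<integral>\<^sup>+x\<in>frontier \<Omega> \<inter> ?B p. ennreal ((\<phi> x)\<^sup>2) \<partial>length_measure)"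
      by (rule nn_integral_le_finite_cover[OF P cover]) (use \<gamma> in auto)
    also have "\<dots> \<le> (\<Sum>p\<in>P. ennreal (K p) * (ennreal (2 / l) * ?N + ennreal (2 * l) * ?D))"
      by (rule sum_mono) (rule piece)
    also have "\<dots> = (\<Sum>p\<in>P. ennreal (2 * K p)) * (ennreal (1 / l) * ?N + ennreal l * ?D)"
      unfolding sum_distrib_right
    proof (rule sum.cong[OF refl])
      fix p assume "p \<in> P"
      then have "ennreal (2 * K p) * ennreal (1 / l) = ennreal (K p) * ennreal (2 / l)"
        "ennreal (2 * K p) * ennreal l = ennreal (K p) * ennreal (2 * l)"
        using K[of p] l by (simp_all add: ennreal_mult[symmetric] mult_ac)
      then show "ennreal (K p) * (ennreal (2 / l) * ?N + ennreal (2 * l) * ?D)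
          = ennreal (2 * K p) * (ennreal (1 / l) * ?N + ennreal l * ?D)"
        by (simp add: distrib_left mult.assoc[symmetric])
    qed
    also have "\<dots> \<le> ennreal C * (ennreal (1 / l) * ?N + ennreal l * ?D)"
      using K by (intro mult_right_mono) (auto simp: C_def sum_ennreal less_imp_le intro!: ennreal_leI)
    also have "\<dots> = ennreal (C / l) * ?N + ennreal (C * l) * ?D"
      using \<open>C > 0\<close> l by (simp add: distrib_left mult.assoc[symmetric] ennreal_mult'[symmetric])
    finally show ?thesis .
  qed
  ultimately show ?thesis by (rule that)
qed

text \<open>A thin neighbourhood of the boundary carries a small part of the mass, uniformly over
  functions with bounded energy. This keeps minimising sequences from concentrating there.\<close>

theorem strip_inequality:
  assumes \<Omega>: "bounded_lipschitz_domain \<Omega>" and \<epsilon>: "\<epsilon> > 0"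
  obtains V where "open V" "frontier \<Omega> \<subseteq> V"
    "\<And>\<phi> D. C1_grad \<phi> D \<Longrightarrow> (\<integral>\<^sup>+x\<in>\<Omega> \<inter> V. ennreal ((\<phi> x)\<^sup>2) \<partial>lborel)
      \<le> ennreal \<epsilon> * ((\<integral>\<^sup>+x\<in>\<Omega>. ennreal ((\<phi> x)\<^sup>2) \<partial>lborel)
        + (\<integral>\<^sup>+x\<in>\<Omega>. ennreal ((norm (D x))\<^sup>2) \<partial>lborel))"
proof -
  obtain P e f \<gamma> r h K where P: "finite P"
    and cover: "frontier \<Omega> \<subseteq> (\<Union>p\<in>P. chart_box p (e p) (f p) (\<gamma> p) {-r p<..<r p} {-h p<..<h p})"
    and chart: "\<And>p. p \<in> P \<Longrightarrow> boundary_chart \<Omega> p (e p) (f p) (\<gamma> p) (r p) (h p) (K p)"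
    by (rule boundary_atlas[OF \<Omega>]) (rule that, assumption+)
  have h: "h p > 0" if "p \<in> P" for p using chart[OF that] by (auto simp: boundary_chart_def)
  define l where "l = Min (insert 1 (h ` P))"
  have l: "0 < l" "l \<le> 1" using P h by (auto simp: l_def)
  have lh: "l \<le> h p" if "p \<in> P" for p using P that by (auto simp: l_def)
  \<comment> \<open>Each chart contributes at most \<open>\<delta> * (2 / l)\<close> times mass plus energy.\<close>
  define c where "c = (2 / l) * (1 + real (card P))"
  have c: "c > 0" using l by (simp add: c_def add_pos_nonneg)
  define \<delta> where "\<delta> = min l (\<epsilon> / c)"
  have \<delta>: "0 < \<delta>" "\<delta> \<le> l" "\<delta> * c \<le> \<epsilon>" using l c \<epsilon> by (auto simp: \<delta>_def min_def field_simps)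
  define W where "W p = chart_box p (e p) (f p) (\<gamma> p) {-r p<..<r p} {-\<delta><..<\<delta>}" for p
  have opW: "open (W p)" if "p \<in> P" for p
    using chart[OF that] by (auto simp: W_def boundary_chart_def intro!: open_chart_box)
  show ?thesis
  proof (rule that[of "\<Union>p\<in>P. W p"])
    show "open (\<Union>p\<in>P. W p)" using opW by blast
    show "frontier \<Omega> \<subseteq> (\<Union>p\<in>P. W p)"
    proof
      fix x assume x: "x \<in> frontier \<Omega>"
      then obtain p where p: "p \<in> P" "x \<in> chart_box p (e p) (f p) (\<gamma> p) {-r p<..<r p} {-h p<..<h p}"
        using cover by blast
      note ch = chart[OF p(1), unfolded boundary_chart_def]
      obtain s where "s \<in> {-r p<..<r p}" "x = chart p (e p) (f p) (\<gamma> p) s 0" using ch x p by blast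
      then have "x \<in> W p" using ch \<delta> by (auto simp: W_def chart_in_box)
      then show "x \<in> (\<Union>p\<in>P. W p)" using p by blast
    qed
    fix \<phi> D assume C1: "C1_grad \<phi> D"
    let ?N = "\<integral>\<^sup>+x\<in>\<Omega>. ennreal ((\<phi> x)\<^sup>2) \<partial>lborel" and ?D = "\<integral>\<^sup>+x\<in>\<Omega>. ennreal ((norm (D x))\<^sup>2) \<partial>lborel"
    note [measurable] = C1_grad_measurable[OF C1] domain_borel[OF \<Omega>]
    have piece: "(\<integral>\<^sup>+x\<in>(\<Omega> \<inter> (\<Union>p\<in>P. W p)) \<inter> W p. ennreal ((\<phi> x)\<^sup>2) \<partial>lborel) \<le> ennreal (\<delta> * (2 / l)) * (?N + ?D)"
      if p: "p \<in> P" for p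
    proof -
      note ch = chart[OF p, unfolded boundary_chart_def]
      have \<gamma>: "\<gamma> p \<in> borel_measurable borel" using ch by (auto intro: borel_measurable_continuous_onI)
      have "\<Omega> \<inter> W p \<subseteq> chart_box p (e p) (f p) (\<gamma> p) {-r p<..<r p} {0<..<\<delta>}"
      proof
        fix x assume x: "x \<in> \<Omega> \<inter> W p"
        then have "x \<in> chart_box p (e p) (f p) (\<gamma> p) {-r p<..<r p} {-h p<..<h p}"
          using \<delta> lh[OF p] by (auto simp: W_def chart_box_def)
        then have "x \<in> chart_box p (e p) (f p) (\<gamma> p) {-r p<..<r p} {0<..<h p}" using ch x by blast
        then show "x \<in> chart_box p (e p) (f p) (\<gamma> p) {-r p<..<r p} {0<..<\<delta>}"
          using x by (auto simp: W_def chart_box_def)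
      qed
      then have "(\<integral>\<^sup>+x\<in>(\<Omega> \<inter> (\<Union>p\<in>P. W p)) \<inter> W p. ennreal ((\<phi> x)\<^sup>2) \<partial>lborel)
         \<le> (\<integral>\<^sup>+x\<in>chart_box p (e p) (f p) (\<gamma> p) {-r p<..<r p} {0<..<\<delta>}. ennreal ((\<phi> x)\<^sup>2) \<partial>lborel)"
        by (intro nn_integral_mono_set) auto
      also have "\<dots> \<le> ennreal \<delta> *
          (ennreal (2 / l) * (\<integral>\<^sup>+x\<in>chart_box p (e p) (f p) (\<gamma> p) {-r p<..<r p} {0<..<l}. ennreal ((\<phi> x)\<^sup>2) \<partial>lborel)
           + ennreal (2 * l) * (\<integral>\<^sup>+x\<in>chart_box p (e p) (f p) (\<gamma> p) {-r p<..<r p} {0<..<l}. ennreal ((D x \<bullet> f p)\<^sup>2) \<partial>lborel))"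
        by (rule chart_strip) (use ch l \<delta> C1 \<gamma> in auto)
      also have "\<dots> \<le> ennreal \<delta> * (ennreal (2 / l) * ?N + ennreal (2 / l) * ?D)"
      proof -
        have sub: "chart_box p (e p) (f p) (\<gamma> p) {-r p<..<r p} {0<..<l} \<subseteq> \<Omega>"
          using ch lh[OF p] by (auto simp: chart_box_def)
        have "l * l \<le> 1" using l by (simp add: mult_le_one)
        then have "2 * l \<le> 2 / l" using l by (simp add: field_simps)
        moreover have "norm (f p) = 1" using ch by (simp add: orthoframe_def)
        ultimately show ?thesis
          using sub by (intro mult_left_mono add_mono mult_mono nn_integral_mono_set inner_unit_sq_le order_refl ennreal_leI; simp)
      qed
      also have "\<dots> = ennreal (\<delta> * (2 / l)) * (?N + ?D)"
        unfolding ennreal_mult[OF less_imp_le[OF \<delta>(1)] less_imp_le[OF divide_pos_pos[OF zero_less_numeral l(1)]]]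
        by (simp only: distrib_left mult.assoc)
      finally show ?thesis .
    qed
    have "(\<integral>\<^sup>+x\<in>\<Omega> \<inter> (\<Union>p\<in>P. W p). ennreal ((\<phi> x)\<^sup>2) \<partial>lborel)
      \<le> (\<Sum>p\<in>P. \<integral>\<^sup>+x\<in>(\<Omega> \<inter> (\<Union>p\<in>P. W p)) \<inter> W p. ennreal ((\<phi> x)\<^sup>2) \<partial>lborel)"
    proof (rule nn_integral_le_finite_cover[OF P])
      have "open ((\<Union>p\<in>P. W p) \<inter> W p)" if "p \<in> P" for p using opW that by blast
      then have "((\<Union>p\<in>P. W p) \<inter> W p) \<inter> \<Omega> \<in> sets borel" if "p \<in> P" for p using that by simp
      then show "\<Omega> \<inter> (\<Union>p\<in>P. W p) \<inter> W p \<in> sets lborel" if "p \<in> P" for p using that by (simp add: Int_ac)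
    qed auto
    also have "\<dots> \<le> (\<Sum>p\<in>P. ennreal (\<delta> * (2 / l)) * (?N + ?D))"
      by (rule sum_mono) (rule piece)
    also have "\<dots> = ennreal (real (card P) * (\<delta> * (2 / l))) * (?N + ?D)"
      using \<delta> l by (subst ennreal_mult[of "real (card P)"]) (auto simp: ennreal_of_nat_eq_real_of_nat mult.assoc)
    also have "\<dots> \<le> ennreal \<epsilon> * (?N + ?D)"
    proof -
      have "\<delta> * c = \<delta> * (2 / l) + real (card P) * (\<delta> * (2 / l))" by (simp add: c_def distrib_left)
      moreover have "0 \<le> \<delta> * (2 / l)" using \<delta> l by simp
      ultimately have "real (card P) * (\<delta> * (2 / l)) \<le> \<delta> * c" by linarith
      then show ?thesis using \<delta> by (intro mult_right_mono ennreal_leI) auto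
    qed
    finally show "(\<integral>\<^sup>+x\<in>\<Omega> \<inter> (\<Union>p\<in>P. W p). ennreal ((\<phi> x)\<^sup>2) \<partial>lborel) \<le> ennreal \<epsilon> * (?N + ?D)" .
  qed
qed

section \<open>The Hilbert space of square integrable functions\<close>

definition L2_fun :: "'a measure \<Rightarrow> ('a \<Rightarrow> 'b::euclidean_space) \<Rightarrow> bool" where
  "L2_fun M f \<longleftrightarrow> f \<in> borel_measurable M \<and> integrable M (\<lambda>x. (norm (f x))\<^sup>2)"

lemma L2_fun_inner:
  assumes "L2_fun M f" "L2_fun M g"
  shows "integrable M (\<lambda>x. f x \<bullet> g x)"
proof (rule Bochner_Integration.integrable_bound)
  show "integrable M (\<lambda>x. (norm (f x))\<^sup>2 + (norm (g x))\<^sup>2)"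
    using assms by (auto simp: L2_fun_def)
  show "(\<lambda>x. f x \<bullet> g x) \<in> borel_measurable M" using assms by (auto simp: L2_fun_def)
  show "AE x in M. norm (f x \<bullet> g x) \<le> norm ((norm (f x))\<^sup>2 + (norm (g x))\<^sup>2)"
  proof (rule AE_I2)
    fix x
    have "2 * (norm (f x) * norm (g x)) \<le> (norm (f x))\<^sup>2 + (norm (g x))\<^sup>2"
      using sum_squares_bound[of "norm (f x)" "norm (g x)"] by (simp add: mult.assoc)
    moreover have "\<bar>f x \<bullet> g x\<bar> \<le> norm (f x) * norm (g x)" by (rule Cauchy_Schwarz_ineq2)
    moreover have "0 \<le> norm (f x) * norm (g x)" by simp
    ultimately show "norm (f x \<bullet> g x) \<le> norm ((norm (f x))\<^sup>2 + (norm (g x))\<^sup>2)"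
      unfolding real_norm_def by linarith
  qed
qed

lemma norm_sq_lincomb:
  fixes u v :: "'b::real_inner"
  shows "(norm (u + t *\<^sub>R v))\<^sup>2 = (norm u)\<^sup>2 + 2 * t * (u \<bullet> v) + t\<^sup>2 * (norm v)\<^sup>2"
  unfolding power2_norm_eq_inner
  by (simp add: inner_add_left inner_add_right inner_commute[of v u] power2_eq_square algebra_simps)

lemma L2_fun_lincomb:
  assumes "L2_fun M f" "L2_fun M g"
  shows "L2_fun M (\<lambda>x. f x + t *\<^sub>R g x)"
    and "(\<integral>x. (norm (f x + t *\<^sub>R g x))\<^sup>2 \<partial>M)
      = (\<integral>x. (norm (f x))\<^sup>2 \<partial>M) + 2 * t * (\<integral>x. f x \<bullet> g x \<partial>M) + t\<^sup>2 * (\<integral>x. (norm (g x))\<^sup>2 \<partial>M)"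
  using assms L2_fun_inner[OF assms] by (auto simp: L2_fun_def norm_sq_lincomb)

lemma L2_fun_diff:
  assumes "L2_fun M f" "L2_fun M g"
  shows "L2_fun M (\<lambda>x. f x - g x)"
  using L2_fun_lincomb(1)[OF assms, of "-1"] by simp

lemma L2_fun_Cauchy_Schwarz:
  assumes "L2_fun M f" "L2_fun M g"
  shows "(\<integral>x. f x \<bullet> g x \<partial>M)\<^sup>2 \<le> (\<integral>x. (norm (f x))\<^sup>2 \<partial>M) * (\<integral>x. (norm (g x))\<^sup>2 \<partial>M)"
proof -
  define a b c where "a = (\<integral>x. (norm (f x))\<^sup>2 \<partial>M)" "b = (\<integral>x. f x \<bullet> g x \<partial>M)" "c = (\<integral>x. (norm (g x))\<^sup>2 \<partial>M)"
  note abc = this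
  have pos: "0 \<le> a + 2 * t * b + t\<^sup>2 * c" for t
  proof -
    have "0 \<le> (\<integral>x. (norm (f x + t *\<^sub>R g x))\<^sup>2 \<partial>M)" by simp
    then show ?thesis unfolding L2_fun_lincomb(2)[OF assms] abc .
  qed
  have "c \<ge> 0" by (simp add: abc)
  have "b\<^sup>2 \<le> a * c"
  proof (cases "c = 0")
    case True
    have "b = 0"
    proof (rule ccontr)
      assume "b \<noteq> 0"
      then have "2 * (- (a + 1) / (2 * b)) * b = - (a + 1)" by simp
      then show False using pos[of "- (a + 1) / (2 * b)"] True by simp
    qed
    then show ?thesis using True by simp
  next
    case False
    then have "c > 0" using \<open>c \<ge> 0\<close> by simp
    have "0 \<le> a - b\<^sup>2 / c"
      using pos[of "- b / c"] False by (simp add: power2_eq_square field_simps)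
    then show ?thesis using \<open>c > 0\<close> by (simp add: field_simps)
  qed
  then show ?thesis unfolding abc .
qed

lemma L2_fun_inner_tendsto_zero:
  assumes "\<And>n. L2_fun M (f n)" "\<And>n. L2_fun M (g n)"
    and "(\<lambda>n. (\<integral>x. (norm (f n x))\<^sup>2 \<partial>M) * (\<integral>x. (norm (g n x))\<^sup>2 \<partial>M)) \<longlonglongrightarrow> 0"
  shows "(\<lambda>n. \<integral>x. f n x \<bullet> g n x \<partial>M) \<longlonglongrightarrow> 0"
proof -
  have "(\<lambda>n. (\<integral>x. f n x \<bullet> g n x \<partial>M)\<^sup>2) \<longlonglongrightarrow> 0"
    by (rule tendsto_sandwich[OF _ _ tendsto_const assms(3)])
       (auto intro!: always_eventually L2_fun_Cauchy_Schwarz assms)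
  then show ?thesis by (rule power_tendsto_0_iff[THEN iffD1, rotated]) simp
qed

lemma L2_fun_inner_tendsto:
  assumes f: "\<And>n. L2_fun M (f n)" and g: "\<And>n. L2_fun M (g n)" and F: "L2_fun M F" and G: "L2_fun M G"
    and limf: "(\<lambda>n. \<integral>x. (norm (f n x - F x))\<^sup>2 \<partial>M) \<longlonglongrightarrow> 0"
    and limg: "(\<lambda>n. \<integral>x. (norm (g n x - G x))\<^sup>2 \<partial>M) \<longlonglongrightarrow> 0"
  shows "(\<lambda>n. \<integral>x. f n x \<bullet> g n x \<partial>M) \<longlonglongrightarrow> (\<integral>x. F x \<bullet> G x \<partial>M)"
proof -
  note df = L2_fun_diff[OF f F] and dg = L2_fun_diff[OF g G]
  have "(\<lambda>n. (\<integral>x. (f n x - F x) \<bullet> (g n x - G x) \<partial>M) + (\<integral>x. (f n x - F x) \<bullet> G x \<partial>M)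
      + (\<integral>x. F x \<bullet> (g n x - G x) \<partial>M) + (\<integral>x. F x \<bullet> G x \<partial>M)) \<longlonglongrightarrow> 0 + 0 + 0 + (\<integral>x. F x \<bullet> G x \<partial>M)"
    by (intro tendsto_add tendsto_const L2_fun_inner_tendsto_zero df dg F G
         tendsto_mult_zero tendsto_mult_left_zero tendsto_mult_right_zero limf limg)
  moreover have "(\<integral>x. f n x \<bullet> g n x \<partial>M) = (\<integral>x. (f n x - F x) \<bullet> (g n x - G x) \<partial>M) + (\<integral>x. (f n x - F x) \<bullet> G x \<partial>M)
      + (\<integral>x. F x \<bullet> (g n x - G x) \<partial>M) + (\<integral>x. F x \<bullet> G x \<partial>M)" for n
  proof -
    have "(\<integral>x. f n x \<bullet> g n x \<partial>M) = (\<integral>x. (f n x - F x) \<bullet> (g n x - G x) + (f n x - F x) \<bullet> G x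
      + F x \<bullet> (g n x - G x) + F x \<bullet> G x \<partial>M)"
      by (rule Bochner_Integration.integral_cong) (auto simp: inner_diff_left inner_diff_right)
    then show ?thesis
      by (simp add: L2_fun_inner[OF df dg] L2_fun_inner[OF df G] L2_fun_inner[OF F dg] L2_fun_inner[OF F G])
  qed
  ultimately show ?thesis by simp
qed

lemma nn_integral_L2_fun:
  assumes "L2_fun M f"
  shows "(\<integral>\<^sup>+x. ennreal ((norm (f x))\<^sup>2) \<partial>M) = ennreal (\<integral>x. (norm (f x))\<^sup>2 \<partial>M)"
  using assms by (intro nn_integral_eq_integral) (auto simp: L2_fun_def)

text \<open>Along a subsequence whose consecutive differences decay geometrically in norm, the
  sequence converges almost everywhere; Fatou's lemma turns this into convergence in norm.\<close>

theorem L2_fun_complete: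
  fixes f :: "nat \<Rightarrow> 'a \<Rightarrow> 'b::euclidean_space"
  assumes f: "\<And>n. L2_fun M (f n)"
    and cauchy: "\<And>e. e > 0 \<Longrightarrow> \<exists>N. \<forall>m\<ge>N. \<forall>n\<ge>N. (\<integral>x. (norm (f m x - f n x))\<^sup>2 \<partial>M) \<le> e"
  shows "\<exists>F. L2_fun M F \<and> (\<lambda>n. \<integral>x. (norm (f n x - F x))\<^sup>2 \<partial>M) \<longlonglongrightarrow> 0"
proof -
  have [measurable]: "f n \<in> borel_measurable M" for n using f by (simp add: L2_fun_def)
  \<comment> \<open>The rate \<open>1/8\<close> leaves a convergent sum even after weighting the \<open>k\<close>-th difference by \<open>2^k\<close>; the weights then bound the differences pointwise by a geometric sequence.\<close>
  have "\<exists>N. \<forall>m\<ge>N. \<forall>n\<ge>N. (\<integral>x. (norm (f m x - f n x))\<^sup>2 \<partial>M) \<le> (1/8)^k" for k :: nat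
    by (rule cauchy) simp
  then obtain N where N: "\<And>k m n. N k \<le> m \<Longrightarrow> N k \<le> n \<Longrightarrow> (\<integral>x. (norm (f m x - f n x))\<^sup>2 \<partial>M) \<le> (1/8)^k"
    by metis
  define r where "r k = (\<Sum>j\<le>k. N j) + k" for k
  have rN: "N j \<le> r k" if "j \<le> k" for j k
    using member_le_sum[of j "{..k}" N] that by (simp add: r_def)
  have nn: "(\<integral>\<^sup>+x. ennreal ((norm (f m x - f n x))\<^sup>2) \<partial>M) \<le> ennreal ((1/8)^k)" if "N k \<le> m" "N k \<le> n" for k m n
    using N[OF that] by (subst nn_integral_L2_fun[OF L2_fun_diff[OF f f]]) (rule ennreal_leI)
  define d where "d k x = (norm (f (r (Suc k)) x - f (r k) x))\<^sup>2" for k x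
  have [measurable]: "d k \<in> borel_measurable M" for k unfolding d_def by measurable
  have "(\<integral>\<^sup>+x. (\<Sum>k. ennreal (2^k) * ennreal (d k x)) \<partial>M) = (\<Sum>k. ennreal (2^k) * (\<integral>\<^sup>+x. ennreal (d k x) \<partial>M))"
    by (subst nn_integral_suminf) (auto simp: nn_integral_cmult)
  also have "\<dots> \<le> (\<Sum>k. ennreal ((1/4)^k))"
  proof (intro suminf_le)
    fix k
    have "ennreal (2^k) * (\<integral>\<^sup>+x. ennreal (d k x) \<partial>M) \<le> ennreal (2^k) * ennreal ((1/8)^k)"
      unfolding d_def by (intro mult_left_mono nn rN) auto
    also have "\<dots> = ennreal ((1/4)^k)"
      by (simp add: ennreal_mult[symmetric] power_mult_distrib[symmetric])
    finally show "ennreal (2^k) * (\<integral>\<^sup>+x. ennreal (d k x) \<partial>M) \<le> ennreal ((1/4)^k)" .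
  qed auto
  also have "\<dots> < top"
    unfolding less_top[symmetric] by (rule ennreal_suminf_neq_top[OF summable_geometric]) auto
  finally have fin: "(\<integral>\<^sup>+x. (\<Sum>k. ennreal (2^k) * ennreal (d k x)) \<partial>M) \<noteq> \<infinity>"
    unfolding infinity_ennreal_def less_top .
  have "(\<lambda>x. \<Sum>k. ennreal (2^k) * ennreal (d k x)) \<in> borel_measurable M"
    by measurable
  from nn_integral_PInf_AE[OF this fin]
  have "AE x in M. (\<Sum>k. ennreal (2^k) * ennreal (d k x)) \<noteq> \<infinity>" .
  then have conv: "AE x in M. convergent (\<lambda>k. f (r k) x)"
  proof eventually_elim
    case (elim x)
    define C where "C = enn2real (\<Sum>k. ennreal (2^k) * ennreal (d k x))"
    have bound: "norm (f (r (Suc k)) x - f (r k) x) \<le> sqrt C * (1 / sqrt 2)^k" for k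
    proof -
      have "ennreal (2^k * d k x) = (\<Sum>j\<in>{k}. ennreal (2^j) * ennreal (d j x))"
        by (simp add: ennreal_mult d_def)
      also have "\<dots> \<le> (\<Sum>k. ennreal (2^k) * ennreal (d k x))"
        by (rule sum_le_suminf) auto
      also have "\<dots> = ennreal C" using elim by (simp add: C_def less_top)
      finally have "2^k * d k x \<le> C" by (simp add: C_def d_def)
      then have "d k x \<le> C * (1/2)^k" by (simp add: field_simps power_divide)
      then have "sqrt (d k x) \<le> sqrt (C * (1/2)^k)" by (rule real_sqrt_le_mono)
      then show ?thesis by (simp add: d_def real_sqrt_mult real_sqrt_power real_sqrt_divide)
    qed
    have "summable (\<lambda>k. sqrt C * (1 / sqrt 2)^k)"
      by (intro summable_mult summable_geometric) (simp add: real_less_rsqrt)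
    then have "summable (\<lambda>k. f (r (Suc k)) x - f (r k) x)"
      by (rule summable_comparison_test'[where N=0]) (use bound in simp)
    then show ?case
      unfolding summable_iff_convergent sum_lessThan_telescope[of "\<lambda>k. f (r k) x"]
      by (simp add: convergent_diff_const_right_iff)
  qed
  define F where "F x = lim (\<lambda>k. f (r k) x)" for x
  have [measurable]: "F \<in> borel_measurable M" unfolding F_def by measurable
  have fatou: "(\<integral>\<^sup>+x. ennreal ((norm (f n x - F x))\<^sup>2) \<partial>M) \<le> ennreal ((1/8)^j)" if n: "N j \<le> n" for n j
  proof -
    have "(\<integral>\<^sup>+x. ennreal ((norm (f n x - F x))\<^sup>2) \<partial>M)
        = (\<integral>\<^sup>+x. liminf (\<lambda>k. ennreal ((norm (f n x - f (r k) x))\<^sup>2)) \<partial>M)"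
    proof (rule nn_integral_cong_AE)
      show "AE x in M. ennreal ((norm (f n x - F x))\<^sup>2) = liminf (\<lambda>k. ennreal ((norm (f n x - f (r k) x))\<^sup>2))"
        using conv
      proof eventually_elim
        case (elim x)
        then have "(\<lambda>k. f (r k) x) \<longlonglongrightarrow> F x" by (simp add: F_def convergent_LIMSEQ_iff)
        then have "(\<lambda>k. ennreal ((norm (f n x - f (r k) x))\<^sup>2)) \<longlonglongrightarrow> ennreal ((norm (f n x - F x))\<^sup>2)"
          by (intro tendsto_ennrealI tendsto_intros)
        then show ?case by (rule sym[OF lim_imp_Liminf[OF trivial_limit_sequentially]])
      qed
    qed
    also have "\<dots> \<le> liminf (\<lambda>k. \<integral>\<^sup>+x. ennreal ((norm (f n x - f (r k) x))\<^sup>2) \<partial>M)"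
      by (rule nn_integral_liminf) measurable
    also have "\<dots> \<le> liminf (\<lambda>k. ennreal ((1/8)^j))"
      using rN[of j] n by (intro Liminf_mono eventually_sequentiallyI[of j] nn) auto
    finally show ?thesis by (simp add: Liminf_const)
  qed
  have diffL2: "L2_fun M (\<lambda>x. f n x - F x)" if "N 0 \<le> n" for n
    unfolding L2_fun_def
  proof
    show "integrable M (\<lambda>x. (norm (f n x - F x))\<^sup>2)"
      using fatou[OF that] by (intro integrableI_bounded) (auto simp: less_top[symmetric] top_unique)
  qed measurable
  have FL2: "L2_fun M F"
    using L2_fun_diff[OF f[of "N 0"] diffL2[of "N 0"]] by simp
  have "(\<lambda>n. \<integral>x. (norm (f n x - F x))\<^sup>2 \<partial>M) \<longlonglongrightarrow> 0"
  proof (rule LIMSEQ_I)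
    fix e :: real assume "0 < e"
    then obtain j where j: "(1/8::real)^j < e" using real_arch_pow_inv[of e "1/8"] by auto
    have "norm ((\<integral>x. (norm (f n x - F x))\<^sup>2 \<partial>M) - 0) < e" if "N j \<le> n" for n
    proof -
      have "ennreal (\<integral>x. (norm (f n x - F x))\<^sup>2 \<partial>M) \<le> ennreal ((1/8)^j)"
        using fatou[OF that] unfolding nn_integral_L2_fun[OF L2_fun_diff[OF f FL2]] .
      then have "(\<integral>x. (norm (f n x - F x))\<^sup>2 \<partial>M) \<le> (1/8)^j" by simp
      moreover have "0 \<le> (\<integral>x. (norm (f n x - F x))\<^sup>2 \<partial>M)" by simp
      ultimately show ?thesis using j by simp
    qed
    then show "\<exists>no. \<forall>n\<ge>no. norm ((\<integral>x. (norm (f n x - F x))\<^sup>2 \<partial>M) - 0) < e" by blast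
  qed
  with FL2 show ?thesis by blast
qed

subsection \<open>Square integrability on a set\<close>

text \<open>Extension by zero reduces everything on a set to functions on the whole space.\<close>

lemma square_integrable_on_L2_fun:
  "square_integrable_on M S u \<longleftrightarrow> L2_fun M (\<lambda>x. indicat_real S x *\<^sub>R u x)"
proof -
  have "(\<lambda>x. (norm (indicat_real S x *\<^sub>R u x))\<^sup>2) = (\<lambda>x. indicat_real S x *\<^sub>R (norm (u x))\<^sup>2)"
    by (auto split: split_indicator)
  then show ?thesis
    by (simp add: square_integrable_on_def L2_fun_def set_borel_measurable_def set_integrable_def)
qed

lemma set_integral_inner_L2:
  "(LINT x:S|M. u x \<bullet> v x) = (\<integral>x. (indicat_real S x *\<^sub>R u x) \<bullet> (indicat_real S x *\<^sub>R v x) \<partial>M)"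
  unfolding set_lebesgue_integral_def
  by (rule Bochner_Integration.integral_cong) (auto split: split_indicator)

lemma set_integral_norm_L2:
  "(LINT x:S|M. (norm (u x))\<^sup>2) = (\<integral>x. (norm (indicat_real S x *\<^sub>R u x))\<^sup>2 \<partial>M)"
  unfolding set_lebesgue_integral_def
  by (rule Bochner_Integration.integral_cong) (auto split: split_indicator)

lemma square_integrable_on_inner:
  assumes "square_integrable_on M S u" "square_integrable_on M S v"
  shows "set_integrable M S (\<lambda>x. u x \<bullet> v x)"
proof -
  have "(\<lambda>x. indicat_real S x *\<^sub>R (u x \<bullet> v x)) = (\<lambda>x. (indicat_real S x *\<^sub>R u x) \<bullet> (indicat_real S x *\<^sub>R v x))"
    by (auto split: split_indicator)
  then show ?thesis
    using L2_fun_inner[OF assms[unfolded square_integrable_on_L2_fun]] by (simp add: set_integrable_def)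
qed

lemma square_integrable_on_lincomb:
  assumes "square_integrable_on M S u" "square_integrable_on M S v"
  shows "square_integrable_on M S (\<lambda>x. u x + t *\<^sub>R v x)"
    and "(LINT x:S|M. (norm (u x + t *\<^sub>R v x))\<^sup>2)
      = (LINT x:S|M. (norm (u x))\<^sup>2) + 2 * t * (LINT x:S|M. u x \<bullet> v x) + t\<^sup>2 * (LINT x:S|M. (norm (v x))\<^sup>2)"
  using L2_fun_lincomb[OF assms[unfolded square_integrable_on_L2_fun], of t]
  unfolding square_integrable_on_L2_fun set_integral_norm_L2 set_integral_inner_L2
  by (simp_all add: scaleR_add_right mult.commute[of t])

lemma square_integrable_on_diff:
  assumes "square_integrable_on M S u" "square_integrable_on M S v"
  shows "square_integrable_on M S (\<lambda>x. u x - v x)"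
  using square_integrable_on_lincomb(1)[OF assms, of "-1"] by simp

lemma tendsto_L2_square_integrable:
  assumes "tendsto_L2 M S v u" "square_integrable_on M S u"
  shows "square_integrable_on M S (v n)"
  using square_integrable_on_lincomb(1)[of M S "\<lambda>x. v n x - u x" u 1] assms by (simp add: tendsto_L2_def)

lemma tendsto_L2_inner:
  assumes "tendsto_L2 M S v u" "tendsto_L2 M S v' u'"
    and u: "square_integrable_on M S u" "square_integrable_on M S u'"
  shows "(\<lambda>n. LINT x:S|M. v n x \<bullet> v' n x) \<longlonglongrightarrow> (LINT x:S|M. u x \<bullet> u' x)"
proof -
  have lim: "(\<lambda>n. \<integral>x. (norm (indicat_real S x *\<^sub>R v n x - indicat_real S x *\<^sub>R u x))\<^sup>2 \<partial>M) \<longlonglongrightarrow> 0"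
    if "tendsto_L2 M S v u" for v :: "nat \<Rightarrow> 'a \<Rightarrow> 'b" and u
    using that unfolding tendsto_L2_def set_integral_norm_L2 by (simp add: scaleR_diff_right)
  show ?thesis
    unfolding set_integral_inner_L2
    by (rule L2_fun_inner_tendsto)
       (use assms lim tendsto_L2_square_integrable[OF assms(1) u(1)] tendsto_L2_square_integrable[OF assms(2) u(2)]
         in \<open>auto simp: square_integrable_on_L2_fun\<close>)
qed

lemma tendsto_L2_norm:
  assumes "tendsto_L2 M S v u" "square_integrable_on M S u"
  shows "(\<lambda>n. LINT x:S|M. (norm (v n x))\<^sup>2) \<longlonglongrightarrow> (LINT x:S|M. (norm (u x))\<^sup>2)"
  using tendsto_L2_inner[OF assms(1) assms(1) assms(2) assms(2)] by (simp add: power2_norm_eq_inner)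

lemma tendsto_L2_const: "square_integrable_on M S u \<Longrightarrow> tendsto_L2 M S (\<lambda>_. u) u"
  unfolding tendsto_L2_def square_integrable_on_L2_fun L2_fun_def
  by (simp add: set_lebesgue_integral_def)

theorem tendsto_L2_complete:
  fixes v :: "nat \<Rightarrow> 'a \<Rightarrow> 'b::euclidean_space"
  assumes S: "S \<in> sets M" and v: "\<And>n. square_integrable_on M S (v n)"
    and cauchy: "\<And>e. e > 0 \<Longrightarrow> \<exists>N. \<forall>m\<ge>N. \<forall>n\<ge>N. (LINT x:S|M. (norm (v m x - v n x))\<^sup>2) \<le> e"
  shows "\<exists>u. square_integrable_on M S u \<and> tendsto_L2 M S v u"
proof -
  let ?f = "\<lambda>n x. indicat_real S x *\<^sub>R v n x"
  have f: "L2_fun M (?f n)" for n using v by (simp add: square_integrable_on_L2_fun)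
  obtain F where F: "L2_fun M F" and lim: "(\<lambda>n. \<integral>x. (norm (?f n x - F x))\<^sup>2 \<partial>M) \<longlonglongrightarrow> 0"
  proof -
    have "\<exists>N. \<forall>m\<ge>N. \<forall>n\<ge>N. (\<integral>x. (norm (?f m x - ?f n x))\<^sup>2 \<partial>M) \<le> e" if "e > 0" for e
      using cauchy[OF that] unfolding set_integral_norm_L2 by (simp add: scaleR_diff_right)
    then show ?thesis using L2_fun_complete[of M ?f] f that by blast
  qed
  have [measurable]: "F \<in> borel_measurable M" "S \<in> sets M" using F S by (auto simp: L2_fun_def)
  have FS: "square_integrable_on M S F"
    unfolding square_integrable_on_L2_fun L2_fun_def
  proof
    show "integrable M (\<lambda>x. (norm (indicat_real S x *\<^sub>R F x))\<^sup>2)"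
      by (rule Bochner_Integration.integrable_bound[of M "\<lambda>x. (norm (F x))\<^sup>2"])
         (use F in \<open>auto simp: L2_fun_def split: split_indicator\<close>)
  qed measurable
  have "(\<lambda>n. LINT x:S|M. (norm (v n x - F x))\<^sup>2) \<longlonglongrightarrow> 0"
  proof (rule tendsto_sandwich[OF _ _ tendsto_const lim])
    show "\<forall>\<^sub>F n in sequentially. (LINT x:S|M. (norm (v n x - F x))\<^sup>2) \<le> (\<integral>x. (norm (?f n x - F x))\<^sup>2 \<partial>M)"
    proof (intro always_eventually allI)
      fix n
      show "(LINT x:S|M. (norm (v n x - F x))\<^sup>2) \<le> (\<integral>x. (norm (?f n x - F x))\<^sup>2 \<partial>M)"
        unfolding set_integral_norm_L2
        using square_integrable_on_diff[OF v FS, of n] L2_fun_diff[OF f F, of n]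
        by (intro integral_mono) (auto simp: square_integrable_on_L2_fun L2_fun_def split: split_indicator)
    qed
  qed (auto simp: set_integral_norm_L2)
  then show ?thesis
    using FS square_integrable_on_diff[OF v FS] by (auto simp: tendsto_L2_def)
qed

section \<open>Compactness of sequences with bounded energy\<close>

lemma continuous_bounded_set_finite_sq:
  fixes u :: "'a::euclidean_space \<Rightarrow> 'b::euclidean_space"
  assumes sets: "sets M = sets borel" and fin: "emeasure M S < \<infinity>" and bdd: "bounded S" and S: "S \<in> sets borel"
    and u: "continuous_on UNIV u"
  shows "square_integrable_on M S u"
proof -
  have "compact (closure S)" using bdd by simp
  then have "compact (u ` closure S)"
    by (intro compact_continuous_image continuous_on_subset[OF u]) auto
  then obtain B where "\<forall>y\<in>u ` closure S. norm y \<le> B"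
    using compact_imp_bounded bounded_iff by metis
  then have B: "norm (u x) \<le> B" if "x \<in> S" for x
    using closure_subset[of S] that by blast
  have um: "u \<in> borel_measurable borel" using u by (rule borel_measurable_continuous_onI)
  have [measurable]: "u \<in> borel_measurable M" "S \<in> sets M"
    using um S sets measurable_cong_sets[OF sets refl] by auto
  show ?thesis
    unfolding square_integrable_on_L2_fun L2_fun_def
  proof
    show "integrable M (\<lambda>x. (norm (indicat_real S x *\<^sub>R u x))\<^sup>2)"
    proof (rule Bochner_Integration.integrable_bound)
      show "integrable M (\<lambda>x. B\<^sup>2 * indicat_real S x)"
        using fin by (intro integrable_mult_right integrable_real_indicator) auto
      show "AE x in M. norm ((norm (indicat_real S x *\<^sub>R u x))\<^sup>2) \<le> norm (B\<^sup>2 * indicat_real S x)"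
        using B by (auto intro!: AE_I2 power_mono split: split_indicator)
    qed measurable
  qed measurable
qed

lemma bounded_borel_finite_area: "bounded S \<Longrightarrow> S \<in> sets borel \<Longrightarrow> emeasure lborel (S :: (real^2) set) < \<infinity>"
  using emeasure_bounded_finite[of S] by simp

lemma nn_integral_set_sq:
  assumes "square_integrable_on M S u"
  shows "(\<integral>\<^sup>+x\<in>S. ennreal ((norm (u x))\<^sup>2) \<partial>M) = ennreal (LINT x:S|M. (norm (u x))\<^sup>2)"
proof -
  have "(\<integral>\<^sup>+x\<in>S. ennreal ((norm (u x))\<^sup>2) \<partial>M) = (\<integral>\<^sup>+x. ennreal ((norm (indicat_real S x *\<^sub>R u x))\<^sup>2) \<partial>M)"
    by (intro nn_integral_cong) (auto split: split_indicator)
  then show ?thesis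
    using nn_integral_L2_fun[OF assms[unfolded square_integrable_on_L2_fun]] by (simp only: set_integral_norm_L2)
qed

lemma C1_grad_lincomb:
  assumes "C1_grad \<phi> D" "C1_grad \<psi> E"
  shows "C1_grad (\<lambda>x. \<phi> x + t * \<psi> x) (\<lambda>x. D x + t *\<^sub>R E x)"
proof -
  have "((\<lambda>x. \<phi> x + t * \<psi> x) has_derivative (\<lambda>h. h \<bullet> (D x + t *\<^sub>R E x))) (at x)" for x
    using C1_gradD(1)[OF assms(1), of x] C1_gradD(1)[OF assms(2), of x]
    by (auto intro!: derivative_eq_intros simp: inner_add_right)
  then show ?thesis
    using C1_gradD(2)[OF assms(1)] C1_gradD(2)[OF assms(2)]
    by (auto simp: C1_grad_def gderiv_def intro!: continuous_intros)
qed

lemma C1_grad_diff: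
  assumes "C1_grad \<phi> D" "C1_grad \<psi> E"
  shows "C1_grad (\<lambda>x. \<phi> x - \<psi> x) (\<lambda>x. D x - E x)"
  using C1_grad_lincomb[OF assms, of "-1"] by simp

subsection \<open>Poincare inequality on a square\<close>

definition axis_square :: "real^2 \<Rightarrow> real \<Rightarrow> (real^2) set" where
  "axis_square p \<eta> = chart_box p (axis 1 1) (axis 2 1) (\<lambda>_. 0) {0..<\<eta>} {0..<\<eta>}"

lemma orthoframe_axes: "orthoframe (axis 1 1) (axis 2 1)" "orthoframe (axis 2 1) (axis 1 1)"
  by (auto simp: orthoframe_def norm_axis_1 inner_axis_axis)

lemma axis_square_swap: "axis_square p \<eta> = chart_box p (axis 2 1) (axis 1 1) (\<lambda>_. 0) {0..<\<eta>} {0..<\<eta>}"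
  by (auto simp: axis_square_def chart_box_def)

lemma borel_axis_square [measurable]: "axis_square p \<eta> \<in> sets borel"
  unfolding axis_square_def by measurable

lemma emeasure_axis_square: "\<eta> \<ge> 0 \<Longrightarrow> emeasure lborel (axis_square p \<eta>) = ennreal (\<eta>\<^sup>2)"
proof -
  assume "\<eta> \<ge> 0"
  have "emeasure lborel (axis_square p \<eta>) = (\<integral>\<^sup>+x\<in>axis_square p \<eta>. 1 \<partial>lborel)" by simp
  also have "\<dots> = ennreal (\<eta>\<^sup>2)"
    unfolding axis_square_def
    by (subst nn_integral_chart_box[OF orthoframe_axes(1)])
       (use \<open>\<eta> \<ge> 0\<close> in \<open>auto simp: nn_integral_cmult_indicator ennreal_mult[symmetric] power2_eq_square\<close>)
  finally show ?thesis .
qed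

lemma dist_axis_square:
  assumes "x \<in> axis_square p \<eta>" "y \<in> axis_square p \<eta>"
  shows "dist x y \<le> 2 * \<eta>"
proof -
  have "dist x y \<le> \<bar>(x - y) $ 1\<bar> + \<bar>(x - y) $ 2\<bar>"
    using norm_le_l1_cart[of "x - y"] by (simp add: dist_norm sum_2)
  also have "\<dots> \<le> \<eta> + \<eta>"
    using assms by (intro add_mono) (auto simp: axis_square_def chart_box_def inner_axis)
  finally show ?thesis by simp
qed

lemma axis_square_sq_integrable:
  fixes u :: "real^2 \<Rightarrow> 'b::euclidean_space"
  assumes "continuous_on UNIV u" "\<eta> > 0"
  shows "square_integrable_on lborel (axis_square p \<eta>) u"
proof (rule continuous_bounded_set_finite_sq)
  show "bounded (axis_square p \<eta>)" using dist_axis_square unfolding bounded_two_points by blast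
  show "emeasure lborel (axis_square p \<eta>) < \<infinity>" using assms(2) by (simp add: emeasure_axis_square)
qed (use assms in auto)

lemma ennreal_le_twice:
  assumes "x \<le> 2 * y + 2 * z" "0 \<le> y" "0 \<le> z"
  shows "ennreal x \<le> ennreal 2 * ennreal y + ennreal 2 * ennreal z"
proof -
  have "ennreal x \<le> ennreal (2 * y + 2 * z)" by (rule ennreal_leI[OF assms(1)])
  then show ?thesis using assms by (simp add: ennreal_mult)
qed

lemma set_integral_sq_le:
  fixes u :: "'a \<Rightarrow> real"
  assumes u: "square_integrable_on M S u" and one: "square_integrable_on M S (\<lambda>_. 1::real)"
  shows "(LINT x:S|M. u x)\<^sup>2 \<le> (LINT x:S|M. (u x)\<^sup>2) * (LINT x:S|M. 1)"
proof -
  have "(LINT x:S|M. u x \<bullet> 1)\<^sup>2 \<le> (LINT x:S|M. (norm (u x))\<^sup>2) * (LINT x:S|M. (norm (1::real))\<^sup>2)"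
    unfolding set_integral_inner_L2 set_integral_norm_L2
    by (rule L2_fun_Cauchy_Schwarz) (use assms in \<open>auto simp: square_integrable_on_L2_fun\<close>)
  then show ?thesis by simp
qed

text \<open>The deviation from the mean is bounded by the average of all increments, and an
  increment splits into one along each axis.\<close>

lemma poincare_square:
  fixes \<phi> :: "real^2 \<Rightarrow> real" and p :: "real^2"
  assumes C1: "C1_grad \<phi> D" and \<eta>: "\<eta> > 0"
  defines "Q \<equiv> axis_square p \<eta>"
  shows "(\<integral>\<^sup>+x\<in>Q. ennreal ((\<phi> x)\<^sup>2) \<partial>lborel)
    \<le> ennreal (2 / \<eta>\<^sup>2 * (LINT x:Q|lborel. \<phi> x)\<^sup>2)
      + ennreal (4 * \<eta>\<^sup>2) * (\<integral>\<^sup>+x\<in>Q. ennreal ((norm (D x))\<^sup>2) \<partial>lborel)"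
proof -
  note [measurable] = C1_grad_measurable[OF C1]
  define m where "m = (LINT x:Q|lborel. \<phi> x) / \<eta>\<^sup>2"
  have cont: "continuous_on UNIV \<phi>" by (rule C1_gradD(3)[OF C1])
  have sqi: "square_integrable_on lborel Q u" if "continuous_on UNIV u" for u :: "real^2 \<Rightarrow> real"
    unfolding Q_def using that \<eta> by (rule axis_square_sq_integrable)
  have one: "(LINT x:Q|lborel. 1) = \<eta>\<^sup>2"
    using \<eta> by (simp add: Q_def set_lebesgue_integral_def measure_def emeasure_axis_square)
  have int: "set_integrable lborel Q \<phi>"
    using square_integrable_on_inner[OF sqi[OF cont] sqi[OF continuous_on_const[of UNIV 1]]] by simp
  have int1: "set_integrable lborel Q (\<lambda>x. c)" for c :: real
    using square_integrable_on_inner[OF sqi[OF continuous_on_const[of UNIV c]] sqi[OF continuous_on_const[of UNIV 1]]] by simp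
  have dev: "ennreal ((\<phi> x - m)\<^sup>2) \<le> ennreal (1 / \<eta>\<^sup>2) * (\<integral>\<^sup>+y\<in>Q. ennreal ((\<phi> x - \<phi> y)\<^sup>2) \<partial>lborel)" for x
  proof -
    have s: "square_integrable_on lborel Q (\<lambda>y. \<phi> x - \<phi> y)"
      by (intro sqi continuous_intros cont)
    have "(LINT y:Q|lborel. \<phi> x - \<phi> y) = \<eta>\<^sup>2 * (\<phi> x - m)"
    proof -
      have "(LINT y:Q|lborel. \<phi> x - \<phi> y) = (LINT y:Q|lborel. \<phi> x) - (LINT y:Q|lborel. \<phi> y)"
        by (rule set_integral_diff(2)[OF int1 int])
      moreover have "(LINT y:Q|lborel. \<phi> x) = \<phi> x * \<eta>\<^sup>2"
      proof -
        have "(LINT y:Q|lborel. \<phi> x * 1) = \<phi> x * (LINT y:Q|lborel. 1)" by (rule set_integral_mult_right)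
        then show ?thesis using one by simp
      qed
      moreover have "m * \<eta>\<^sup>2 = (LINT y:Q|lborel. \<phi> y)" using \<eta> by (simp add: m_def)
      ultimately show ?thesis by (simp add: left_diff_distrib mult.commute[of "\<eta>\<^sup>2"])
    qed
    then have "(\<eta>\<^sup>2 * (\<phi> x - m))\<^sup>2 \<le> (LINT y:Q|lborel. (\<phi> x - \<phi> y)\<^sup>2) * \<eta>\<^sup>2"
      using set_integral_sq_le[OF s sqi[OF continuous_on_const]] unfolding one by simp
    moreover have "(\<eta>\<^sup>2 * (\<phi> x - m))\<^sup>2 = (\<eta>\<^sup>2 * (\<phi> x - m)\<^sup>2) * \<eta>\<^sup>2"
      by (simp add: power2_eq_square mult_ac)
    ultimately have "(\<eta>\<^sup>2 * (\<phi> x - m)\<^sup>2) * \<eta>\<^sup>2 \<le> (LINT y:Q|lborel. (\<phi> x - \<phi> y)\<^sup>2) * \<eta>\<^sup>2"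
      by simp
    then have "\<eta>\<^sup>2 * (\<phi> x - m)\<^sup>2 \<le> (LINT y:Q|lborel. (\<phi> x - \<phi> y)\<^sup>2)"
      by (rule mult_right_le_imp_le) (use \<eta> in simp)
    then have "(\<phi> x - m)\<^sup>2 \<le> 1 / \<eta>\<^sup>2 * (LINT y:Q|lborel. (\<phi> x - \<phi> y)\<^sup>2)"
      using \<eta> by (simp add: pos_le_divide_eq mult.commute)
    moreover have "(\<integral>\<^sup>+y\<in>Q. ennreal ((\<phi> x - \<phi> y)\<^sup>2) \<partial>lborel) = ennreal (LINT y:Q|lborel. (\<phi> x - \<phi> y)\<^sup>2)"
      using nn_integral_set_sq[OF s] by simp
    ultimately show ?thesis by (simp add: ennreal_mult'[symmetric] ennreal_leI)
  qed
  let ?e = "axis 1 1 :: real^2" and ?f = "axis 2 1 :: real^2"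
  let ?\<Psi> = "\<lambda>s t. chart p ?e ?f (\<lambda>_. 0) s t"
  let ?I = "{0..<\<eta>}"
  define A where "A t = (\<integral>\<^sup>+s\<in>?I. ennreal ((D (?\<Psi> s t) \<bullet> ?e)\<^sup>2) \<partial>lborel)" for t
  define B where "B s = (\<integral>\<^sup>+t\<in>?I. ennreal ((D (?\<Psi> s t) \<bullet> ?f)\<^sup>2) \<partial>lborel)" for s
  have [measurable]: "A \<in> borel_measurable borel" "B \<in> borel_measurable borel"
    unfolding A_def B_def by measurable
  have swap: "?\<Psi> s t = chart p ?f ?e (\<lambda>_. 0) t s" for s t by (simp add: chart_def)
  have incr_t: "ennreal ((\<phi> (?\<Psi> s t) - \<phi> (?\<Psi> s t'))\<^sup>2) \<le> ennreal \<eta> * B s" if "t \<in> ?I" "t' \<in> ?I" for s t t'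
  proof -
    have "ennreal ((\<phi> (?\<Psi> s t) - \<phi> (?\<Psi> s t'))\<^sup>2)
        \<le> ennreal \<eta> * (\<integral>\<^sup>+t\<in>{0<..<\<eta>}. ennreal ((D (?\<Psi> s t) \<bullet> ?f)\<^sup>2) \<partial>lborel)"
      by (rule increment_sq_le_integral[OF C1_grad_along_fibre[OF C1]]) (use that in auto)
    also have "\<dots> \<le> ennreal \<eta> * B s"
      unfolding B_def by (intro mult_left_mono nn_integral_mono_set) auto
    finally show ?thesis .
  qed
  have incr_s: "ennreal ((\<phi> (?\<Psi> s t) - \<phi> (?\<Psi> s' t))\<^sup>2) \<le> ennreal \<eta> * A t" if "s \<in> ?I" "s' \<in> ?I" for s s' t
  proof -
    have "ennreal ((\<phi> (?\<Psi> s t) - \<phi> (?\<Psi> s' t))\<^sup>2)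
        \<le> ennreal \<eta> * (\<integral>\<^sup>+s\<in>{0<..<\<eta>}. ennreal ((D (?\<Psi> s t) \<bullet> ?e)\<^sup>2) \<partial>lborel)"
      unfolding swap by (rule increment_sq_le_integral[OF C1_grad_along_fibre[OF C1]]) (use that in auto)
    also have "\<dots> \<le> ennreal \<eta> * A t"
      unfolding A_def by (intro mult_left_mono nn_integral_mono_set) auto
    finally show ?thesis .
  qed
  have sq2: "(a - c)\<^sup>2 \<le> 2 * (a - b)\<^sup>2 + 2 * (b - c)\<^sup>2" for a b c :: real
    using sum_squares_bound[of "a - b" "b - c"] by (simp add: power2_eq_square algebra_simps)
  have incr: "ennreal ((\<phi> (?\<Psi> s t) - \<phi> (?\<Psi> s' t'))\<^sup>2) \<le> ennreal (2 * \<eta>) * (A t + B s')"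
    if "s \<in> ?I" "t \<in> ?I" "s' \<in> ?I" "t' \<in> ?I" for s t s' t'
  proof -
    have "ennreal ((\<phi> (?\<Psi> s t) - \<phi> (?\<Psi> s' t'))\<^sup>2)
      \<le> ennreal 2 * ennreal ((\<phi> (?\<Psi> s t) - \<phi> (?\<Psi> s' t))\<^sup>2) + ennreal 2 * ennreal ((\<phi> (?\<Psi> s' t) - \<phi> (?\<Psi> s' t'))\<^sup>2)"
      by (rule ennreal_le_twice[OF sq2]) auto
    also have "\<dots> \<le> ennreal 2 * (ennreal \<eta> * A t) + ennreal 2 * (ennreal \<eta> * B s')"
      by (intro add_mono mult_left_mono incr_s incr_t that) auto
    also have "\<dots> = ennreal (2 * \<eta>) * (A t + B s')"
      using \<eta> by (simp add: ennreal_mult distrib_left mult.assoc)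
    finally show ?thesis .
  qed
  have QA: "(\<integral>\<^sup>+t\<in>?I. A t \<partial>lborel) = (\<integral>\<^sup>+x\<in>Q. ennreal ((D x \<bullet> ?e)\<^sup>2) \<partial>lborel)"
    unfolding Q_def axis_square_swap A_def swap
    by (subst nn_integral_chart_box[OF orthoframe_axes(2)]) auto
  have QB: "(\<integral>\<^sup>+s\<in>?I. B s \<partial>lborel) = (\<integral>\<^sup>+x\<in>Q. ennreal ((D x \<bullet> ?f)\<^sup>2) \<partial>lborel)"
    unfolding Q_def axis_square_def B_def
    by (subst nn_integral_chart_box[OF orthoframe_axes(1)]) auto
  have QAB: "(\<integral>\<^sup>+t\<in>?I. A t \<partial>lborel) + (\<integral>\<^sup>+s\<in>?I. B s \<partial>lborel) = (\<integral>\<^sup>+x\<in>Q. ennreal ((norm (D x))\<^sup>2) \<partial>lborel)"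
    unfolding QA QB Q_def
    by (subst nn_integral_add[symmetric])
       (auto intro!: nn_integral_cong simp: norm_orthoframe[OF orthoframe_axes(1)] split: split_indicator)
  have inner: "(\<integral>\<^sup>+y\<in>Q. ennreal ((\<phi> (?\<Psi> s t) - \<phi> y)\<^sup>2) \<partial>lborel)
      \<le> ennreal (2 * \<eta>) * (ennreal (\<eta>\<^sup>2) * A t + ennreal \<eta> * (\<integral>\<^sup>+s\<in>?I. B s \<partial>lborel))"
    if st: "s \<in> ?I" "t \<in> ?I" for s t
  proof -
    have "(\<integral>\<^sup>+y\<in>Q. ennreal ((\<phi> (?\<Psi> s t) - \<phi> y)\<^sup>2) \<partial>lborel)
        = (\<integral>\<^sup>+s'\<in>?I. \<integral>\<^sup>+t'\<in>?I. ennreal ((\<phi> (?\<Psi> s t) - \<phi> (?\<Psi> s' t'))\<^sup>2) \<partial>lborel \<partial>lborel)"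
      unfolding Q_def axis_square_def by (subst nn_integral_chart_box[OF orthoframe_axes(1)]) auto
    also have "\<dots> \<le> (\<integral>\<^sup>+s'\<in>?I. \<integral>\<^sup>+t'\<in>?I. ennreal (2 * \<eta>) * (A t + B s') \<partial>lborel \<partial>lborel)"
      by (intro nn_integral_mono_set order_refl incr st) auto
    also have "\<dots> = (\<integral>\<^sup>+s'. (ennreal (2 * \<eta>) * ennreal \<eta>) * (A t * indicator ?I s' + B s' * indicator ?I s') \<partial>lborel)"
      using \<eta> by (intro nn_integral_cong, subst nn_integral_cmult_indicator)
        (auto simp: distrib_left distrib_right mult_ac split: split_indicator)
    also have "\<dots> = (ennreal (2 * \<eta>) * ennreal \<eta>) * (A t * ennreal \<eta> + (\<integral>\<^sup>+s\<in>?I. B s \<partial>lborel))"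
      using \<eta> by (simp add: nn_integral_cmult nn_integral_add nn_integral_cmult_indicator)
    also have "\<dots> = ennreal (2 * \<eta>) * (ennreal (\<eta>\<^sup>2) * A t + ennreal \<eta> * (\<integral>\<^sup>+s\<in>?I. B s \<partial>lborel))"
      using \<eta> by (simp add: power2_eq_square ennreal_mult distrib_left mult_ac)
    finally show ?thesis .
  qed
  have double: "(\<integral>\<^sup>+x\<in>Q. (\<integral>\<^sup>+y\<in>Q. ennreal ((\<phi> x - \<phi> y)\<^sup>2) \<partial>lborel) \<partial>lborel)
      \<le> ennreal (2 * \<eta>^4) * (\<integral>\<^sup>+x\<in>Q. ennreal ((norm (D x))\<^sup>2) \<partial>lborel)"
  proof -
    have "(\<integral>\<^sup>+x\<in>Q. (\<integral>\<^sup>+y\<in>Q. ennreal ((\<phi> x - \<phi> y)\<^sup>2) \<partial>lborel) \<partial>lborel)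
        = (\<integral>\<^sup>+s\<in>?I. \<integral>\<^sup>+t\<in>?I. (\<integral>\<^sup>+y\<in>Q. ennreal ((\<phi> (?\<Psi> s t) - \<phi> y)\<^sup>2) \<partial>lborel) \<partial>lborel \<partial>lborel)"
      unfolding Q_def by (subst (2) axis_square_def, subst nn_integral_chart_box[OF orthoframe_axes(1)]) auto
    also have "\<dots> \<le> (\<integral>\<^sup>+s\<in>?I. \<integral>\<^sup>+t\<in>?I. ennreal (2 * \<eta>) * (ennreal (\<eta>\<^sup>2) * A t + ennreal \<eta> * (\<integral>\<^sup>+s\<in>?I. B s \<partial>lborel)) \<partial>lborel \<partial>lborel)"
      by (intro nn_integral_mono_set order_refl inner) auto
    also have "\<dots> = (\<integral>\<^sup>+s\<in>?I. ennreal (2 * \<eta>) * (ennreal (\<eta>\<^sup>2) * (\<integral>\<^sup>+t\<in>?I. A t \<partial>lborel) + ennreal \<eta> * (\<integral>\<^sup>+s\<in>?I. B s \<partial>lborel) * ennreal \<eta>) \<partial>lborel)"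
    proof (intro nn_integral_cong arg_cong2[of _ _ _ _ "(*)"] refl)
      have "(\<integral>\<^sup>+t\<in>?I. ennreal (2 * \<eta>) * (ennreal (\<eta>\<^sup>2) * A t + ennreal \<eta> * (\<integral>\<^sup>+s\<in>?I. B s \<partial>lborel)) \<partial>lborel)
        = (\<integral>\<^sup>+t. ennreal (2 * \<eta>) * (ennreal (\<eta>\<^sup>2) * (A t * indicator ?I t) + (ennreal \<eta> * (\<integral>\<^sup>+s\<in>?I. B s \<partial>lborel)) * indicator ?I t) \<partial>lborel)"
        by (intro nn_integral_cong) (auto split: split_indicator)
      also have "\<dots> = ennreal (2 * \<eta>) * (ennreal (\<eta>\<^sup>2) * (\<integral>\<^sup>+t\<in>?I. A t \<partial>lborel) + ennreal \<eta> * (\<integral>\<^sup>+s\<in>?I. B s \<partial>lborel) * ennreal \<eta>)"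
        using \<eta> by (simp add: nn_integral_cmult nn_integral_add nn_integral_cmult_indicator)
      finally show "(\<integral>\<^sup>+t\<in>?I. ennreal (2 * \<eta>) * (ennreal (\<eta>\<^sup>2) * A t + ennreal \<eta> * (\<integral>\<^sup>+s\<in>?I. B s \<partial>lborel)) \<partial>lborel)
        = ennreal (2 * \<eta>) * (ennreal (\<eta>\<^sup>2) * (\<integral>\<^sup>+t\<in>?I. A t \<partial>lborel) + ennreal \<eta> * (\<integral>\<^sup>+s\<in>?I. B s \<partial>lborel) * ennreal \<eta>)" .
    qed
    also have "\<dots> = ennreal (2 * \<eta>) * (ennreal (\<eta>\<^sup>2) * (\<integral>\<^sup>+t\<in>?I. A t \<partial>lborel) + ennreal \<eta> * (\<integral>\<^sup>+s\<in>?I. B s \<partial>lborel) * ennreal \<eta>) * ennreal \<eta>"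
      using \<eta> by (subst nn_integral_cmult_indicator) auto
    also have "\<dots> = ennreal (2 * \<eta>^4) * ((\<integral>\<^sup>+t\<in>?I. A t \<partial>lborel) + (\<integral>\<^sup>+s\<in>?I. B s \<partial>lborel))"
    proof -
      have "ennreal (\<eta>\<^sup>2) = ennreal \<eta> * ennreal \<eta>" "ennreal (2 * \<eta>^4) = ennreal (2 * \<eta>) * (ennreal \<eta> * (ennreal \<eta> * ennreal \<eta>))"
        using \<eta> by (simp_all add: ennreal_mult[symmetric] power2_eq_square power4_eq_xxxx mult_ac)
      then show ?thesis by (simp only: distrib_left mult_ac)
    qed
    finally show ?thesis unfolding QAB .
  qed
  have "(\<integral>\<^sup>+x\<in>Q. ennreal ((\<phi> x)\<^sup>2) \<partial>lborel)
      \<le> (\<integral>\<^sup>+x. ennreal (2 * m\<^sup>2) * indicator Q x + ennreal 2 * (ennreal (1 / \<eta>\<^sup>2) * ((\<integral>\<^sup>+y\<in>Q. ennreal ((\<phi> x - \<phi> y)\<^sup>2) \<partial>lborel) * indicator Q x)) \<partial>lborel)"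
  proof (intro nn_integral_mono)
    fix x
    have "ennreal ((\<phi> x)\<^sup>2) \<le> ennreal 2 * ennreal (m\<^sup>2) + ennreal 2 * ennreal ((\<phi> x - m)\<^sup>2)"
      using sq2[where a="\<phi> x" and c=0 and b=m] by (intro ennreal_le_twice) auto
    also have "ennreal 2 * ennreal (m\<^sup>2) = ennreal (2 * m\<^sup>2)" by (simp add: ennreal_mult)
    also have "ennreal (2 * m\<^sup>2) + ennreal 2 * ennreal ((\<phi> x - m)\<^sup>2) \<le> ennreal (2 * m\<^sup>2) + ennreal 2 * (ennreal (1 / \<eta>\<^sup>2) * (\<integral>\<^sup>+y\<in>Q. ennreal ((\<phi> x - \<phi> y)\<^sup>2) \<partial>lborel))"
      by (intro add_left_mono mult_left_mono dev) auto
    finally show "ennreal ((\<phi> x)\<^sup>2) * indicator Q x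
      \<le> ennreal (2 * m\<^sup>2) * indicator Q x + ennreal 2 * (ennreal (1 / \<eta>\<^sup>2) * ((\<integral>\<^sup>+y\<in>Q. ennreal ((\<phi> x - \<phi> y)\<^sup>2) \<partial>lborel) * indicator Q x))"
      by (auto split: split_indicator)
  qed
  also have "\<dots> = ennreal (2 * m\<^sup>2) * ennreal (\<eta>\<^sup>2)
      + ennreal 2 * (ennreal (1 / \<eta>\<^sup>2) * (\<integral>\<^sup>+x\<in>Q. (\<integral>\<^sup>+y\<in>Q. ennreal ((\<phi> x - \<phi> y)\<^sup>2) \<partial>lborel) \<partial>lborel))"
    using \<eta> unfolding Q_def
    by (simp add: nn_integral_add nn_integral_cmult nn_integral_cmult_indicator emeasure_axis_square)
  also have "\<dots> \<le> ennreal (2 * m\<^sup>2) * ennreal (\<eta>\<^sup>2)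
      + ennreal 2 * (ennreal (1 / \<eta>\<^sup>2) * (ennreal (2 * \<eta>^4) * (\<integral>\<^sup>+x\<in>Q. ennreal ((norm (D x))\<^sup>2) \<partial>lborel)))"
    by (intro add_left_mono mult_left_mono double) auto
  also have "ennreal (2 * m\<^sup>2) * ennreal (\<eta>\<^sup>2) = ennreal (2 / \<eta>\<^sup>2 * (LINT x:Q|lborel. \<phi> x)\<^sup>2)"
    using \<eta> by (simp add: ennreal_mult[symmetric] m_def power2_eq_square field_simps)
  also have "ennreal 2 * (ennreal (1 / \<eta>\<^sup>2) * (ennreal (2 * \<eta>^4) * (\<integral>\<^sup>+x\<in>Q. ennreal ((norm (D x))\<^sup>2) \<partial>lborel)))
      = ennreal (4 * \<eta>\<^sup>2) * (\<integral>\<^sup>+x\<in>Q. ennreal ((norm (D x))\<^sup>2) \<partial>lborel)"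
  proof -
    have "2 * (1 / \<eta>\<^sup>2 * (2 * \<eta>^4)) = 4 * \<eta>\<^sup>2" using \<eta> by (simp add: power2_eq_square power4_eq_xxxx field_simps)
    moreover have "ennreal (1 / \<eta>\<^sup>2) * ennreal (2 * \<eta>^4) = ennreal (1 / \<eta>\<^sup>2 * (2 * \<eta>^4))"
      by (rule ennreal_mult[symmetric]) (use \<eta> in auto)
    moreover have "ennreal 2 * ennreal (1 / \<eta>\<^sup>2 * (2 * \<eta>^4)) = ennreal (2 * (1 / \<eta>\<^sup>2 * (2 * \<eta>^4)))"
      by (rule ennreal_mult[symmetric]) (use \<eta> in auto)
    ultimately have "ennreal 2 * (ennreal (1 / \<eta>\<^sup>2) * ennreal (2 * \<eta>^4)) = ennreal (4 * \<eta>\<^sup>2)" by (simp only:)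
    then have "ennreal 2 * (ennreal (1 / \<eta>\<^sup>2) * (ennreal (2 * \<eta>^4) * X)) = ennreal (4 * \<eta>\<^sup>2) * X" for X
      by (simp only: mult.assoc[symmetric])
    then show ?thesis .
  qed
  finally show ?thesis .
qed

subsection \<open>Rellich's theorem\<close>

text \<open>Half-open squares tile the plane: each point lies in exactly one cell, and the energies
  over the cells add up.\<close>

definition grid_cell :: "real \<Rightarrow> int \<times> int \<Rightarrow> (real^2) set" where
  "grid_cell \<eta> c = axis_square ((\<eta> * of_int (fst c)) *\<^sub>R axis 1 1 + (\<eta> * of_int (snd c)) *\<^sub>R axis 2 1) \<eta>"

lemma grid_cell_iff:
  assumes "\<eta> > 0"
  shows "x \<in> grid_cell \<eta> c \<longleftrightarrow> c = (\<lfloor>x $ 1 / \<eta>\<rfloor>, \<lfloor>x $ 2 / \<eta>\<rfloor>)"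
proof -
  have fl: "0 \<le> y - \<eta> * of_int i \<and> y - \<eta> * of_int i < \<eta> \<longleftrightarrow> \<lfloor>y / \<eta>\<rfloor> = i" for y and i :: int
    using assms by (simp add: floor_eq_iff pos_le_divide_eq pos_divide_less_eq algebra_simps)
  have "x \<in> grid_cell \<eta> c \<longleftrightarrow> (0 \<le> x $ 1 - \<eta> * of_int (fst c) \<and> x $ 1 - \<eta> * of_int (fst c) < \<eta>)
      \<and> (0 \<le> x $ 2 - \<eta> * of_int (snd c) \<and> x $ 2 - \<eta> * of_int (snd c) < \<eta>)"
    by (simp add: grid_cell_def axis_square_def chart_box_def inner_axis) (simp add: axis_def)
  then show ?thesis unfolding fl by (metis prod.collapse prod.inject)
qed

lemma borel_grid_cell [measurable]: "grid_cell \<eta> c \<in> sets borel"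
  by (simp add: grid_cell_def)

lemma sq_diff_le: "ennreal ((norm (a - b))\<^sup>2) \<le> 2 * ennreal ((norm a)\<^sup>2) + 2 * ennreal ((norm b)\<^sup>2)"
  for a b :: "'a::real_inner"
proof -
  have "(norm (a - b))\<^sup>2 + (norm (a + b))\<^sup>2 = 2 * (norm a)\<^sup>2 + 2 * (norm b)\<^sup>2"
    unfolding power2_norm_eq_inner
    by (simp add: inner_add_left inner_add_right inner_diff_left inner_diff_right)
  then have "(norm (a - b))\<^sup>2 \<le> 2 * (norm a)\<^sup>2 + 2 * (norm b)\<^sup>2"
    using zero_le_power2[of "norm (a + b)"] by linarith
  then have "ennreal ((norm (a - b))\<^sup>2) \<le> ennreal (2 * (norm a)\<^sup>2 + 2 * (norm b)\<^sup>2)" by (rule ennreal_leI)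
  then show ?thesis by (simp add: ennreal_mult)
qed

lemma nn_integral_sq_diff_le:
  fixes u v :: "'a \<Rightarrow> 'b::euclidean_space"
  assumes [measurable]: "u \<in> borel_measurable M" "v \<in> borel_measurable M" "S \<in> sets M"
    and "(\<integral>\<^sup>+x\<in>S. ennreal ((norm (u x))\<^sup>2) \<partial>M) \<le> ennreal K" "(\<integral>\<^sup>+x\<in>S. ennreal ((norm (v x))\<^sup>2) \<partial>M) \<le> ennreal K"
    and K: "K \<ge> 0"
  shows "(\<integral>\<^sup>+x\<in>S. ennreal ((norm (u x - v x))\<^sup>2) \<partial>M) \<le> ennreal (4 * K)"
proof -
  have "(\<integral>\<^sup>+x\<in>S. ennreal ((norm (u x - v x))\<^sup>2) \<partial>M)
      \<le> (\<integral>\<^sup>+x. 2 * (ennreal ((norm (u x))\<^sup>2) * indicator S x) + 2 * (ennreal ((norm (v x))\<^sup>2) * indicator S x) \<partial>M)"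
    using sq_diff_le by (intro nn_integral_mono) (auto split: split_indicator)
  also have "\<dots> = 2 * (\<integral>\<^sup>+x\<in>S. ennreal ((norm (u x))\<^sup>2) \<partial>M) + 2 * (\<integral>\<^sup>+x\<in>S. ennreal ((norm (v x))\<^sup>2) \<partial>M)"
    by (simp add: nn_integral_add nn_integral_cmult)
  also have "\<dots> \<le> 2 * ennreal K + 2 * ennreal K"
    by (intro add_mono mult_left_mono assms) auto
  also have "\<dots> = ennreal (4 * K)"
    using K by (simp add: ennreal_mult' flip: distrib_right)
  finally show ?thesis .
qed

text \<open>Away from the boundary a fine grid of squares controls the norm by finitely many means and
  a small multiple of the energy. The means converge along a diagonal subsequence.\<close>

theorem rellich_C1:
  fixes \<phi> :: "nat \<Rightarrow> real^2 \<Rightarrow> real"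
  assumes \<Omega>: "bounded_lipschitz_domain \<Omega>" and C1: "\<And>n. C1_grad (\<phi> n) (D n)" and M: "M > 0"
    and N\<phi>: "\<And>n. (\<integral>\<^sup>+x\<in>\<Omega>. ennreal ((\<phi> n x)\<^sup>2) \<partial>lborel) \<le> ennreal M"
    and ND: "\<And>n. (\<integral>\<^sup>+x\<in>\<Omega>. ennreal ((norm (D n x))\<^sup>2) \<partial>lborel) \<le> ennreal M"
  obtains k :: "nat \<Rightarrow> nat" where "strict_mono k"
    "\<And>e. e > 0 \<Longrightarrow> \<exists>N. \<forall>m\<ge>N. \<forall>n\<ge>N. (\<integral>\<^sup>+x\<in>\<Omega>. ennreal ((\<phi> (k m) x - \<phi> (k n) x)\<^sup>2) \<partial>lborel) \<le> ennreal e"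
proof -
  define h where "h n = 1 / real (Suc n)" for n
  have h: "0 < h n" "h n \<le> 1" for n by (auto simp: h_def)
  \<comment> \<open>One diagonal subsequence serves all mesh widths, since there are only countably many cells in total.\<close>
  define S where "S = {(n, c). grid_cell (h n) c \<subseteq> \<Omega>}"
  define mean where "mean i q = (LINT x:grid_cell (h (fst q)) (snd q)|lborel. \<phi> i x)" for i q
  note [measurable] = C1_grad_measurable[OF C1] domain_borel[OF \<Omega>]
  have cell_sqi: "square_integrable_on lborel (grid_cell (h n) c) u" if "continuous_on UNIV u"
    for n c and u :: "real^2 \<Rightarrow> real"
    unfolding grid_cell_def using that h by (intro axis_square_sq_integrable) auto
  have cell_one: "(LINT x:grid_cell (h n) c|lborel. 1) = (h n)\<^sup>2" for n c
    using h[of n] by (simp add: grid_cell_def set_lebesgue_integral_def measure_def emeasure_axis_square)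
  have mean_bound: "norm (mean i q) \<le> sqrt M" if q: "q \<in> S" for i q
  proof -
    obtain n c where nc: "q = (n, c)" by (cases q)
    have sub: "grid_cell (h n) c \<subseteq> \<Omega>" using q nc by (simp add: S_def)
    note s = cell_sqi[OF C1_gradD(3)[OF C1[of i]], of n c]
    have "ennreal (LINT x:grid_cell (h n) c|lborel. (\<phi> i x)\<^sup>2) \<le> ennreal M"
    proof -
      have "ennreal (LINT x:grid_cell (h n) c|lborel. (\<phi> i x)\<^sup>2) = (\<integral>\<^sup>+x\<in>grid_cell (h n) c. ennreal ((\<phi> i x)\<^sup>2) \<partial>lborel)"
        using nn_integral_set_sq[OF s] by simp
      also have "\<dots> \<le> (\<integral>\<^sup>+x\<in>\<Omega>. ennreal ((\<phi> i x)\<^sup>2) \<partial>lborel)" using sub by (intro nn_integral_mono_set) auto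
      finally show ?thesis using N\<phi>[of i] by simp
    qed
    then have le: "(LINT x:grid_cell (h n) c|lborel. (\<phi> i x)\<^sup>2) \<le> M" using M by simp
    have "(mean i q)\<^sup>2 \<le> (LINT x:grid_cell (h n) c|lborel. (\<phi> i x)\<^sup>2) * (h n)\<^sup>2"
      using set_integral_sq_le[OF s cell_sqi[OF continuous_on_const]] unfolding cell_one by (simp add: mean_def nc)
    also have "\<dots> \<le> M * 1"
      using le M h[of n] by (intro mult_mono) (auto simp: power_le_one)
    finally have "sqrt ((mean i q)\<^sup>2) \<le> sqrt M" by (intro real_sqrt_le_mono) simp
    then show ?thesis by simp
  qed
  obtain k where k: "strict_mono k" and lim: "\<And>q. q \<in> S \<Longrightarrow> \<exists>l. (\<lambda>i. mean (k i) q) \<longlonglongrightarrow> l"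
    using function_convergent_subsequence[of S mean "sqrt M"] mean_bound countableI_type[of S] by blast
  have "\<exists>N. \<forall>m\<ge>N. \<forall>n\<ge>N. (\<integral>\<^sup>+x\<in>\<Omega>. ennreal ((\<phi> (k m) x - \<phi> (k n) x)\<^sup>2) \<partial>lborel) \<le> ennreal e" if e: "e > 0" for e
  proof -
    \<comment> \<open>A difference has mass and energy at most \<open>4 * M\<close> each, so the strip receives at most \<open>e / 3\<close>.\<close>
    define \<epsilon> where "\<epsilon> = e / (24 * M)"
    have \<epsilon>: "\<epsilon> > 0" using e M by (simp add: \<epsilon>_def)
    obtain V where V: "open V" "frontier \<Omega> \<subseteq> V"
      and strip: "\<And>\<phi> D. C1_grad \<phi> D \<Longrightarrow> (\<integral>\<^sup>+x\<in>\<Omega> \<inter> V. ennreal ((\<phi> x)\<^sup>2) \<partial>lborel)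
        \<le> ennreal \<epsilon> * ((\<integral>\<^sup>+x\<in>\<Omega>. ennreal ((\<phi> x)\<^sup>2) \<partial>lborel) + (\<integral>\<^sup>+x\<in>\<Omega>. ennreal ((norm (D x))\<^sup>2) \<partial>lborel))"
      by (rule strip_inequality[OF \<Omega> \<epsilon>]) (rule that, assumption+)
    have op: "open \<Omega>" and bdd: "bounded \<Omega>" using \<Omega> by (auto simp: bounded_lipschitz_domain_def)
    define K where "K = closure \<Omega> - V"
    have K: "compact K" unfolding K_def using bdd V by (intro compact_diff) auto
    have K\<Omega>: "K \<subseteq> \<Omega>" using V op by (auto simp: K_def frontier_def interior_open)
    obtain \<delta> where \<delta>: "\<delta> > 0" "(\<Union>x\<in>K. ball x \<delta>) \<subseteq> \<Omega>"
      using compact_subset_open_imp_ball_epsilon_subset[OF K op K\<Omega>] by blast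
    \<comment> \<open>Cells that meet \<open>K\<close> stay inside the domain, and the energy term of the Poincare inequality is at most \<open>e / 3\<close>.\<close>
    obtain n where n: "2 * h n < \<delta>" "16 * M * (h n)\<^sup>2 \<le> e / 3"
    proof -
      define t where "t = min (\<delta> / 2) (e / (48 * M))"
      have "t > 0" using \<delta> e M by (simp add: t_def)
      then obtain n where n: "h n < t" using nat_approx_posE[of t] by (auto simp: h_def)
      have "(h n)\<^sup>2 \<le> h n" using h[of n] by (simp add: power2_eq_square mult_left_le)
      also have "\<dots> \<le> e / (48 * M)" using n by (simp add: t_def)
      finally have "16 * M * (h n)\<^sup>2 \<le> 16 * M * (e / (48 * M))" using M by (intro mult_left_mono) auto
      also have "\<dots> = e / 3" using M by simp
      finally show ?thesis using n that[of n] by (simp add: t_def)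
    qed
    let ?\<eta> = "h n"
    have \<eta>: "?\<eta> > 0" by (rule h)
    define J where "J = (\<lambda>x::real^2. (\<lfloor>x $ 1 / ?\<eta>\<rfloor>, \<lfloor>x $ 2 / ?\<eta>\<rfloor>)) ` K"
    have finJ: "finite J"
    proof -
      obtain B where B: "\<And>x. x \<in> K \<Longrightarrow> norm x \<le> B" using compact_imp_bounded[OF K] by (auto simp: bounded_iff)
      have "J \<subseteq> {\<lfloor>-B / ?\<eta>\<rfloor>..\<lfloor>B / ?\<eta>\<rfloor>} \<times> {\<lfloor>-B / ?\<eta>\<rfloor>..\<lfloor>B / ?\<eta>\<rfloor>}"
      proof -
        have "\<bar>x $ i\<bar> \<le> B" if "x \<in> K" for x i using component_le_norm_cart[of x i] B[OF that] by simp
        then have "- B \<le> x $ i \<and> x $ i \<le> B" if "x \<in> K" for x i using that by (simp add: abs_le_iff minus_le_iff)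
        then have "(- B) / ?\<eta> \<le> x $ i / ?\<eta> \<and> x $ i / ?\<eta> \<le> B / ?\<eta>" if "x \<in> K" for x i
          using \<eta> that by (intro conjI divide_right_mono) auto
        then show ?thesis by (auto simp: J_def intro!: floor_mono)
      qed
      then show ?thesis by (rule finite_subset) auto
    qed
    have coverJ: "K \<subseteq> (\<Union>c\<in>J. grid_cell ?\<eta> c)"
      by (auto simp: J_def grid_cell_iff[OF \<eta>])
    have cell\<Omega>: "grid_cell ?\<eta> c \<subseteq> \<Omega>" if cJ: "c \<in> J" for c
    proof
      fix y assume y: "y \<in> grid_cell ?\<eta> c"
      obtain x where x: "x \<in> K" "x \<in> grid_cell ?\<eta> c" using cJ by (auto simp: J_def grid_cell_iff[OF \<eta>])
      have "dist x y \<le> 2 * ?\<eta>" using x(2) y unfolding grid_cell_def by (rule dist_axis_square)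
      then have "y \<in> ball x \<delta>" using n by simp
      then show "y \<in> \<Omega>" using \<delta> x by blast
    qed
    have disj: "disjoint_family_on (grid_cell ?\<eta>) J"
      by (auto simp: disjoint_family_on_def grid_cell_iff[OF \<eta>])
    \<comment> \<open>The means over all the cells together contribute at most \<open>e / 3\<close>.\<close>
    define e' where "e' = e * ?\<eta>\<^sup>2 / (6 * (real (card J) + 1))"
    have e': "e' > 0" using e \<eta> by (simp add: e'_def add_nonneg_pos)
    have "\<exists>N. \<forall>a\<ge>N. \<forall>b\<ge>N. (mean (k a) (n, c) - mean (k b) (n, c))\<^sup>2 \<le> e'" if c: "c \<in> J" for c
    proof -
      have "(n, c) \<in> S" using cell\<Omega>[OF c] by (simp add: S_def)
      then have "Cauchy (\<lambda>i. mean (k i) (n, c))" using lim LIMSEQ_imp_Cauchy by blast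
      moreover have "sqrt e' > 0" using e' by simp
      ultimately obtain N where N: "\<forall>a\<ge>N. \<forall>b\<ge>N. dist (mean (k a) (n, c)) (mean (k b) (n, c)) < sqrt e'"
        unfolding Cauchy_def by blast
      have "(mean (k a) (n, c) - mean (k b) (n, c))\<^sup>2 \<le> e'" if "a \<ge> N" "b \<ge> N" for a b
      proof -
        have "\<bar>mean (k a) (n, c) - mean (k b) (n, c)\<bar>\<^sup>2 \<le> (sqrt e')\<^sup>2"
          using N that by (intro power_mono) (auto simp: dist_real_def less_imp_le)
        then show ?thesis using e' by simp
      qed
      then show ?thesis by blast
    qed
    then obtain N where N: "\<And>c a b. c \<in> J \<Longrightarrow> a \<ge> N c \<Longrightarrow> b \<ge> N c \<Longrightarrow> (mean (k a) (n, c) - mean (k b) (n, c))\<^sup>2 \<le> e'"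
      by metis
    have "(\<integral>\<^sup>+x\<in>\<Omega>. ennreal ((\<phi> (k a) x - \<phi> (k b) x)\<^sup>2) \<partial>lborel) \<le> ennreal e"
      if ab: "a \<ge> sum N J" "b \<ge> sum N J" for a b
    proof -
      define w where "w x = \<phi> (k a) x - \<phi> (k b) x" for x
      define E where "E x = D (k a) x - D (k b) x" for x
      have C1w: "C1_grad w E" unfolding w_def[abs_def] E_def[abs_def] by (rule C1_grad_diff[OF C1 C1])
      note [measurable] = C1_grad_measurable[OF C1w]
      have nw: "(\<integral>\<^sup>+x\<in>\<Omega>. ennreal ((w x)\<^sup>2) \<partial>lborel) \<le> ennreal (4 * M)"
        using nn_integral_sq_diff_le[of "\<phi> (k a)" lborel "\<phi> (k b)" \<Omega> M] N\<phi> M by (simp add: w_def)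
      have nE: "(\<integral>\<^sup>+x\<in>\<Omega>. ennreal ((norm (E x))\<^sup>2) \<partial>lborel) \<le> ennreal (4 * M)"
        using nn_integral_sq_diff_le[of "D (k a)" lborel "D (k b)" \<Omega> M] ND M by (simp add: E_def)
      have "(\<integral>\<^sup>+x\<in>\<Omega> \<inter> V. ennreal ((w x)\<^sup>2) \<partial>lborel) \<le> ennreal \<epsilon> * (ennreal (4 * M) + ennreal (4 * M))"
        by (rule order_trans[OF strip[OF C1w]]) (intro mult_left_mono add_mono nw nE, simp)
      also have "\<dots> = ennreal (e / 3)"
        using M e by (simp add: \<epsilon>_def ennreal_mult[symmetric] ennreal_plus[symmetric] del: ennreal_plus)
      finally have near: "(\<integral>\<^sup>+x\<in>\<Omega> \<inter> V. ennreal ((w x)\<^sup>2) \<partial>lborel) \<le> ennreal (e / 3)" .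
      have cellE: "(\<Sum>c\<in>J. \<integral>\<^sup>+x\<in>grid_cell ?\<eta> c. ennreal ((norm (E x))\<^sup>2) \<partial>lborel) \<le> ennreal (4 * M)"
      proof -
        have "(\<Sum>c\<in>J. \<integral>\<^sup>+x\<in>grid_cell ?\<eta> c. ennreal ((norm (E x))\<^sup>2) \<partial>lborel)
            = (\<integral>\<^sup>+x. (\<Sum>c\<in>J. ennreal ((norm (E x))\<^sup>2) * indicator (grid_cell ?\<eta> c) x) \<partial>lborel)"
          by (subst nn_integral_sum) auto
        also have "\<dots> = (\<integral>\<^sup>+x\<in>(\<Union>c\<in>J. grid_cell ?\<eta> c). ennreal ((norm (E x))\<^sup>2) \<partial>lborel)"
          unfolding indicator_UN_disjoint[OF finJ disj] sum_distrib_left[symmetric] ..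
        also have "\<dots> \<le> (\<integral>\<^sup>+x\<in>\<Omega>. ennreal ((norm (E x))\<^sup>2) \<partial>lborel)"
          using cell\<Omega> by (intro nn_integral_mono_set) auto
        finally show ?thesis using nE by (rule order_trans)
      qed
      have cell: "(\<integral>\<^sup>+x\<in>grid_cell ?\<eta> c. ennreal ((w x)\<^sup>2) \<partial>lborel)
          \<le> ennreal (2 / ?\<eta>\<^sup>2 * e') + ennreal (4 * ?\<eta>\<^sup>2) * (\<integral>\<^sup>+x\<in>grid_cell ?\<eta> c. ennreal ((norm (E x))\<^sup>2) \<partial>lborel)"
        if c: "c \<in> J" for c
      proof -
        have si: "set_integrable lborel (grid_cell ?\<eta> c) (\<phi> i)" for i
          using square_integrable_on_inner[OF cell_sqi[OF C1_gradD(3)[OF C1[of i]]] cell_sqi[OF continuous_on_const[of UNIV 1]]] by simp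
        have "(LINT x:grid_cell ?\<eta> c|lborel. w x) = mean (k a) (n, c) - mean (k b) (n, c)"
          unfolding w_def mean_def fst_conv snd_conv by (rule set_integral_diff(2)[OF si si])
        moreover have "N c \<le> sum N J" using finJ c by (intro member_le_sum) auto
        ultimately have "(LINT x:grid_cell ?\<eta> c|lborel. w x)\<^sup>2 \<le> e'"
          using N[OF c, of a b] ab by simp
        then have "ennreal (2 / ?\<eta>\<^sup>2 * (LINT x:grid_cell ?\<eta> c|lborel. w x)\<^sup>2) \<le> ennreal (2 / ?\<eta>\<^sup>2 * e')"
          using \<eta> by (intro ennreal_leI mult_left_mono) auto
        then show ?thesis
          using poincare_square[OF C1w \<eta>, of "(?\<eta> * of_int (fst c)) *\<^sub>R axis 1 1 + (?\<eta> * of_int (snd c)) *\<^sub>R axis 2 1"]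
          unfolding grid_cell_def by (meson add_right_mono order_trans)
      qed
      have "(\<integral>\<^sup>+x\<in>K. ennreal ((w x)\<^sup>2) \<partial>lborel) \<le> (\<Sum>c\<in>J. \<integral>\<^sup>+x\<in>K \<inter> grid_cell ?\<eta> c. ennreal ((w x)\<^sup>2) \<partial>lborel)"
        by (rule nn_integral_le_finite_cover[OF finJ coverJ]) (use compact_imp_closed[OF K] in auto)
      also have "\<dots> \<le> (\<Sum>c\<in>J. \<integral>\<^sup>+x\<in>grid_cell ?\<eta> c. ennreal ((w x)\<^sup>2) \<partial>lborel)"
        by (intro sum_mono nn_integral_mono_set) auto
      also have "\<dots> \<le> (\<Sum>c\<in>J. ennreal (2 / ?\<eta>\<^sup>2 * e') + ennreal (4 * ?\<eta>\<^sup>2) * (\<integral>\<^sup>+x\<in>grid_cell ?\<eta> c. ennreal ((norm (E x))\<^sup>2) \<partial>lborel))"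
        by (rule sum_mono) (rule cell)
      also have "\<dots> = of_nat (card J) * ennreal (2 / ?\<eta>\<^sup>2 * e')
          + ennreal (4 * ?\<eta>\<^sup>2) * (\<Sum>c\<in>J. \<integral>\<^sup>+x\<in>grid_cell ?\<eta> c. ennreal ((norm (E x))\<^sup>2) \<partial>lborel)"
        by (simp add: sum.distrib sum_distrib_left)
      also have "\<dots> \<le> ennreal (e / 3) + ennreal (4 * ?\<eta>\<^sup>2) * ennreal (4 * M)"
      proof (intro add_mono mult_left_mono cellE)
        have "real (card J) * (2 / ?\<eta>\<^sup>2 * e') = (e / 3) * (real (card J) / (real (card J) + 1))"
          using \<eta> by (simp add: e'_def field_simps)
        also have "\<dots> \<le> (e / 3) * 1" using e by (intro mult_left_mono) auto
        finally have "real (card J) * (2 / ?\<eta>\<^sup>2 * e') \<le> e / 3" by simp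
        then show "of_nat (card J) * ennreal (2 / ?\<eta>\<^sup>2 * e') \<le> ennreal (e / 3)"
          using e' by (simp add: ennreal_of_nat_eq_real_of_nat ennreal_mult'[symmetric] ennreal_leI)
      qed simp
      also have "ennreal (4 * ?\<eta>\<^sup>2) * ennreal (4 * M) \<le> ennreal (e / 3)"
        using n(2) M by (simp add: ennreal_mult[symmetric] mult_ac ennreal_leI)
      finally have far: "(\<integral>\<^sup>+x\<in>K. ennreal ((w x)\<^sup>2) \<partial>lborel) \<le> ennreal (e / 3) + ennreal (e / 3)"
        by (simp add: add_left_mono)
      have [measurable]: "\<Omega> \<inter> V \<in> sets borel" "K \<in> sets borel"
        using op V compact_imp_closed[OF K] by (auto intro: borel_open borel_closed)
      have "(\<integral>\<^sup>+x\<in>\<Omega>. ennreal ((w x)\<^sup>2) \<partial>lborel)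
          \<le> (\<integral>\<^sup>+x. ennreal ((w x)\<^sup>2) * indicator (\<Omega> \<inter> V) x + ennreal ((w x)\<^sup>2) * indicator K x \<partial>lborel)"
        using closure_subset[of \<Omega>] by (intro nn_integral_mono) (auto simp: K_def split: split_indicator)
      also have "\<dots> = (\<integral>\<^sup>+x\<in>\<Omega> \<inter> V. ennreal ((w x)\<^sup>2) \<partial>lborel) + (\<integral>\<^sup>+x\<in>K. ennreal ((w x)\<^sup>2) \<partial>lborel)"
        by (rule nn_integral_add) auto
      also have "\<dots> \<le> ennreal (e / 3) + (ennreal (e / 3) + ennreal (e / 3))"
        by (intro add_mono near far)
      also have "\<dots> = ennreal e" using e by (simp add: ennreal_plus[symmetric] del: ennreal_plus)
      finally show ?thesis by (simp add: w_def)
    qed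
    then show ?thesis by blast
  qed
  with k show ?thesis by (rule that)
qed

section \<open>Integration by parts\<close>

lemma C1_grad_zero_off_support:
  assumes "C1_grad w W" "x \<notin> closure {x. w x \<noteq> 0}"
  shows "w x = 0" "W x = 0"
proof -
  have off: "w y = 0" if "y \<notin> closure {x. w x \<noteq> 0}" for y
    using that closure_subset[of "{x. w x \<noteq> 0}"] by blast
  show "w x = 0" using off assms(2) .
  have "((\<lambda>_. 0) has_derivative (\<lambda>h. h \<bullet> W x)) (at x)"
  proof (rule has_derivative_transform_within_open[OF C1_gradD(1)[OF assms(1)]])
    show "open (- closure {x. w x \<noteq> 0})" by (rule open_Compl[OF closed_closure])
    show "w y = 0" if "y \<in> - closure {x. w x \<noteq> 0}" for y by (rule off[OF ComplD[OF that]])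
    show "x \<in> - closure {x. w x \<noteq> 0}" by (rule Compl_iff[THEN iffD2, OF assms(2)])
  qed
  from has_derivative_unique[OF this has_derivative_const]
  have "(\<lambda>h. h \<bullet> W x) = (\<lambda>_. 0)" .
  from fun_cong[OF this, of "W x"] show "W x = 0" by simp
qed

lemma integrable_compact_support:
  fixes u :: "'a::euclidean_space \<Rightarrow> 'b::{banach, second_countable_topology}"
  assumes "compact K" "continuous_on UNIV u" "\<And>x. x \<notin> K \<Longrightarrow> u x = 0"
  shows "integrable lborel u"
proof -
  have "integrable lborel (\<lambda>x. indicator K x *\<^sub>R u x)"
    by (rule borel_integrable_compact[OF assms(1) continuous_on_subset[OF assms(2)]]) auto
  moreover have "(\<lambda>x. indicator K x *\<^sub>R u x) = u"
    using assms(3) by (intro ext) (auto split: split_indicator)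
  ultimately show ?thesis by simp
qed

lemma integral_compact_derivative_zero:
  fixes g g' :: "real \<Rightarrow> real"
  assumes g: "\<And>t. (g has_real_derivative g' t) (at t)" and g': "continuous_on UNIV g'"
    and supp: "\<And>t. \<bar>t\<bar> \<ge> R \<Longrightarrow> g t = 0 \<and> g' t = 0"
  shows "(\<integral>t. g' t \<partial>lborel) = 0"
proof -
  let ?R = "\<bar>R\<bar>"
  have "(\<integral>t. indicator {-?R..?R} t *\<^sub>R g' t \<partial>lborel) = g ?R - g (- ?R)"
  proof (rule integral_FTC_atLeastAtMost)
    show "(g has_vector_derivative g' t) (at t within {-?R..?R})" for t
      using g[of t] by (rule has_vector_derivative_at_within[OF has_real_derivative_iff_has_vector_derivative[THEN iffD1]])
    show "continuous_on {-?R..?R} g'" by (rule continuous_on_subset[OF g']) simp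
  qed simp
  moreover have "(\<lambda>t. indicator {-?R..?R} t *\<^sub>R g' t) = g'"
  proof
    fix t show "indicator {-?R..?R} t *\<^sub>R g' t = g' t"
      using supp[of t] by (cases "t \<in> {-?R..?R}") auto
  qed
  ultimately show ?thesis using supp[of ?R] supp[of "- ?R"] by simp
qed

text \<open>On each line parallel to an axis the derivative integrates to zero, and Fubini's theorem
  collects the lines.\<close>

lemma integral_gradient_component_zero:
  assumes C1: "C1_grad w W" and supp: "compact (closure {x. w x \<noteq> 0})"
  shows "(\<integral>x. W x \<bullet> axis 1 1 \<partial>lborel) = 0" "(\<integral>x. W x \<bullet> axis 2 1 \<partial>lborel) = 0"
proof -
  let ?P = "\<lambda>z. fst z *\<^sub>R axis 1 1 + snd z *\<^sub>R axis 2 1 :: real^2"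
  have Pm[measurable]: "?P \<in> borel_measurable (lborel \<Otimes>\<^sub>M lborel)" by measurable
  have distr: "lborel = distr (lborel \<Otimes>\<^sub>M lborel) borel ?P"
    using lborel_pair_axes by (simp add: split_beta')
  note [measurable] = C1_grad_measurable[OF C1]
  obtain R where R: "\<And>x. x \<in> closure {x. w x \<noteq> 0} \<Longrightarrow> norm x < R"
    using compact_imp_bounded[OF supp] unfolding bounded_pos_less by blast
  have zero: "w x = 0 \<and> W x = 0" if "norm x \<ge> R" for x
    using C1_grad_zero_off_support[OF C1, of x] R[of x] that by force
  have int: "integrable lborel (\<lambda>x. W x \<bullet> b)" for b
  proof (rule integrable_compact_support[OF supp])
    show "continuous_on UNIV (\<lambda>x. W x \<bullet> b)" by (intro continuous_on_inner C1_gradD(2)[OF C1] continuous_on_const)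
    show "W x \<bullet> b = 0" if "x \<notin> closure {x. w x \<noteq> 0}" for x
      using C1_grad_zero_off_support(2)[OF C1 that] by simp
  qed
  have intP: "integrable (lborel \<Otimes>\<^sub>M lborel) (\<lambda>z. W (?P z) \<bullet> b)" for b
  proof -
    have "integrable (distr (lborel \<Otimes>\<^sub>M lborel) borel ?P) (\<lambda>x. W x \<bullet> b)"
      using int[of b] unfolding distr[symmetric] .
    then show ?thesis by (subst (asm) integrable_distr_eq) auto
  qed
  have eq: "(\<integral>x. W x \<bullet> b \<partial>lborel) = (\<integral>z. W (?P z) \<bullet> b \<partial>(lborel \<Otimes>\<^sub>M lborel))" for b
    by (subst distr, subst integral_distr) auto
  have big: "norm (s *\<^sub>R axis 1 1 + t *\<^sub>R axis 2 1 :: real^2) \<ge> \<bar>s\<bar>"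
    "norm (s *\<^sub>R axis 1 1 + t *\<^sub>R axis 2 1 :: real^2) \<ge> \<bar>t\<bar>" for s t
    using component_le_norm_cart[of "s *\<^sub>R axis 1 1 + t *\<^sub>R axis 2 1 :: real^2" 1]
      component_le_norm_cart[of "s *\<^sub>R axis 1 1 + t *\<^sub>R axis 2 1 :: real^2" 2]
    by (simp_all add: axis_def)
  have cont: "continuous_on UNIV (\<lambda>t. W (q + t *\<^sub>R b) \<bullet> b)" for q b
    by (intro continuous_intros continuous_on_compose2[OF C1_gradD(2)[OF C1]]) auto
  have "(\<integral>t. W (s *\<^sub>R axis 1 1 + t *\<^sub>R axis 2 1) \<bullet> axis 2 1 \<partial>lborel) = 0" for s
  proof (rule integral_compact_derivative_zero[OF C1_grad_along_line[OF C1] cont])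
    fix t assume "R \<le> \<bar>t\<bar>"
    then show "w (s *\<^sub>R axis 1 1 + t *\<^sub>R axis 2 1) = 0 \<and> W (s *\<^sub>R axis 1 1 + t *\<^sub>R axis 2 1) \<bullet> axis 2 1 = 0"
      using zero[of "s *\<^sub>R axis 1 1 + t *\<^sub>R axis 2 1"] big(2)[of t s] by simp
  qed
  note inner2 = this
  have "(\<integral>z. W (?P z) \<bullet> axis 2 1 \<partial>(lborel \<Otimes>\<^sub>M lborel))
      = (\<integral>s. \<integral>t. W (s *\<^sub>R axis 1 1 + t *\<^sub>R axis 2 1) \<bullet> axis 2 1 \<partial>lborel \<partial>lborel)"
    using lborel_pair.integral_fst'[OF intP[of "axis 2 1"]] by (simp only: fst_conv snd_conv)
  then show "(\<integral>x. W x \<bullet> axis 2 1 \<partial>lborel) = 0"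
    unfolding eq inner2 by simp
  have "(\<integral>s. W (s *\<^sub>R axis 1 1 + t *\<^sub>R axis 2 1) \<bullet> axis 1 1 \<partial>lborel) = 0" for t
    unfolding add.commute[of "_ *\<^sub>R axis 1 1"]
  proof (rule integral_compact_derivative_zero[OF C1_grad_along_line[OF C1] cont])
    fix s assume "R \<le> \<bar>s\<bar>"
    then show "w (t *\<^sub>R axis 2 1 + s *\<^sub>R axis 1 1) = 0 \<and> W (t *\<^sub>R axis 2 1 + s *\<^sub>R axis 1 1) \<bullet> axis 1 1 = 0"
      using zero[of "t *\<^sub>R axis 2 1 + s *\<^sub>R axis 1 1"] big(1)[of s t] by (simp add: add.commute)
  qed
  note inner1 = this
  have "integrable (lborel \<Otimes>\<^sub>M lborel) (\<lambda>(s, t). W (s *\<^sub>R axis 1 1 + t *\<^sub>R axis 2 1) \<bullet> axis 1 1)"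
    using intP[of "axis 1 1"] by (simp only: split_beta')
  from lborel_pair.integral_snd[OF this]
  have "(\<integral>z. W (?P z) \<bullet> axis 1 1 \<partial>(lborel \<Otimes>\<^sub>M lborel))
      = (\<integral>t. \<integral>s. W (s *\<^sub>R axis 1 1 + t *\<^sub>R axis 2 1) \<bullet> axis 1 1 \<partial>lborel \<partial>lborel)"
    by (simp only: split_beta')
  then show "(\<integral>x. W x \<bullet> axis 1 1 \<partial>lborel) = 0"
    unfolding eq inner1 by simp
qed

lemma C1_grad_mult:
  assumes "C1_grad \<phi> D" "C1_grad \<psi> E"
  shows "C1_grad (\<lambda>x. \<phi> x * \<psi> x) (\<lambda>x. \<phi> x *\<^sub>R E x + \<psi> x *\<^sub>R D x)"
proof -
  have "((\<lambda>x. \<phi> x * \<psi> x) has_derivative (\<lambda>h. h \<bullet> (\<phi> x *\<^sub>R E x + \<psi> x *\<^sub>R D x))) (at x)" for x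
    by (rule has_derivative_eq_rhs[OF has_derivative_mult[OF C1_gradD(1)[OF assms(1)] C1_gradD(1)[OF assms(2)]]])
       (simp add: fun_eq_iff inner_add_right mult.commute)
  moreover have "continuous_on UNIV (\<lambda>x. \<phi> x *\<^sub>R E x + \<psi> x *\<^sub>R D x)"
    by (intro continuous_on_add continuous_on_scaleR C1_gradD(2,3)[OF assms(1)] C1_gradD(2,3)[OF assms(2)])
  ultimately show ?thesis by (simp add: C1_grad_def gderiv_def)
qed

text \<open>The product \<open>\<phi> * \<psi>\<close> has compact support, so the integral of its gradient vanishes.\<close>

lemma integration_by_parts_C1:
  assumes \<phi>: "C1_grad \<phi> D" and \<psi>: "C1_grad \<psi> E"
    and supp: "compact (closure {x. \<psi> x \<noteq> 0})" "closure {x. \<psi> x \<noteq> 0} \<subseteq> \<Omega>"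
  shows "(LINT x:\<Omega>|lborel. \<phi> x *\<^sub>R E x) = - (LINT x:\<Omega>|lborel. \<psi> x *\<^sub>R D x)"
proof -
  let ?K = "closure {x. \<psi> x \<noteq> 0}"
  note off = C1_grad_zero_off_support[OF \<psi>]
  have int1: "integrable lborel (\<lambda>x. \<phi> x *\<^sub>R E x)"
  proof (rule integrable_compact_support[OF supp(1)])
    show "continuous_on UNIV (\<lambda>x. \<phi> x *\<^sub>R E x)" by (rule continuous_on_scaleR[OF C1_gradD(3)[OF \<phi>] C1_gradD(2)[OF \<psi>]])
    show "\<phi> x *\<^sub>R E x = 0" if "x \<notin> ?K" for x using off(2)[OF that] by simp
  qed
  have int2: "integrable lborel (\<lambda>x. \<psi> x *\<^sub>R D x)"
  proof (rule integrable_compact_support[OF supp(1)])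
    show "continuous_on UNIV (\<lambda>x. \<psi> x *\<^sub>R D x)" by (rule continuous_on_scaleR[OF C1_gradD(3)[OF \<psi>] C1_gradD(2)[OF \<phi>]])
    show "\<psi> x *\<^sub>R D x = 0" if "x \<notin> ?K" for x using off(1)[OF that] by simp
  qed
  have sub: "closure {x. \<phi> x * \<psi> x \<noteq> 0} \<subseteq> ?K" by (intro closure_mono) auto
  have comp: "compact (closure {x. \<phi> x * \<psi> x \<noteq> 0})"
    using compact_Int_closed[OF supp(1) closed_closure[of "{x. \<phi> x * \<psi> x \<noteq> 0}"]] sub
    by (simp add: Int_absorb1)
  note zero = integral_gradient_component_zero[OF C1_grad_mult[OF \<phi> \<psi>] comp]
  have "(\<integral>x. \<phi> x *\<^sub>R E x + \<psi> x *\<^sub>R D x \<partial>lborel) = 0"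
  proof (rule euclidean_eqI)
    fix b :: "real^2" assume "b \<in> Basis"
    then have "b = axis 1 1 \<or> b = axis 2 1" by (auto simp: Basis_vec_def exhaust_2 UNIV_2)
    then have "(\<integral>x. (\<phi> x *\<^sub>R E x + \<psi> x *\<^sub>R D x) \<bullet> b \<partial>lborel) = 0" using zero by auto
    then show "(\<integral>x. \<phi> x *\<^sub>R E x + \<psi> x *\<^sub>R D x \<partial>lborel) \<bullet> b = 0 \<bullet> b"
      using int1 int2 by (subst integral_inner_left[symmetric]) auto
  qed
  then have "(\<integral>x. \<phi> x *\<^sub>R E x \<partial>lborel) = - (\<integral>x. \<psi> x *\<^sub>R D x \<partial>lborel)"
    using int1 int2 by (simp add: eq_neg_iff_add_eq_0)
  moreover have "indicat_real \<Omega> x *\<^sub>R (\<phi> x *\<^sub>R E x) = \<phi> x *\<^sub>R E x"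
    "indicat_real \<Omega> x *\<^sub>R (\<psi> x *\<^sub>R D x) = \<psi> x *\<^sub>R D x" for x
    using off[of x] supp(2) by (auto split: split_indicator)
  ultimately show ?thesis by (simp add: set_lebesgue_integral_def del: scaleR_scaleR)
qed

lemma square_integrable_on_scaleR:
  fixes u :: "'a \<Rightarrow> real" and F :: "'a \<Rightarrow> 'b::euclidean_space"
  assumes "square_integrable_on M S u" "square_integrable_on M S F"
  shows "set_integrable M S (\<lambda>x. u x *\<^sub>R F x)"
proof -
  let ?u = "\<lambda>x. indicat_real S x *\<^sub>R u x" and ?F = "\<lambda>x. indicat_real S x *\<^sub>R F x"
  have uF: "L2_fun M ?u" "L2_fun M ?F" using assms by (simp_all add: square_integrable_on_L2_fun)
  have "integrable M (\<lambda>x. ?u x *\<^sub>R ?F x)"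
  proof (rule Bochner_Integration.integrable_bound)
    show "integrable M (\<lambda>x. (norm (?u x))\<^sup>2 + (norm (?F x))\<^sup>2)"
      using uF by (auto simp: L2_fun_def)
    show "(\<lambda>x. ?u x *\<^sub>R ?F x) \<in> borel_measurable M"
      using borel_measurable_scaleR[of ?u M ?F] uF unfolding L2_fun_def by blast
    show "AE x in M. norm (?u x *\<^sub>R ?F x) \<le> norm ((norm (?u x))\<^sup>2 + (norm (?F x))\<^sup>2)"
    proof (rule AE_I2)
      fix x
      have "2 * (norm (?u x) * norm (?F x)) \<le> (norm (?u x))\<^sup>2 + (norm (?F x))\<^sup>2"
        using sum_squares_bound[of "norm (?u x)" "norm (?F x)"] by (simp only: mult.assoc)
      moreover have "0 \<le> norm (?u x) * norm (?F x)" by simp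
      ultimately show "norm (?u x *\<^sub>R ?F x) \<le> norm ((norm (?u x))\<^sup>2 + (norm (?F x))\<^sup>2)"
        unfolding norm_scaleR[of "?u x" "?F x"] real_norm_def by linarith
    qed
  qed
  moreover have "(\<lambda>x. ?u x *\<^sub>R ?F x) = (\<lambda>x. indicat_real S x *\<^sub>R (u x *\<^sub>R F x))"
    by (intro ext) (auto split: split_indicator)
  ultimately show ?thesis by (simp add: set_integrable_def)
qed

lemma set_integral_scaleR_inner:
  fixes u :: "'a \<Rightarrow> real" and F :: "'a \<Rightarrow> 'b::euclidean_space"
  assumes "square_integrable_on M S u" "square_integrable_on M S F"
  shows "(LINT x:S|M. u x *\<^sub>R F x) \<bullet> b = (LINT x:S|M. u x * (F x \<bullet> b))"
proof -
  have "(LINT x:S|M. u x *\<^sub>R F x) \<bullet> b = (\<integral>x. (indicat_real S x *\<^sub>R (u x *\<^sub>R F x)) \<bullet> b \<partial>M)"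
    unfolding set_lebesgue_integral_def
    using square_integrable_on_scaleR[OF assms] by (subst integral_inner_left) (auto simp: set_integrable_def)
  then show ?thesis by (simp add: set_lebesgue_integral_def mult.assoc)
qed

lemma set_integral_norm_scale:
  "(LINT x:S|M. (norm (c *\<^sub>R w x))\<^sup>2) = c\<^sup>2 * (LINT x:S|M. (norm (w x))\<^sup>2)"
  by (simp only: norm_scaleR power_mult_distrib power2_abs set_integral_mult_right)

lemma square_integrable_on_parallelogram:
  assumes "square_integrable_on M S w" "square_integrable_on M S w'"
  shows "(LINT x:S|M. (norm (w x + w' x))\<^sup>2) + (LINT x:S|M. (norm (w x - w' x))\<^sup>2)
      = 2 * (LINT x:S|M. (norm (w x))\<^sup>2) + 2 * (LINT x:S|M. (norm (w' x))\<^sup>2)"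
  using square_integrable_on_lincomb(2)[OF assms, of 1] square_integrable_on_lincomb(2)[OF assms, of "-1"] by simp

section \<open>The ground state of the Robin form\<close>

context
  fixes \<Omega> :: "(real^2) set"
  assumes \<Omega>: "bounded_lipschitz_domain \<Omega>"
begin

lemma domain_facts: "open \<Omega>" "bounded \<Omega>" "\<Omega> \<noteq> {}" "\<Omega> \<in> sets borel" "frontier \<Omega> \<in> sets borel"
  "bounded (frontier \<Omega>)" "emeasure lborel \<Omega> < \<infinity>"
proof -
  show o: "open \<Omega>" and b: "bounded \<Omega>" and "\<Omega> \<noteq> {}" using \<Omega> by (auto simp: bounded_lipschitz_domain_def)
  show "\<Omega> \<in> sets borel" "frontier \<Omega> \<in> sets borel" using domain_borel[OF \<Omega>] .
  then show "emeasure lborel \<Omega> < \<infinity>" using bounded_borel_finite_area[OF b] by simp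
  show "bounded (frontier \<Omega>)" by (rule compact_imp_bounded[OF compact_frontier_bounded[OF b]])
qed

lemma area_pos: "area \<Omega> > 0"
proof -
  obtain x r where "r > 0" "ball x r \<subseteq> \<Omega>" using domain_facts(1,3) open_contains_ball by blast
  then have "emeasure lborel (ball x r) \<le> emeasure lborel \<Omega>"
    using domain_facts by (intro emeasure_mono) auto
  then have "measure lborel (ball x r) \<le> measure lborel \<Omega>"
    unfolding measure_def using domain_facts(7) by (intro enn2real_mono) auto
  moreover have "measure lborel (ball x r) > 0" using content_ball_pos[OF \<open>r > 0\<close>, of x] .
  ultimately show ?thesis unfolding area_def by linarith
qed

lemma C1_grad_const: "C1_grad (\<lambda>_. c) (\<lambda>_. 0)"
  by (simp add: C1_grad_def GDERIV_const)

lemma frontier_length_finite: "emeasure length_measure (frontier \<Omega>) < \<infinity>"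
proof -
  obtain C l0 where "C > 0" "l0 > 0"
    and T: "\<And>l \<phi> D. \<lbrakk>0 < l; l \<le> l0; C1_grad \<phi> D\<rbrakk> \<Longrightarrow>
      (\<integral>\<^sup>+x\<in>frontier \<Omega>. ennreal ((\<phi> x)\<^sup>2) \<partial>length_measure)
      \<le> ennreal (C / l) * (\<integral>\<^sup>+x\<in>\<Omega>. ennreal ((\<phi> x)\<^sup>2) \<partial>lborel)
        + ennreal (C * l) * (\<integral>\<^sup>+x\<in>\<Omega>. ennreal ((norm (D x))\<^sup>2) \<partial>lborel)"
    by (rule trace_inequality[OF \<Omega>]) (rule that, assumption+)
  have "emeasure length_measure (frontier \<Omega>) \<le> ennreal (C / l0) * emeasure lborel \<Omega>"
    using T[OF \<open>l0 > 0\<close> order_refl C1_grad_const[of 1]] domain_facts by simp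
  also have "\<dots> < \<infinity>" using domain_facts(7) by (simp add: ennreal_mult_less_top)
  finally show ?thesis .
qed

text \<open>Every line in a fixed direction through a small disc in the domain meets the boundary,
  so the boundary projects onto an interval.\<close>

lemma perimeter_pos: "perimeter \<Omega> > 0"
proof -
  obtain x r where r: "r > 0" "ball x r \<subseteq> \<Omega>" using domain_facts(1,3) open_contains_ball by blast
  have "{x $ 1 - r <..< x $ 1 + r} \<subseteq> (\<lambda>y. y $ 1) ` frontier \<Omega>"
  proof
    fix a assume a: "a \<in> {x $ 1 - r <..< x $ 1 + r}"
    let ?q = "x + (a - x $ 1) *\<^sub>R axis 1 1"
    let ?L = "range (\<lambda>t. ?q + t *\<^sub>R axis 2 1)"
    have "dist x ?q < r" using a by (simp add: dist_norm norm_axis_1 abs_less_iff)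
    then have "?q \<in> \<Omega>" using r by (auto simp: subset_iff)
    moreover have "?q \<in> ?L" by (rule range_eqI[of _ _ 0]) simp
    ultimately have "?L \<inter> \<Omega> \<noteq> {}" by blast
    moreover have "?L - \<Omega> \<noteq> {}"
    proof -
      obtain B where B: "\<And>y. y \<in> \<Omega> \<Longrightarrow> norm y \<le> B" using domain_facts(2) by (auto simp: bounded_iff)
      have "?q + (\<bar>B\<bar> + norm ?q + 1) *\<^sub>R axis 2 1 \<notin> \<Omega>"
      proof
        assume "?q + (\<bar>B\<bar> + norm ?q + 1) *\<^sub>R axis 2 1 \<in> \<Omega>"
        from B[OF this] have "norm (?q + (\<bar>B\<bar> + norm ?q + 1) *\<^sub>R axis 2 1) \<le> \<bar>B\<bar>" by simp
        moreover have "norm ((\<bar>B\<bar> + norm ?q + 1) *\<^sub>R axis 2 1 :: real^2)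
            \<le> norm (?q + (\<bar>B\<bar> + norm ?q + 1) *\<^sub>R axis 2 1) + norm ?q"
          using norm_triangle_ineq4[of "?q + (\<bar>B\<bar> + norm ?q + 1) *\<^sub>R axis 2 1" ?q] by simp
        moreover have "norm ((\<bar>B\<bar> + norm ?q + 1) *\<^sub>R axis 2 1 :: real^2) = \<bar>B\<bar> + norm ?q + 1"
          unfolding norm_scaleR norm_axis_1 by (simp add: abs_of_nonneg add_nonneg_nonneg)
        ultimately show False by linarith
      qed
      then show ?thesis by blast
    qed
    moreover have "connected ?L"
      by (intro connected_continuous_image continuous_intros connected_UNIV)
    ultimately have "?L \<inter> frontier \<Omega> \<noteq> {}" by (intro connected_Int_frontier)
    then obtain t where t: "?q + t *\<^sub>R axis 2 1 \<in> frontier \<Omega>" by blast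
    have "(?q + t *\<^sub>R axis 2 1) $ 1 = a" by (simp add: axis_def)
    then show "a \<in> (\<lambda>y. y $ 1) ` frontier \<Omega>" using t by (metis image_eqI)
  qed
  then have "hausdorff1_outer {x $ 1 - r <..< x $ 1 + r} \<le> hausdorff1_outer ((\<lambda>y. y $ 1) ` frontier \<Omega>)"
    by (rule hausdorff1_outer_mono)
  also have "\<dots> \<le> ennreal 1 * hausdorff1_outer (frontier \<Omega>)"
    by (rule hausdorff1_outer_lipschitz_image) (auto simp: dist_vec_nth_le)
  finally have "ennreal (2 * r) \<le> emeasure length_measure (frontier \<Omega>)"
    using r domain_facts(5) by (simp add: hausdorff1_outer_real emeasure_length_measure)
  then have "emeasure length_measure (frontier \<Omega>) \<noteq> 0" using r by (auto simp: ennreal_eq_0_iff)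
  then show ?thesis
    using frontier_length_finite unfolding perimeter_def measure_def
    by (simp add: enn2real_positive_iff zero_less_iff_neq_zero)
qed

lemma C1_square_integrable:
  assumes "C1_grad \<phi> D"
  shows "square_integrable_on lborel \<Omega> \<phi>" "square_integrable_on lborel \<Omega> D"
    "square_integrable_on length_measure (frontier \<Omega>) \<phi>"
  using C1_gradD[OF assms] domain_facts frontier_length_finite
  by (auto intro!: continuous_bounded_set_finite_sq)

definition mass :: "(real^2 \<Rightarrow> real) \<Rightarrow> real" where
  "mass u = (LINT x:\<Omega>|lborel. (norm (u x))\<^sup>2)"

definition dirichlet :: "(real^2 \<Rightarrow> real^2) \<Rightarrow> real" where
  "dirichlet G = (LINT x:\<Omega>|lborel. (norm (G x))\<^sup>2)"

definition boundary_mass :: "(real^2 \<Rightarrow> real) \<Rightarrow> real" where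
  "boundary_mass g = (LINT x:frontier \<Omega>|length_measure. (norm (g x))\<^sup>2)"

lemma masses_nonneg: "mass u \<ge> 0" "dirichlet G \<ge> 0" "boundary_mass g \<ge> 0"
  unfolding mass_def dirichlet_def boundary_mass_def set_integral_norm_L2
  by (rule Bochner_Integration.integral_nonneg, rule zero_le_power2)+

lemma boundary_mass_le:
  assumes "\<epsilon> > 0"
  obtains K where "K \<ge> 0" "\<And>\<phi> D. C1_grad \<phi> D \<Longrightarrow> boundary_mass \<phi> \<le> \<epsilon> * dirichlet D + K * mass \<phi>"
proof -
  obtain C l0 where C: "C > 0" "l0 > 0"
    and T: "\<And>l \<phi> D. \<lbrakk>0 < l; l \<le> l0; C1_grad \<phi> D\<rbrakk> \<Longrightarrow>
      (\<integral>\<^sup>+x\<in>frontier \<Omega>. ennreal ((\<phi> x)\<^sup>2) \<partial>length_measure)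
      \<le> ennreal (C / l) * (\<integral>\<^sup>+x\<in>\<Omega>. ennreal ((\<phi> x)\<^sup>2) \<partial>lborel)
        + ennreal (C * l) * (\<integral>\<^sup>+x\<in>\<Omega>. ennreal ((norm (D x))\<^sup>2) \<partial>lborel)"
    by (rule trace_inequality[OF \<Omega>]) (rule that, assumption+)
  define l where "l = min l0 (\<epsilon> / C)"
  have l: "0 < l" "l \<le> l0" "C * l \<le> \<epsilon>" using C assms by (auto simp: l_def min_def field_simps)
  have "boundary_mass \<phi> \<le> \<epsilon> * dirichlet D + C / l * mass \<phi>" if C1: "C1_grad \<phi> D" for \<phi> D
  proof -
    note s = C1_square_integrable[OF C1]
    have "ennreal (boundary_mass \<phi>) \<le> ennreal (C / l) * ennreal (mass \<phi>) + ennreal (C * l) * ennreal (dirichlet D)"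
      using T[OF l(1,2) C1] nn_integral_set_sq[OF s(1)] nn_integral_set_sq[OF s(2)] nn_integral_set_sq[OF s(3)]
      by (simp add: boundary_mass_def mass_def dirichlet_def)
    also have "\<dots> = ennreal (C / l * mass \<phi> + C * l * dirichlet D)"
    proof -
      have "ennreal (C / l) * ennreal (mass \<phi>) = ennreal (C / l * mass \<phi>)"
        by (rule ennreal_mult[symmetric]) (use C l masses_nonneg in auto)
      moreover have "ennreal (C * l) * ennreal (dirichlet D) = ennreal (C * l * dirichlet D)"
        by (rule ennreal_mult[symmetric]) (use C l masses_nonneg in auto)
      ultimately show ?thesis
        by (simp only:) (rule ennreal_plus[symmetric]; use C l masses_nonneg in simp)
    qed
    finally have "boundary_mass \<phi> \<le> C / l * mass \<phi> + C * l * dirichlet D"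
      by (subst (asm) ennreal_le_iff) (use C l masses_nonneg in auto)
    also have "\<dots> \<le> C / l * mass \<phi> + \<epsilon> * dirichlet D"
      using l masses_nonneg by (intro add_left_mono mult_right_mono) auto
    finally show ?thesis by simp
  qed
  moreover have "C / l \<ge> 0" using C l by simp
  ultimately show ?thesis by (rule that[rotated])
qed

text \<open>The gradient and the trace are separate arguments because an element of the Sobolev space
  comes with both, and only for continuously differentiable functions is the second the restriction
  of the function itself.\<close>

definition robin_form :: "real \<Rightarrow> (real^2 \<Rightarrow> real^2) \<Rightarrow> (real^2 \<Rightarrow> real) \<Rightarrow> real" where
  "robin_form \<beta> G g = dirichlet G + \<beta> * boundary_mass g"

text \<open>For a negative \<open>\<beta>\<close> the boundary term is absorbed by half of the Dirichlet integral.\<close>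

lemma robin_form_coercive:
  obtains K where "K \<ge> 0" "\<And>\<phi> D. C1_grad \<phi> D \<Longrightarrow> dirichlet D \<le> 2 * robin_form \<beta> D \<phi> + K * mass \<phi>"
proof -
  define \<epsilon> where "\<epsilon> = 1 / (2 * (\<bar>\<beta>\<bar> + 1))"
  have \<epsilon>: "\<epsilon> > 0" "\<bar>\<beta>\<bar> * \<epsilon> \<le> 1 / 2"
    by (auto simp: \<epsilon>_def add_nonneg_pos divide_simps)
  obtain K where K: "K \<ge> 0" "\<And>\<phi> D. C1_grad \<phi> D \<Longrightarrow> boundary_mass \<phi> \<le> \<epsilon> * dirichlet D + K * mass \<phi>"
    by (rule boundary_mass_le[OF \<epsilon>(1)]) (rule that, assumption+)
  have "dirichlet D \<le> 2 * robin_form \<beta> D \<phi> + (2 * \<bar>\<beta>\<bar> * K) * mass \<phi>" if C1: "C1_grad \<phi> D" for \<phi> D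
  proof -
    have "- (\<beta> * boundary_mass \<phi>) \<le> \<bar>\<beta>\<bar> * boundary_mass \<phi>"
      using abs_ge_self[of "- \<beta> * boundary_mass \<phi>"] masses_nonneg(3)[of \<phi>] by (simp add: abs_mult)
    also have "\<dots> \<le> \<bar>\<beta>\<bar> * (\<epsilon> * dirichlet D + K * mass \<phi>)"
      by (intro mult_left_mono K(2)[OF C1]) auto
    also have "\<dots> = (\<bar>\<beta>\<bar> * \<epsilon>) * dirichlet D + \<bar>\<beta>\<bar> * K * mass \<phi>" by (simp add: algebra_simps)
    also have "\<dots> \<le> 1 / 2 * dirichlet D + \<bar>\<beta>\<bar> * K * mass \<phi>"
      by (intro add_right_mono mult_right_mono \<epsilon>(2) masses_nonneg)
    finally show ?thesis by (simp add: robin_form_def)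
  qed
  moreover have "2 * \<bar>\<beta>\<bar> * K \<ge> 0" using K by simp
  ultimately show ?thesis by (rule that[rotated])
qed

text \<open>The infimum of the Rayleigh quotient over continuously differentiable functions, written
  without division so that functions of mass zero on the domain need no exception.\<close>

definition robin_bottom :: "real \<Rightarrow> real" where
  "robin_bottom \<beta> = Sup {m. \<forall>\<phi> D. C1_grad \<phi> D \<longrightarrow> m * mass \<phi> \<le> robin_form \<beta> D \<phi>}"

lemma mass_one: "mass (\<lambda>_. 1) = area \<Omega>"
  by (simp add: mass_def area_def set_lebesgue_integral_def)

lemma form_one: "robin_form \<beta> (\<lambda>_. 0) (\<lambda>_. 1) = \<beta> * perimeter \<Omega>"
  using domain_facts(5)
  by (simp add: robin_form_def dirichlet_def boundary_mass_def perimeter_def set_lebesgue_integral_def)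

lemma robin_bottom_set:
  fixes \<beta> :: real
  defines "A \<equiv> {m. \<forall>\<phi> D. C1_grad \<phi> D \<longrightarrow> m * mass \<phi> \<le> robin_form \<beta> D \<phi>}"
  shows "A \<noteq> {}" "bdd_above A"
proof -
  obtain K where K: "K \<ge> 0" "\<And>\<phi> D. C1_grad \<phi> D \<Longrightarrow> dirichlet D \<le> 2 * robin_form \<beta> D \<phi> + K * mass \<phi>"
    by (rule robin_form_coercive[of \<beta>]) (rule that, assumption+)
  have "- K / 2 \<in> A"
    unfolding A_def
  proof (intro CollectI allI impI)
    fix \<phi> D assume "C1_grad \<phi> D"
    from K(2)[OF this] have "0 \<le> 2 * robin_form \<beta> D \<phi> + K * mass \<phi>" using masses_nonneg(2)[of D] by linarith
    then show "- K / 2 * mass \<phi> \<le> robin_form \<beta> D \<phi>" by simp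
  qed
  then show "A \<noteq> {}" by blast
  have "m \<le> \<beta> * perimeter \<Omega> / area \<Omega>" if "m \<in> A" for m
  proof -
    have "m * mass (\<lambda>_. 1) \<le> robin_form \<beta> (\<lambda>_. 0) (\<lambda>_. 1)"
      using that C1_grad_const[of 1] unfolding A_def by blast
    then show ?thesis using area_pos unfolding mass_one form_one by (simp add: pos_le_divide_eq)
  qed
  then show "bdd_above A" by (rule bdd_aboveI)
qed

lemma robin_bottom_le_form:
  assumes "C1_grad \<phi> D"
  shows "robin_bottom \<beta> * mass \<phi> \<le> robin_form \<beta> D \<phi>"
proof (cases "mass \<phi> = 0")
  case True
  obtain m where "\<forall>\<phi> D. C1_grad \<phi> D \<longrightarrow> m * mass \<phi> \<le> robin_form \<beta> D \<phi>" using robin_bottom_set(1)[of \<beta>] by blast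
  then show ?thesis using assms True by fastforce
next
  case False
  then have pos: "mass \<phi> > 0" using masses_nonneg(1)[of \<phi>] by simp
  have "robin_bottom \<beta> \<le> robin_form \<beta> D \<phi> / mass \<phi>"
    unfolding robin_bottom_def
    by (rule cSup_least[OF robin_bottom_set(1)]) (use assms pos in \<open>auto simp: pos_le_divide_eq\<close>)
  then show ?thesis using pos by (simp add: pos_le_divide_eq)
qed

lemma robin_bottom_greatest:
  assumes "\<And>\<phi> D. C1_grad \<phi> D \<Longrightarrow> m * mass \<phi> \<le> robin_form \<beta> D \<phi>"
  shows "m \<le> robin_bottom \<beta>"
  unfolding robin_bottom_def by (rule cSup_upper[OF _ robin_bottom_set(2)]) (use assms in auto)

lemma robin_bottom_le_one: "robin_bottom \<beta> * area \<Omega> \<le> \<beta> * perimeter \<Omega>"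
  using robin_bottom_le_form[OF C1_grad_const[of 1]] by (simp add: mass_one form_one)

subsection \<open>Limits of continuously differentiable functions\<close>

text \<open>Both sides of the integration by parts formula are continuous in the mean.\<close>

lemma H1_grad_limit:
  assumes C1: "\<And>n. C1_grad (\<phi> n) (D n)"
    and u: "square_integrable_on lborel \<Omega> u" "tendsto_L2 lborel \<Omega> \<phi> u"
    and G: "square_integrable_on lborel \<Omega> G" "tendsto_L2 lborel \<Omega> D G"
  shows "H1_grad \<Omega> u G"
  unfolding H1_grad_def
proof (intro conjI allI impI)
  fix \<psi> E assume \<psi>: "C1_grad \<psi> E" and supp: "compact (closure {x. \<psi> x \<noteq> 0})" "closure {x. \<psi> x \<noteq> 0} \<subseteq> \<Omega>"
  note s = C1_square_integrable[OF \<psi>]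
  show "(LINT x:\<Omega>|lborel. u x *\<^sub>R E x) = - (LINT x:\<Omega>|lborel. \<psi> x *\<^sub>R G x)"
  proof (rule euclidean_eqI)
    fix b :: "real^2" assume "b \<in> Basis"
    have sE: "square_integrable_on lborel \<Omega> (\<lambda>x. E x \<bullet> b)"
      and s\<psi>: "square_integrable_on lborel \<Omega> (\<lambda>x. \<psi> x *\<^sub>R b)"
      using C1_gradD(2,3)[OF \<psi>] domain_facts
      by (auto intro!: continuous_bounded_set_finite_sq continuous_intros)
    have lim: "(\<lambda>n. LINT x:\<Omega>|lborel. \<phi> n x \<bullet> (E x \<bullet> b)) \<longlonglongrightarrow> (LINT x:\<Omega>|lborel. u x \<bullet> (E x \<bullet> b))"
      by (rule tendsto_L2_inner[OF u(2) tendsto_L2_const[OF sE] u(1) sE])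
    have lim': "(\<lambda>n. - (LINT x:\<Omega>|lborel. D n x \<bullet> (\<psi> x *\<^sub>R b))) \<longlonglongrightarrow> - (LINT x:\<Omega>|lborel. G x \<bullet> (\<psi> x *\<^sub>R b))"
      by (rule tendsto_minus[OF tendsto_L2_inner[OF G(2) tendsto_L2_const[OF s\<psi>] G(1) s\<psi>]])
    have eq: "(LINT x:\<Omega>|lborel. \<phi> n x \<bullet> (E x \<bullet> b)) = - (LINT x:\<Omega>|lborel. D n x \<bullet> (\<psi> x *\<^sub>R b))" for n
      using arg_cong[OF integration_by_parts_C1[OF C1[of n] \<psi> supp], of "\<lambda>z. z \<bullet> b"]
        set_integral_scaleR_inner[OF C1_square_integrable(1)[OF C1[of n]] s(2), of b]
        set_integral_scaleR_inner[OF s(1) C1_square_integrable(2)[OF C1[of n]], of b]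
      by simp
    have "(LINT x:\<Omega>|lborel. u x \<bullet> (E x \<bullet> b)) = - (LINT x:\<Omega>|lborel. G x \<bullet> (\<psi> x *\<^sub>R b))"
      by (rule LIMSEQ_unique[OF lim[unfolded eq] lim'])
    then show "(LINT x:\<Omega>|lborel. u x *\<^sub>R E x) \<bullet> b = (- (LINT x:\<Omega>|lborel. \<psi> x *\<^sub>R G x)) \<bullet> b"
      using set_integral_scaleR_inner[OF u(1) s(2), of b] set_integral_scaleR_inner[OF s(1) G(1), of b] by simp
  qed
qed (rule u(1) G(1))+

lemma H1_grad_trace_limit:
  assumes C1: "\<And>n. C1_grad (\<phi> n) (D n)"
    and u: "square_integrable_on lborel \<Omega> u" "tendsto_L2 lborel \<Omega> \<phi> u"
    and G: "square_integrable_on lborel \<Omega> G" "tendsto_L2 lborel \<Omega> D G"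
    and g: "square_integrable_on length_measure (frontier \<Omega>) g" "tendsto_L2 length_measure (frontier \<Omega>) \<phi> g"
  shows "H1_grad_trace \<Omega> u G g"
  using H1_grad_limit[OF C1 u G] assms unfolding H1_grad_trace_def by blast

lemma C1_H1_grad_trace: "C1_grad \<phi> D \<Longrightarrow> H1_grad_trace \<Omega> \<phi> D \<phi>"
  using C1_square_integrable[of \<phi> D] by (intro H1_grad_trace_limit[of "\<lambda>_. \<phi>" "\<lambda>_. D"] tendsto_L2_const) auto

text \<open>The lower bound passes to limits, in the expanded form that is used for variations.\<close>

lemma robin_bottom_le_variation:
  assumes u: "H1_grad_trace \<Omega> u G g" and v: "H1_grad_trace \<Omega> v H h"
  shows "robin_bottom \<beta> * (mass u + 2 * t * (LINT x:\<Omega>|lborel. u x \<bullet> v x) + t\<^sup>2 * mass v)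
    \<le> (dirichlet G + 2 * t * (LINT x:\<Omega>|lborel. G x \<bullet> H x) + t\<^sup>2 * dirichlet H)
      + \<beta> * (boundary_mass g + 2 * t * (LINT x:frontier \<Omega>|length_measure. g x \<bullet> h x) + t\<^sup>2 * boundary_mass h)"
proof -
  obtain \<phi> D where \<phi>: "\<And>n::nat. C1_grad (\<phi> n) (D n)" "tendsto_L2 lborel \<Omega> \<phi> u" "tendsto_L2 lborel \<Omega> D G"
    "tendsto_L2 length_measure (frontier \<Omega>) \<phi> g"
    using u unfolding H1_grad_trace_def by blast
  obtain \<psi> E where \<psi>: "\<And>n::nat. C1_grad (\<psi> n) (E n)" "tendsto_L2 lborel \<Omega> \<psi> v" "tendsto_L2 lborel \<Omega> E H"
    "tendsto_L2 length_measure (frontier \<Omega>) \<psi> h"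
    using v unfolding H1_grad_trace_def by blast
  have su: "square_integrable_on lborel \<Omega> u" "square_integrable_on lborel \<Omega> G" "square_integrable_on length_measure (frontier \<Omega>) g"
    and sv: "square_integrable_on lborel \<Omega> v" "square_integrable_on lborel \<Omega> H" "square_integrable_on length_measure (frontier \<Omega>) h"
    using u v by (auto simp: H1_grad_trace_def H1_grad_def)
  let ?l = "\<lambda>n. robin_bottom \<beta> * (mass (\<phi> n) + 2 * t * (LINT x:\<Omega>|lborel. \<phi> n x \<bullet> \<psi> n x) + t\<^sup>2 * mass (\<psi> n))"
  let ?r = "\<lambda>n. (dirichlet (D n) + 2 * t * (LINT x:\<Omega>|lborel. D n x \<bullet> E n x) + t\<^sup>2 * dirichlet (E n))
      + \<beta> * (boundary_mass (\<phi> n) + 2 * t * (LINT x:frontier \<Omega>|length_measure. \<phi> n x \<bullet> \<psi> n x) + t\<^sup>2 * boundary_mass (\<psi> n))"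
  have le: "?l n \<le> ?r n" for n
  proof -
    note C = C1_square_integrable[OF \<phi>(1)[of n]] and C' = C1_square_integrable[OF \<psi>(1)[of n]]
    note e1 = square_integrable_on_lincomb(2)[OF C(1) C'(1), of t] and e2 = square_integrable_on_lincomb(2)[OF C(2) C'(2), of t]
      and e3 = square_integrable_on_lincomb(2)[OF C(3) C'(3), of t]
    show ?thesis
      using robin_bottom_le_form[OF C1_grad_lincomb[OF \<phi>(1)[of n] \<psi>(1)[of n], of t], of \<beta>]
      unfolding robin_form_def mass_def dirichlet_def boundary_mass_def e1[unfolded real_scaleR_def] e2 e3[unfolded real_scaleR_def] .
  qed
  show ?thesis
  proof (rule LIMSEQ_le)
    show "?l \<longlonglongrightarrow> robin_bottom \<beta> * (mass u + 2 * t * (LINT x:\<Omega>|lborel. u x \<bullet> v x) + t\<^sup>2 * mass v)"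
      unfolding mass_def
      by (intro tendsto_add tendsto_mult tendsto_const tendsto_L2_norm tendsto_L2_inner \<phi> \<psi> su sv)
    show "?r \<longlonglongrightarrow> (dirichlet G + 2 * t * (LINT x:\<Omega>|lborel. G x \<bullet> H x) + t\<^sup>2 * dirichlet H)
      + \<beta> * (boundary_mass g + 2 * t * (LINT x:frontier \<Omega>|length_measure. g x \<bullet> h x) + t\<^sup>2 * boundary_mass h)"
      unfolding dirichlet_def boundary_mass_def
      by (intro tendsto_add tendsto_mult tendsto_const tendsto_L2_norm tendsto_L2_inner \<phi> \<psi> su sv)
  qed (use le in auto)
qed

lemma linear_part_zero:
  fixes p q :: real
  assumes "\<And>t. 0 \<le> 2 * t * p + t\<^sup>2 * q"
  shows "p = 0"
proof (rule ccontr)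
  assume "p \<noteq> 0"
  define c where "c = \<bar>q\<bar> + 1"
  have c: "c > 0" "q \<le> c" by (auto simp: c_def)
  have "0 \<le> 2 * (- p / c) * p + (- p / c)\<^sup>2 * q" by (rule assms)
  also have "\<dots> \<le> 2 * (- p / c) * p + (- p / c)\<^sup>2 * c" using c by (intro add_left_mono mult_left_mono) auto
  also have "\<dots> = - (p\<^sup>2 / c)" using c by (simp add: power2_eq_square field_simps)
  also have "\<dots> < 0" using c \<open>p \<noteq> 0\<close> by simp
  finally show False by simp
qed

text \<open>Form minus \<open>robin_bottom \<beta>\<close> times mass is nonnegative on \<open>u + t v\<close> and zero for \<open>t = 0\<close>, so the
  part linear in \<open>t\<close> vanishes. That is the weak equation tested with \<open>v\<close>.\<close>

lemma minimal_weak_solution: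
  assumes u: "H1_grad_trace \<Omega> u G g" and min: "robin_form \<beta> G g = robin_bottom \<beta> * mass u"
  shows "\<And>v H h. H1_grad_trace \<Omega> v H h \<Longrightarrow>
      (LINT x:\<Omega>|lborel. G x \<bullet> H x) + \<beta> * (LINT x:frontier \<Omega>|length_measure. g x * h x)
        = robin_bottom \<beta> * (LINT x:\<Omega>|lborel. u x * v x)"
proof -
  fix v H h assume v: "H1_grad_trace \<Omega> v H h"
  define p where "p = (LINT x:\<Omega>|lborel. G x \<bullet> H x) + \<beta> * (LINT x:frontier \<Omega>|length_measure. g x \<bullet> h x)
        - robin_bottom \<beta> * (LINT x:\<Omega>|lborel. u x \<bullet> v x)"
  have "0 \<le> 2 * t * p + t\<^sup>2 * (dirichlet H + \<beta> * boundary_mass h - robin_bottom \<beta> * mass v)" for t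
    using robin_bottom_le_variation[OF u v, of \<beta> t] min unfolding p_def robin_form_def
    by (simp add: algebra_simps)
  then have "p = 0" by (rule linear_part_zero)
  then show "(LINT x:\<Omega>|lborel. G x \<bullet> H x) + \<beta> * (LINT x:frontier \<Omega>|length_measure. g x * h x)
        = robin_bottom \<beta> * (LINT x:\<Omega>|lborel. u x * v x)"
    by (simp add: p_def)
qed

lemma almost_minimizer:
  fixes e :: real
  assumes "e > 0"
  shows "\<exists>\<phi> D. C1_grad \<phi> D \<and> mass \<phi> = 1 \<and> robin_form \<beta> D \<phi> \<le> robin_bottom \<beta> + e"
proof -
  have "\<not> robin_bottom \<beta> + e \<le> robin_bottom \<beta>" using assms by simp
  then obtain \<phi> D where C1: "C1_grad \<phi> D" and less: "robin_form \<beta> D \<phi> < (robin_bottom \<beta> + e) * mass \<phi>"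
    using robin_bottom_greatest[of "robin_bottom \<beta> + e" \<beta>] by (meson not_le)
  have "mass \<phi> \<noteq> 0" using robin_bottom_le_form[OF C1, of \<beta>] less by auto
  then have pos: "mass \<phi> > 0" using masses_nonneg(1)[of \<phi>] by simp
  define c where "c = 1 / sqrt (mass \<phi>)"
  have c2: "c\<^sup>2 * mass \<phi> = 1" using pos by (simp add: c_def power_divide)
  have C1c: "C1_grad (\<lambda>x. 0 + c * \<phi> x) (\<lambda>x. 0 + c *\<^sub>R D x)"
    by (rule C1_grad_lincomb[OF C1_grad_const C1])
  have "mass (\<lambda>x. c * \<phi> x) = 1" using set_integral_norm_scale[of lborel \<Omega> c \<phi>] c2 by (simp add: mass_def)
  moreover have "robin_form \<beta> (\<lambda>x. c *\<^sub>R D x) (\<lambda>x. c * \<phi> x) = c\<^sup>2 * robin_form \<beta> D \<phi>"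
    using set_integral_norm_scale[of length_measure "frontier \<Omega>" c \<phi>] set_integral_norm_scale[of lborel \<Omega> c D]
    by (simp add: robin_form_def boundary_mass_def dirichlet_def algebra_simps)
  moreover have "c\<^sup>2 * robin_form \<beta> D \<phi> \<le> c\<^sup>2 * ((robin_bottom \<beta> + e) * mass \<phi>)"
    using less by (intro mult_left_mono) auto
  moreover have "c\<^sup>2 * ((robin_bottom \<beta> + e) * mass \<phi>) = robin_bottom \<beta> + e"
    using c2 by (metis mult.left_commute mult.right_neutral)
  ultimately show ?thesis using C1c by (intro exI[of _ "\<lambda>x. c * \<phi> x"] exI[of _ "\<lambda>x. c *\<^sub>R D x"]) simp
qed

text \<open>By the parallelogram law the energy of the difference of two almost minimisers is small as soon
  as their difference is small in the mean, so compactness in the mean suffices.\<close>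

lemma almost_minimizer_difference:
  assumes \<phi>: "C1_grad \<phi> D" "mass \<phi> = 1" "robin_form \<beta> D \<phi> \<le> robin_bottom \<beta> + e"
    and \<psi>: "C1_grad \<psi> E" "mass \<psi> = 1" "robin_form \<beta> E \<psi> \<le> robin_bottom \<beta> + e'"
  shows "robin_form \<beta> (\<lambda>x. D x - E x) (\<lambda>x. \<phi> x - \<psi> x) \<le> 2 * e + 2 * e' + robin_bottom \<beta> * mass (\<lambda>x. \<phi> x - \<psi> x)"
proof -
  note C = C1_square_integrable[OF \<phi>(1)] and C' = C1_square_integrable[OF \<psi>(1)]
  have "mass (\<lambda>x. \<phi> x + \<psi> x) + mass (\<lambda>x. \<phi> x - \<psi> x) = 4"
    using square_integrable_on_parallelogram[OF C(1) C'(1)] \<phi>(2) \<psi>(2) by (simp only: mass_def)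
  then have m: "mass (\<lambda>x. \<phi> x + \<psi> x) = 4 - mass (\<lambda>x. \<phi> x - \<psi> x)" by simp
  have d: "dirichlet (\<lambda>x. D x + E x) + dirichlet (\<lambda>x. D x - E x) = 2 * dirichlet D + 2 * dirichlet E"
    using square_integrable_on_parallelogram[OF C(2) C'(2)] by (simp only: dirichlet_def)
  have b: "boundary_mass (\<lambda>x. \<phi> x + \<psi> x) + boundary_mass (\<lambda>x. \<phi> x - \<psi> x) = 2 * boundary_mass \<phi> + 2 * boundary_mass \<psi>"
    using square_integrable_on_parallelogram[OF C(3) C'(3)] by (simp only: boundary_mass_def)
  have "robin_form \<beta> (\<lambda>x. D x + E x) (\<lambda>x. \<phi> x + \<psi> x) + robin_form \<beta> (\<lambda>x. D x - E x) (\<lambda>x. \<phi> x - \<psi> x)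
      = (dirichlet (\<lambda>x. D x + E x) + dirichlet (\<lambda>x. D x - E x))
        + \<beta> * (boundary_mass (\<lambda>x. \<phi> x + \<psi> x) + boundary_mass (\<lambda>x. \<phi> x - \<psi> x))"
    by (simp add: robin_form_def algebra_simps)
  also have "\<dots> = 2 * robin_form \<beta> D \<phi> + 2 * robin_form \<beta> E \<psi>"
    unfolding d b by (simp add: robin_form_def algebra_simps)
  finally have "robin_form \<beta> (\<lambda>x. D x - E x) (\<lambda>x. \<phi> x - \<psi> x)
      = 2 * robin_form \<beta> D \<phi> + 2 * robin_form \<beta> E \<psi> - robin_form \<beta> (\<lambda>x. D x + E x) (\<lambda>x. \<phi> x + \<psi> x)" by simp
  moreover have "robin_bottom \<beta> * mass (\<lambda>x. \<phi> x + \<psi> x) \<le> robin_form \<beta> (\<lambda>x. D x + E x) (\<lambda>x. \<phi> x + \<psi> x)"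
    using robin_bottom_le_form[OF C1_grad_lincomb[OF \<phi>(1) \<psi>(1), of 1], of \<beta>] by simp
  ultimately show ?thesis using \<phi>(3) \<psi>(3) unfolding m by (simp add: algebra_simps)
qed

text \<open>Coercivity bounds the energies of a minimising sequence, and Rellich's theorem supplies a
  subsequence that is Cauchy in the mean. The difference estimate, coercivity and the trace
  inequality then make the gradients and the boundary values Cauchy too.\<close>

theorem minimizer_exists:
  obtains u G g where "H1_grad_trace \<Omega> u G g" "mass u = 1" "robin_form \<beta> G g = robin_bottom \<beta>"
proof -
  define lam where "lam = robin_bottom \<beta>"
  have "\<exists>\<phi> D. C1_grad \<phi> D \<and> mass \<phi> = 1 \<and> robin_form \<beta> D \<phi> \<le> lam + 1 / real (Suc n)" for n
    unfolding lam_def by (rule almost_minimizer) simp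
  then obtain \<phi>0 D0 where C10: "\<And>n::nat. C1_grad (\<phi>0 n) (D0 n)" and m0: "\<And>n. mass (\<phi>0 n) = 1"
    and f0: "\<And>n. robin_form \<beta> (D0 n) (\<phi>0 n) \<le> lam + 1 / real (Suc n)" by metis
  obtain K where K: "K \<ge> 0" "\<And>\<phi> D. C1_grad \<phi> D \<Longrightarrow> dirichlet D \<le> 2 * robin_form \<beta> D \<phi> + K * mass \<phi>"
    by (rule robin_form_coercive[of \<beta>]) (rule that, assumption+)
  obtain K1 where K1: "K1 \<ge> 0" "\<And>\<phi> D. C1_grad \<phi> D \<Longrightarrow> boundary_mass \<phi> \<le> 1 * dirichlet D + K1 * mass \<phi>"
    by (rule boundary_mass_le[OF zero_less_one]) (rule that, assumption+)
  define M where "M = max 1 (2 * (lam + 1) + K)"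
  have massnn: "(\<integral>\<^sup>+x\<in>\<Omega>. ennreal ((\<phi> x)\<^sup>2) \<partial>lborel) = ennreal (mass \<phi>)" if "C1_grad \<phi> D" for \<phi> D
    using nn_integral_set_sq[OF C1_square_integrable(1)[OF that]] by (simp add: mass_def)
  have N\<phi>: "(\<integral>\<^sup>+x\<in>\<Omega>. ennreal ((\<phi>0 n x)\<^sup>2) \<partial>lborel) \<le> ennreal M" for n
    unfolding massnn[OF C10] m0 by (intro ennreal_leI) (simp add: M_def)
  have ND: "(\<integral>\<^sup>+x\<in>\<Omega>. ennreal ((norm (D0 n x))\<^sup>2) \<partial>lborel) \<le> ennreal M" for n
  proof -
    have "1 / real (Suc n) \<le> 1" by simp
    then have "robin_form \<beta> (D0 n) (\<phi>0 n) \<le> lam + 1" using f0[of n] by linarith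
    then have "dirichlet (D0 n) \<le> M" using K(2)[OF C10[of n]] m0[of n] by (simp add: M_def)
    then show ?thesis
      using nn_integral_set_sq[OF C1_square_integrable(2)[OF C10[of n]]] by (simp add: dirichlet_def ennreal_leI)
  qed
  have "M > 0" by (simp add: M_def)
  obtain k :: "nat \<Rightarrow> nat" where k: "strict_mono k"
    and rel: "\<And>e. e > 0 \<Longrightarrow> \<exists>N. \<forall>m\<ge>N. \<forall>n\<ge>N. (\<integral>\<^sup>+x\<in>\<Omega>. ennreal ((\<phi>0 (k m) x - \<phi>0 (k n) x)\<^sup>2) \<partial>lborel) \<le> ennreal e"
    by (rule rellich_C1[OF \<Omega> C10 \<open>M > 0\<close> N\<phi> ND]) (rule that, assumption+)
  define \<phi> where "\<phi> n = \<phi>0 (k n)" for n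
  define D where "D n = D0 (k n)" for n
  have C1: "C1_grad (\<phi> n) (D n)" and m: "mass (\<phi> n) = 1" for n using C10 m0 by (auto simp: \<phi>_def D_def)
  have f: "robin_form \<beta> (D n) (\<phi> n) \<le> lam + 1 / real (Suc n)" for n
  proof -
    have "1 / real (Suc (k n)) \<le> 1 / real (Suc n)" using seq_suble[OF k, of n] by (intro divide_left_mono) auto
    then show ?thesis using f0[of "k n"] by (simp add: \<phi>_def D_def)
  qed
  have dC1: "C1_grad (\<lambda>x. \<phi> m x - \<phi> n x) (\<lambda>x. D m x - D n x)" for m n by (rule C1_grad_diff[OF C1 C1])
  define \<mu> where "\<mu> m n = mass (\<lambda>x. \<phi> m x - \<phi> n x)" for m n
  have \<mu>0: "\<mu> m n \<ge> 0" for m n by (simp add: \<mu>_def masses_nonneg)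
  have mu: "\<exists>N. \<forall>m\<ge>N. \<forall>n\<ge>N. \<mu> m n \<le> e" if e: "e > 0" for e
  proof -
    obtain N where N: "\<And>m n. m \<ge> N \<Longrightarrow> n \<ge> N \<Longrightarrow> (\<integral>\<^sup>+x\<in>\<Omega>. ennreal ((\<phi>0 (k m) x - \<phi>0 (k n) x)\<^sup>2) \<partial>lborel) \<le> ennreal e"
      using rel[OF e] by blast
    have "\<mu> m n \<le> e" if "m \<ge> N" "n \<ge> N" for m n
    proof -
      have "ennreal (\<mu> m n) \<le> ennreal e"
        using massnn[OF dC1[of m n]] N[OF that] by (simp add: \<mu>_def \<phi>_def)
      then show ?thesis using e by simp
    qed
    then show ?thesis by blast
  qed
  \<comment> \<open>A common bound for the factors of \<open>\<mu> m n\<close> in the Cauchy estimates of functions, gradients and traces.\<close>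
  define c where "c = 2 * \<bar>lam\<bar> + K + K1 + 1"
  have c: "c > 0" using K(1) K1(1) by (simp add: c_def add_nonneg_pos)
  have dir: "dirichlet (\<lambda>x. D m x - D n x) \<le> 4 / real (Suc m) + 4 / real (Suc n) + (2 * \<bar>lam\<bar> + K) * \<mu> m n" for m n
  proof -
    have "lam * \<mu> m n \<le> \<bar>lam\<bar> * \<mu> m n" using \<mu>0[of m n] by (intro mult_right_mono) auto
    then show ?thesis
      using K(2)[OF dC1[of m n]] almost_minimizer_difference[OF C1 m f[unfolded lam_def] C1 m f[unfolded lam_def], of m n]
      by (simp add: \<mu>_def lam_def algebra_simps)
  qed
  have bd: "boundary_mass (\<lambda>x. \<phi> m x - \<phi> n x) \<le> dirichlet (\<lambda>x. D m x - D n x) + K1 * \<mu> m n" for m n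
    using K1(2)[OF dC1[of m n]] by (simp add: \<mu>_def)
  have small: "\<exists>N. \<forall>m\<ge>N. \<forall>n\<ge>N. 4 / real (Suc m) + 4 / real (Suc n) + c * \<mu> m n \<le> e" if e: "e > 0" for e
  proof -
    obtain N1 where N1: "\<And>m n. m \<ge> N1 \<Longrightarrow> n \<ge> N1 \<Longrightarrow> \<mu> m n \<le> e / (3 * c)" using mu[of "e / (3 * c)"] e c by auto
    obtain N2 where N2: "1 / real (Suc N2) < e / 12" using nat_approx_posE[of "e / 12"] e by auto
    have q: "4 / real (Suc m) \<le> e / 3" if "m \<ge> N2" for m
    proof -
      have "1 / real (Suc m) \<le> 1 / real (Suc N2)" using that by (intro divide_left_mono) auto
      then show ?thesis using N2 by simp
    qed
    have "4 / real (Suc m) + 4 / real (Suc n) + c * \<mu> m n \<le> e" if "m \<ge> max N1 N2" "n \<ge> max N1 N2" for m n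
    proof -
      have "c * \<mu> m n \<le> c * (e / (3 * c))" using N1[of m n] that c by (intro mult_left_mono) auto
      also have "\<dots> = e / 3" using c by simp
      finally show ?thesis using q[of m] q[of n] that by simp
    qed
    then show ?thesis by blast
  qed
  have dominated: "x \<le> c * \<mu> m n" if "x = \<mu> m n \<or> x = (2 * \<bar>lam\<bar> + K) * \<mu> m n \<or> x = (2 * \<bar>lam\<bar> + K + K1) * \<mu> m n" for x m n
    using that
  proof (elim disjE)
    assume "x = \<mu> m n"
    then show ?thesis using mult_right_mono[OF _ \<mu>0, of 1 c m n] K(1) K1(1) by (simp add: c_def)
  qed (use K(1) K1(1) \<mu>0[of m n] in \<open>auto simp: c_def intro!: mult_right_mono\<close>)
  have "\<exists>u. square_integrable_on lborel \<Omega> u \<and> tendsto_L2 lborel \<Omega> \<phi> u"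
  proof (rule tendsto_L2_complete)
    show "\<exists>N. \<forall>m\<ge>N. \<forall>n\<ge>N. (LINT x:\<Omega>|lborel. (norm (\<phi> m x - \<phi> n x))\<^sup>2) \<le> e" if "e > 0" for e
      using mu[OF that] by (simp only: \<mu>_def mass_def)
  qed (use domain_facts C1_square_integrable[OF C1] in auto)
  then obtain u where u: "square_integrable_on lborel \<Omega> u" "tendsto_L2 lborel \<Omega> \<phi> u" by blast
  have "\<exists>G. square_integrable_on lborel \<Omega> G \<and> tendsto_L2 lborel \<Omega> D G"
  proof (rule tendsto_L2_complete)
    fix e :: real assume "e > 0"
    then obtain N where N: "\<And>m n. m \<ge> N \<Longrightarrow> n \<ge> N \<Longrightarrow> 4 / real (Suc m) + 4 / real (Suc n) + c * \<mu> m n \<le> e"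
      using small by meson
    have "dirichlet (\<lambda>x. D m x - D n x) \<le> e" if "m \<ge> N" "n \<ge> N" for m n
      using dir[of m n] dominated[of "(2 * \<bar>lam\<bar> + K) * \<mu> m n" m n] N[OF that] by simp
    then show "\<exists>N. \<forall>m\<ge>N. \<forall>n\<ge>N. (LINT x:\<Omega>|lborel. (norm (D m x - D n x))\<^sup>2) \<le> e"
      unfolding dirichlet_def by blast
  qed (use domain_facts C1_square_integrable[OF C1] in auto)
  then obtain G where G: "square_integrable_on lborel \<Omega> G" "tendsto_L2 lborel \<Omega> D G" by blast
  have "\<exists>g. square_integrable_on length_measure (frontier \<Omega>) g \<and> tendsto_L2 length_measure (frontier \<Omega>) \<phi> g"
  proof (rule tendsto_L2_complete)
    fix e :: real assume "e > 0"
    then obtain N where N: "\<And>m n. m \<ge> N \<Longrightarrow> n \<ge> N \<Longrightarrow> 4 / real (Suc m) + 4 / real (Suc n) + c * \<mu> m n \<le> e"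
      using small by meson
    have "boundary_mass (\<lambda>x. \<phi> m x - \<phi> n x) \<le> e" if "m \<ge> N" "n \<ge> N" for m n
      using bd[of m n] dir[of m n] dominated[of "(2 * \<bar>lam\<bar> + K + K1) * \<mu> m n" m n] N[OF that]
      by (simp add: algebra_simps)
    then show "\<exists>N. \<forall>m\<ge>N. \<forall>n\<ge>N. (LINT x:frontier \<Omega>|length_measure. (norm (\<phi> m x - \<phi> n x))\<^sup>2) \<le> e"
      unfolding boundary_mass_def by blast
  qed (use domain_facts C1_square_integrable[OF C1] in auto)
  then obtain g where g: "square_integrable_on length_measure (frontier \<Omega>) g"
    "tendsto_L2 length_measure (frontier \<Omega>) \<phi> g" by blast
  have "(\<lambda>n. mass (\<phi> n)) \<longlonglongrightarrow> mass u" unfolding mass_def by (rule tendsto_L2_norm[OF u(2,1)])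
  then have "mass u = 1" unfolding m by (simp add: LIMSEQ_const_iff)
  moreover have "robin_form \<beta> G g = robin_bottom \<beta>"
  proof (rule LIMSEQ_unique)
    show "(\<lambda>n. robin_form \<beta> (D n) (\<phi> n)) \<longlonglongrightarrow> robin_form \<beta> G g"
      unfolding robin_form_def dirichlet_def boundary_mass_def
      by (intro tendsto_add tendsto_mult tendsto_const tendsto_L2_norm G g)
    show "(\<lambda>n. robin_form \<beta> (D n) (\<phi> n)) \<longlonglongrightarrow> robin_bottom \<beta>"
    proof (rule tendsto_sandwich[of "\<lambda>_. robin_bottom \<beta>" _ _ "\<lambda>n. lam + 1 / real (Suc n)"])
      show "(\<lambda>n. lam + 1 / real (Suc n)) \<longlonglongrightarrow> robin_bottom \<beta>"
        using tendsto_add[OF tendsto_const[of lam] LIMSEQ_inverse_real_of_nat] by (simp add: lam_def inverse_eq_divide)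
      show "\<forall>\<^sub>F n in sequentially. robin_bottom \<beta> \<le> robin_form \<beta> (D n) (\<phi> n)"
        using robin_bottom_le_form[OF C1, of \<beta>] by (simp add: m)
      show "\<forall>\<^sub>F n in sequentially. robin_form \<beta> (D n) (\<phi> n) \<le> lam + 1 / real (Suc n)"
        using f by simp
    qed simp
  qed
  moreover have "H1_grad_trace \<Omega> u G g" by (rule H1_grad_trace_limit[OF C1 u G g])
  ultimately show ?thesis by (intro that)
qed

subsection \<open>The first Robin eigenvalue\<close>

lemma mass_pos_of_lin_indep:
  assumes "lin_indep_ae \<Omega> 1 u" "square_integrable_on lborel \<Omega> (u 0)"
  shows "mass (u 0) > 0"
proof (rule ccontr)
  assume "\<not> ?thesis"
  then have "(\<integral>x. (norm (indicat_real \<Omega> x *\<^sub>R u 0 x))\<^sup>2 \<partial>lborel) = 0"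
    using masses_nonneg(1)[of "u 0"] by (simp only: mass_def set_integral_norm_L2)
  then have "AE x in lborel. (norm (indicat_real \<Omega> x *\<^sub>R u 0 x))\<^sup>2 = 0"
    using assms(2) unfolding square_integrable_on_L2_fun L2_fun_def
    by (subst (asm) integral_nonneg_eq_0_iff_AE) auto
  then have "AE x in lborel. x \<in> \<Omega> \<longrightarrow> (\<Sum>i<1. 1 * u i x) = 0"
    by eventually_elim auto
  with assms(1)[unfolded lin_indep_ae_def, THEN spec[of _ "\<lambda>_. 1"]]
  have "\<forall>i<1::nat. (1::real) = 0" by (rule mp)
  from spec[OF this, of 0] show False by simp
qed

text \<open>The minimiser is an eigenfunction for the infimum. Conversely, testing a weak solution with
  itself shows that its Rayleigh quotient is its eigenvalue.\<close>

theorem robin_eigenvalue_eq_bottom: "robin_eigenvalue 1 \<Omega> \<beta> = robin_bottom \<beta>"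
proof -
  let ?T = "{t. \<exists>\<mu> u. lin_indep_ae \<Omega> 1 u \<and> (\<forall>i<1. \<mu> i \<le> t \<and> robin_weak_solution \<Omega> \<beta> (\<mu> i) (u i))}"
  have "robin_bottom \<beta> \<in> ?T"
  proof -
    obtain u G g where u: "H1_grad_trace \<Omega> u G g" and m: "mass u = 1" and f: "robin_form \<beta> G g = robin_bottom \<beta>"
      by (rule minimizer_exists)
    have "robin_weak_solution \<Omega> \<beta> (robin_bottom \<beta>) u"
      unfolding robin_weak_solution_def
      using u minimal_weak_solution[OF u, of \<beta>] f m by auto
    moreover have "lin_indep_ae \<Omega> 1 (\<lambda>_. u)"
      unfolding lin_indep_ae_def
    proof (intro allI impI)
      fix c :: "nat \<Rightarrow> real" and i :: nat
      assume AE: "AE x in lborel. x \<in> \<Omega> \<longrightarrow> (\<Sum>i<1. c i * u x) = 0" and i: "i < 1"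
      show "c i = 0"
      proof (rule ccontr)
        assume "c i \<noteq> 0"
        then have "AE x in lborel. (norm (indicat_real \<Omega> x *\<^sub>R u x))\<^sup>2 = 0"
          using AE i by (auto elim!: eventually_mono split: split_indicator)
        then have "mass u = 0" unfolding mass_def set_integral_norm_L2 by (rule integral_eq_zero_AE)
        then show False using m by simp
      qed
    qed
    ultimately show ?thesis by auto
  qed
  moreover have "robin_bottom \<beta> \<le> t" if t: "t \<in> ?T" for t
  proof -
    obtain \<mu> u where ind: "lin_indep_ae \<Omega> 1 u" and le: "\<mu> 0 \<le> t" and sol: "robin_weak_solution \<Omega> \<beta> (\<mu> (0::nat)) (u 0)"
      using t by auto
    obtain G g where u: "H1_grad_trace \<Omega> (u 0) G g"
      and eq: "\<And>v H h. H1_grad_trace \<Omega> v H h \<Longrightarrow>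
        (LINT x:\<Omega>|lborel. G x \<bullet> H x) + \<beta> * (LINT x:frontier \<Omega>|length_measure. g x * h x)
             = \<mu> 0 * (LINT x:\<Omega>|lborel. u 0 x * v x)"
      using sol unfolding robin_weak_solution_def by blast
    have "robin_form \<beta> G g = \<mu> 0 * mass (u 0)"
      using eq[OF u]
      unfolding robin_form_def dirichlet_def boundary_mass_def mass_def power2_norm_eq_inner inner_real_def .
    moreover have "robin_bottom \<beta> * mass (u 0) \<le> robin_form \<beta> G g"
      using robin_bottom_le_variation[OF u u, of \<beta> 0] by (simp add: robin_form_def)
    moreover have "mass (u 0) > 0"
      using u by (intro mass_pos_of_lin_indep ind) (auto simp: H1_grad_trace_def H1_grad_def)
    ultimately have "robin_bottom \<beta> \<le> \<mu> 0" by simp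
    then show ?thesis using le by simp
  qed
  ultimately show ?thesis unfolding robin_eigenvalue_def by (rule cInf_eq_minimum)
qed

end

subsection \<open>Strict inequality\<close>

lemma DERIV_pos_part_sq:
  fixes y :: real
  shows "((\<lambda>y. (max 0 y)\<^sup>2) has_real_derivative 2 * max 0 y) (at y)"
proof -
  consider "y < 0" | "y > 0" | "y = 0" by linarith
  then show ?thesis
  proof cases
    case 1
    have "((\<lambda>_. 0) has_real_derivative 0) (at y)" by simp
    then have "((\<lambda>y. (max 0 y)\<^sup>2) has_real_derivative 0) (at y)"
      by (rule has_field_derivative_transform_within_open[where S="{..<0}"]) (use 1 in auto)
    then show ?thesis using 1 by simp
  next
    case 2
    have "((\<lambda>y. y\<^sup>2) has_real_derivative 2 * y) (at y)" by (auto intro!: derivative_eq_intros)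
    then have "((\<lambda>y. (max 0 y)\<^sup>2) has_real_derivative 2 * y) (at y)"
      by (rule has_field_derivative_transform_within_open[where S="{0<..}"]) (use 2 in auto)
    then show ?thesis using 2 by simp
  next
    case 3
    have "(\<lambda>h::real. max 0 h) \<midarrow>0\<rightarrow> max 0 0" by (intro tendsto_max tendsto_const tendsto_ident_at)
    moreover have "\<forall>\<^sub>F h::real in at 0. ((max 0 h)\<^sup>2 - (max 0 0)\<^sup>2) / (h - 0) = max 0 h"
      by (auto simp: eventually_at_filter max_def power2_eq_square)
    ultimately have "(\<lambda>h::real. ((max 0 h)\<^sup>2 - (max 0 0)\<^sup>2) / (h - 0)) \<midarrow>0\<rightarrow> max 0 0"
      by (subst tendsto_cong)
    then show ?thesis using 3 by (simp add: has_field_derivative_iff)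
  qed
qed

text \<open>The square of the positive part is the simplest cut-off with a continuous derivative.\<close>

lemma bump_exists:
  fixes \<Omega> :: "(real^2) set"
  assumes "open \<Omega>" "x0 \<in> \<Omega>"
  obtains \<psi> E r where "C1_grad \<psi> E" "compact (closure {x. \<psi> x \<noteq> 0})" "closure {x. \<psi> x \<noteq> 0} \<subseteq> \<Omega>"
    "\<And>x. \<psi> x \<ge> 0" "r > 0" "\<And>x. x \<in> ball x0 r \<Longrightarrow> \<psi> x > 0"
proof -
  obtain r where r: "r > 0" "cball x0 r \<subseteq> \<Omega>" using assms open_contains_cball by blast
  define \<psi> where "\<psi> x = (max 0 (r\<^sup>2 - (x - x0) \<bullet> (x - x0)))\<^sup>2" for x
  define E where "E x = (- 4 * max 0 (r\<^sup>2 - (x - x0) \<bullet> (x - x0))) *\<^sub>R (x - x0)" for x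
  have "(\<psi> has_derivative (\<lambda>h. h \<bullet> E x)) (at x)" for x
  proof -
    have "((\<lambda>x. r\<^sup>2 - (x - x0) \<bullet> (x - x0)) has_derivative (\<lambda>h. - 2 * (h \<bullet> (x - x0)))) (at x)"
      by (auto intro!: derivative_eq_intros simp: inner_commute)
    from has_derivative_compose[OF this DERIV_pos_part_sq[unfolded has_field_derivative_def]]
    moreover have "(\<lambda>h. 2 * max 0 (r\<^sup>2 - (x - x0) \<bullet> (x - x0)) * (- 2 * (h \<bullet> (x - x0)))) = (\<lambda>h. h \<bullet> E x)"
      by (simp add: E_def fun_eq_iff)
    ultimately show ?thesis unfolding \<psi>_def[abs_def] by simp
  qed
  moreover have "continuous_on UNIV E" unfolding E_def by (intro continuous_intros)
  ultimately have C1: "C1_grad \<psi> E" by (simp add: C1_grad_def gderiv_def)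
  have sub: "closure {x. \<psi> x \<noteq> 0} \<subseteq> cball x0 r"
  proof (rule closure_minimal)
    show "{x. \<psi> x \<noteq> 0} \<subseteq> cball x0 r"
    proof
      fix x assume "x \<in> {x. \<psi> x \<noteq> 0}"
      then have "(x - x0) \<bullet> (x - x0) < r\<^sup>2" by (auto simp: \<psi>_def max_def split: if_splits)
      then have "(norm (x - x0))\<^sup>2 < r\<^sup>2" by (simp add: power2_norm_eq_inner)
      then have "norm (x - x0) < r" using r by (meson less_imp_le power_less_imp_less_base)
      then show "x \<in> cball x0 r" by (simp add: dist_norm norm_minus_commute)
    qed
  qed simp
  have comp: "compact (closure {x. \<psi> x \<noteq> 0})"
    using compact_Int_closed[OF compact_cball[of x0 r] closed_closure[of "{x. \<psi> x \<noteq> 0}"]] sub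
    by (simp add: Int_absorb1)
  have "\<psi> x > 0" if "x \<in> ball x0 r" for x
  proof -
    have "norm (x - x0) < r" using that by (simp add: dist_norm norm_minus_commute)
    then have "(norm (x - x0))\<^sup>2 < r\<^sup>2" by (intro power_strict_mono) auto
    then show ?thesis by (simp add: \<psi>_def power2_norm_eq_inner)
  qed
  then show ?thesis
    by (intro that[OF C1 comp _ _ r(1)]) (use sub r in \<open>auto simp: \<psi>_def\<close>)
qed

text \<open>The constant function gives the bound. If it were attained, constants would be
  eigenfunctions, and testing against a bump inside the domain would make the eigenvalue vanish.\<close>

theorem robin_eigenvalue_strict_upper_bound:
  assumes \<Omega>: "bounded_lipschitz_domain \<Omega>" and \<alpha>: "\<alpha> \<noteq> 0"
  shows "robin_eigenvalue 1 \<Omega> (\<alpha> / perimeter \<Omega>) * area \<Omega> < \<alpha>"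
proof -
  define \<beta> where "\<beta> = \<alpha> / perimeter \<Omega>"
  have L: "\<beta> * perimeter \<Omega> = \<alpha>" using perimeter_pos[OF \<Omega>] by (simp add: \<beta>_def)
  note facts = domain_facts[OF \<Omega>]
  have "robin_bottom \<Omega> \<beta> * area \<Omega> \<noteq> \<alpha>"
  proof
    assume eq: "robin_bottom \<Omega> \<beta> * area \<Omega> = \<alpha>"
    have one: "H1_grad_trace \<Omega> (\<lambda>_. 1) (\<lambda>_. 0) (\<lambda>_. 1)" by (rule C1_H1_grad_trace[OF \<Omega> C1_grad_const[OF \<Omega>]])
    have min: "robin_form \<Omega> \<beta> (\<lambda>_. 0) (\<lambda>_. 1) = robin_bottom \<Omega> \<beta> * mass \<Omega> (\<lambda>_. 1)"
      unfolding form_one[OF \<Omega>] mass_one[OF \<Omega>] L eq ..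
    obtain x0 where x0: "x0 \<in> \<Omega>" using facts(3) by blast
    obtain \<psi> E r where \<psi>: "C1_grad \<psi> E" "compact (closure {x. \<psi> x \<noteq> 0})" "closure {x. \<psi> x \<noteq> 0} \<subseteq> \<Omega>"
      "\<And>x. \<psi> x \<ge> 0" and r: "r > 0" "\<And>x. x \<in> ball x0 r \<Longrightarrow> \<psi> x > 0"
      by (rule bump_exists[OF facts(1) x0]) (rule that, assumption+)
    have off: "\<psi> x = 0" if "x \<notin> \<Omega>" for x using that \<psi>(3) closure_subset[of "{x. \<psi> x \<noteq> 0}"] by blast
    have "frontier \<Omega> \<inter> \<Omega> = {}" using facts(1) by (auto simp: frontier_def interior_open)
    then have "(LINT x:frontier \<Omega>|length_measure. 1 * \<psi> x) = (LINT x:frontier \<Omega>|length_measure. 0)"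
      unfolding set_lebesgue_integral_def using off by (intro Bochner_Integration.integral_cong) (auto split: split_indicator)
    moreover have "robin_bottom \<Omega> \<beta> \<noteq> 0" using eq \<alpha> by auto
    ultimately have "(LINT x:\<Omega>|lborel. 1 * \<psi> x) = 0"
      using minimal_weak_solution[OF \<Omega> one min C1_H1_grad_trace[OF \<Omega> \<psi>(1)]] by simp
    moreover have "(\<lambda>x. indicat_real \<Omega> x *\<^sub>R \<psi> x) = \<psi>" using off by (intro ext) (auto split: split_indicator)
    ultimately have "(\<integral>x. \<psi> x \<partial>lborel) = 0" by (simp add: set_lebesgue_integral_def)
    moreover have "integrable lborel \<psi>"
      by (rule integrable_compact_support[OF \<psi>(2) C1_gradD(3)[OF \<psi>(1)]]) (rule C1_grad_zero_off_support(1)[OF \<psi>(1)])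
    ultimately have "AE x in lborel. \<psi> x = 0" using \<psi>(4) by (subst (asm) integral_nonneg_eq_0_iff_AE) auto
    then have "AE x in lborel. x \<notin> ball x0 r" by eventually_elim (use r(2) in force)
    then have "emeasure lborel (ball x0 r) = 0" by (subst (asm) AE_iff_measurable[of "ball x0 r"]) auto
    then have "measure lborel (ball x0 r) = 0" by (simp add: measure_def)
    then show False using content_ball_pos[OF r(1), of x0] by linarith
  qed
  moreover have "robin_bottom \<Omega> \<beta> * area \<Omega> \<le> \<alpha>" using robin_bottom_le_one[OF \<Omega>, of \<beta>] unfolding L .
  ultimately show ?thesis unfolding robin_eigenvalue_eq_bottom[OF \<Omega>] \<beta>_def[symmetric] by simp
qed

section \<open>Rectangles\<close>

definition rect :: "real^2 \<Rightarrow> real^2 \<Rightarrow> real^2 \<Rightarrow> real \<Rightarrow> real \<Rightarrow> (real^2) set" where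
  "rect p e f a b = chart_box p e f (\<lambda>_. 0) {0<..<a} {0<..<b}"

lemma mem_rect: "x \<in> rect p e f a b \<longleftrightarrow> 0 < (x - p) \<bullet> e \<and> (x - p) \<bullet> e < a \<and> 0 < (x - p) \<bullet> f \<and> (x - p) \<bullet> f < b"
  by (auto simp: rect_def chart_box_def)

lemma open_rectangle_rect:
  assumes "open_rectangle R a b"
  obtains p e f where "orthoframe e f" "R = rect p e f a b"
proof -
  obtain p e f where o: "norm e = 1" "norm f = 1" "e \<bullet> f = 0"
    and R: "R = {p + s *\<^sub>R e + t *\<^sub>R f | s t. 0 < s \<and> s < a \<and> 0 < t \<and> t < b}"
    using assms unfolding open_rectangle_def by blast
  have ef: "orthoframe e f" using o by (simp add: orthoframe_def)
  have "R = rect p e f a b"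
    unfolding R rect_def chart_box_image[OF ef] by (auto simp: chart_def)
  with ef show ?thesis by (rule that)
qed

lemma rect_swap: "rect p e f a b = rect p f e b a"
  by (auto simp: mem_rect)

lemma orthoframe_swap: "orthoframe e f \<Longrightarrow> orthoframe f e"
  by (simp add: orthoframe_def inner_commute)

lemma orthoframe_flip: "orthoframe e f \<Longrightarrow> orthoframe (- e) f"
  by (simp add: orthoframe_def)

lemma rect_flip:
  assumes "orthoframe e f"
  shows "rect p e f a b = rect (p + a *\<^sub>R e) (- e) f a b"
proof -
  have "(x - (p + a *\<^sub>R e)) \<bullet> (- e) = a - (x - p) \<bullet> e" "(x - (p + a *\<^sub>R e)) \<bullet> f = (x - p) \<bullet> f" for x
    using orthoframe_inner[OF assms] by (simp_all add: inner_diff_left inner_add_left)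
  then show ?thesis unfolding set_eq_iff mem_rect by auto
qed

text \<open>The condition that a Lipschitz boundary imposes at a single point, so that the sides and corners
  of a rectangle can be handled by symmetry.\<close>

definition has_graph_chart :: "(real^2) set \<Rightarrow> real^2 \<Rightarrow> bool" where
  "has_graph_chart \<Omega> p \<longleftrightarrow> (\<exists>e f :: real^2. \<exists>r>0. \<exists>h>0. \<exists>\<gamma> :: real \<Rightarrow> real. \<exists>C.
        norm e = 1 \<and> norm f = 1 \<and> e \<bullet> f = 0 \<and> C-lipschitz_on UNIV \<gamma> \<and>
        (\<forall>s t. \<bar>s\<bar> < r \<longrightarrow> \<bar>t\<bar> < h \<longrightarrow> (p + s *\<^sub>R e + t *\<^sub>R f \<in> \<Omega> \<longleftrightarrow> \<gamma> s < t)))"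

text \<open>Along a side the boundary is a straight graph; at a corner it is the graph of the
  absolute value in the frame turned by half a right angle.\<close>

lemma rect_chart_bottom:
  assumes ef: "orthoframe e f" and ab: "a > 0" "b > 0"
    and x: "(x - p) \<bullet> f = 0" "0 \<le> (x - p) \<bullet> e" "(x - p) \<bullet> e < a"
  shows "has_graph_chart (rect p e f a b) x"
proof (cases "(x - p) \<bullet> e = 0")
  case False
  define s0 where "s0 = (x - p) \<bullet> e"
  have s0: "0 < s0" "s0 < a" using x False by (auto simp: s0_def)
  have co: "(x + s *\<^sub>R e + t *\<^sub>R f - p) \<bullet> e = s0 + s" "(x + s *\<^sub>R e + t *\<^sub>R f - p) \<bullet> f = t" for s t
    using x(1) orthoframe_inner[OF ef] by (simp_all add: s0_def inner_diff_left inner_add_left)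
  show ?thesis
    unfolding has_graph_chart_def
  proof (intro exI conjI allI impI)
    show "0 < min s0 (a - s0)" "0 < b" using s0 ab by auto
    show "norm e = 1" "norm f = 1" "e \<bullet> f = 0" using ef by (auto simp: orthoframe_def)
    show "0-lipschitz_on UNIV (\<lambda>_::real. 0::real)" by (rule lipschitz_on_constant)
    show "x + s *\<^sub>R e + t *\<^sub>R f \<in> rect p e f a b \<longleftrightarrow> 0 < t" if "\<bar>s\<bar> < min s0 (a - s0)" "\<bar>t\<bar> < b" for s t
      unfolding mem_rect co using that by auto
  qed
next
  case True
  have xp: "x = p" using orthoframe_expand[OF ef, of "x - p"] x(1) True by simp
  define k where "k = 1 / sqrt (2::real)"
  have k: "0 < k" "k \<le> 1" "k * k = 1 / 2" by (auto simp: k_def)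
  define e' f' where "e' = k *\<^sub>R (e - f)" "f' = k *\<^sub>R (e + f)"
  note def = this
  note ins = orthoframe_inner[OF ef]
  have co: "(x + s *\<^sub>R e' + t *\<^sub>R f' - p) \<bullet> e = k * (t + s)" "(x + s *\<^sub>R e' + t *\<^sub>R f' - p) \<bullet> f = k * (t - s)" for s t
    unfolding xp def by (simp_all add: inner_diff_left inner_add_left ins algebra_simps)
  have norms: "e' \<bullet> e' = 1" "f' \<bullet> f' = 1" "e' \<bullet> f' = 0"
    using k(3) by (simp_all add: def inner_diff_left inner_add_left inner_diff_right inner_add_right ins)
  define r where "r = min a b / 2"
  show ?thesis
    unfolding has_graph_chart_def
  proof (intro exI conjI allI impI)
    show "0 < r" using ab by (simp add: r_def)
    then show "0 < r" .
    show "norm e' = 1" "norm f' = 1" "e' \<bullet> f' = 0" using norms by (auto simp: norm_eq_1)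
    show "1-lipschitz_on UNIV (\<lambda>s::real. \<bar>s\<bar>)"
      by (rule lipschitz_onI) (auto simp: dist_real_def)
    show "x + s *\<^sub>R e' + t *\<^sub>R f' \<in> rect p e f a b \<longleftrightarrow> \<bar>s\<bar> < t" if "\<bar>s\<bar> < r" "\<bar>t\<bar> < r" for s t
    proof -
      have "\<bar>t + s\<bar> < min a b" "\<bar>t - s\<bar> < min a b" using that by (auto simp: r_def)
      moreover have "k * y < c" if "\<bar>y\<bar> < c" for y c :: real
      proof -
        have "k * y \<le> k * \<bar>y\<bar>" using k by (intro mult_left_mono) auto
        also have "\<dots> \<le> 1 * \<bar>y\<bar>" using k by (intro mult_right_mono) auto
        finally show ?thesis using that by simp
      qed
      ultimately have "k * (t + s) < a" "k * (t - s) < b" by auto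
      then show ?thesis unfolding mem_rect co using k(1) by (auto simp: zero_less_mult_iff)
    qed
  qed
qed

lemma frontier_rect_subset:
  assumes ef: "orthoframe e f" and x: "x \<in> frontier (rect p e f a b)"
  shows "0 \<le> (x - p) \<bullet> e" "(x - p) \<bullet> e \<le> a" "0 \<le> (x - p) \<bullet> f" "(x - p) \<bullet> f \<le> b"
    "(x - p) \<bullet> f = 0 \<or> (x - p) \<bullet> f = b \<or> (x - p) \<bullet> e = 0 \<or> (x - p) \<bullet> e = a"
proof -
  let ?K = "{x. 0 \<le> (x - p) \<bullet> e} \<inter> {x. (x - p) \<bullet> e \<le> a} \<inter> {x. 0 \<le> (x - p) \<bullet> f} \<inter> {x. (x - p) \<bullet> f \<le> b}"
  have "closed ?K" by (intro closed_Int closed_Collect_le continuous_intros)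
  then have "closure (rect p e f a b) \<subseteq> ?K" by (rule closure_minimal[rotated]) (auto simp: mem_rect)
  moreover have "open (rect p e f a b)" unfolding rect_def by (rule open_chart_box) auto
  ultimately have K: "x \<in> ?K" and n: "x \<notin> rect p e f a b" using x by (auto simp: frontier_def interior_open)
  then show "0 \<le> (x - p) \<bullet> e" "(x - p) \<bullet> e \<le> a" "0 \<le> (x - p) \<bullet> f" "(x - p) \<bullet> f \<le> b" by auto
  show "(x - p) \<bullet> f = 0 \<or> (x - p) \<bullet> f = b \<or> (x - p) \<bullet> e = 0 \<or> (x - p) \<bullet> e = a"
    using K n by (auto simp: mem_rect)
qed

lemma rect_lipschitz_domain:
  assumes ef: "orthoframe e f" and ab: "a > 0" "b > 0"
  shows "bounded_lipschitz_domain (rect p e f a b)"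
proof -
  let ?R = "rect p e f a b"
  have op: "open ?R" unfolding rect_def by (rule open_chart_box) auto
  have "p + (a/2) *\<^sub>R e + (b/2) *\<^sub>R f \<in> ?R"
    using ab orthoframe_inner[OF ef] by (simp add: mem_rect inner_add_left)
  then have ne: "?R \<noteq> {}" by blast
  have "?R = {x. e \<bullet> x > e \<bullet> p} \<inter> {x. e \<bullet> x < e \<bullet> p + a} \<inter> {x. f \<bullet> x > f \<bullet> p} \<inter> {x. f \<bullet> x < f \<bullet> p + b}"
    by (auto simp: mem_rect inner_diff_left inner_commute[of e] inner_commute[of f])
  then have "convex ?R"
    by (simp only: convex_Int convex_halfspace_gt convex_halfspace_lt)
  then have conn: "connected ?R" by (rule convex_connected)
  have bdd: "bounded ?R"
    unfolding bounded_iff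
  proof (intro exI ballI)
    fix x assume x: "x \<in> ?R"
    have "norm (x - p) = norm (((x - p) \<bullet> e) *\<^sub>R e + ((x - p) \<bullet> f) *\<^sub>R f)" by (simp only: orthoframe_expand[OF ef])
    also have "\<dots> \<le> \<bar>(x - p) \<bullet> e\<bar> + \<bar>(x - p) \<bullet> f\<bar>"
      using norm_triangle_ineq[of "((x - p) \<bullet> e) *\<^sub>R e" "((x - p) \<bullet> f) *\<^sub>R f"] ef by (simp add: orthoframe_def)
    also have "\<dots> \<le> a + b" using x by (auto simp: mem_rect)
    finally show "norm x \<le> norm p + (a + b)" using norm_triangle_sub[of x p] by linarith
  qed
  have "has_graph_chart ?R x" if x: "x \<in> frontier ?R" for x
  proof -
    note F = frontier_rect_subset[OF ef x]
    have *: "has_graph_chart (rect p e f a b) x"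
      if ef: "orthoframe e f" and ab: "a > 0" "b > 0" and x: "(x - p) \<bullet> f = 0" "0 \<le> (x - p) \<bullet> e" "(x - p) \<bullet> e \<le> a"
      for p e f a b
    proof (cases "(x - p) \<bullet> e < a")
      case True
      then show ?thesis using rect_chart_bottom[OF ef ab x(1,2)] by simp
    next
      case False
      then have "(x - p) \<bullet> e = a" using x by simp
      then show ?thesis
        unfolding rect_flip[OF ef]
        using orthoframe_inner[OF ef] x ab
        by (intro rect_chart_bottom orthoframe_flip ef) (simp_all add: inner_diff_left inner_add_left)
    qed
    note co = orthoframe_inner[OF ef]
    from F(5) show ?thesis
    proof (elim disjE)
      assume "(x - p) \<bullet> f = 0"
      then show ?thesis using F by (intro * ef ab) auto
    next
      assume top: "(x - p) \<bullet> f = b"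
      have shift: "(x - (p + b *\<^sub>R f)) \<bullet> v = (x - p) \<bullet> v - b * (f \<bullet> v)" for v
        by (simp add: inner_diff_left inner_add_left)
      have "has_graph_chart (rect (p + b *\<^sub>R f) e (- f) a b) x"
        by (rule *[OF orthoframe_swap[OF orthoframe_flip[OF orthoframe_swap[OF ef]]] ab])
          (use top F(1,2) in \<open>simp_all add: shift co\<close>)
      moreover have "?R = rect (p + b *\<^sub>R f) e (- f) a b"
        by (rule trans[OF rect_swap[of p e f a b] trans[OF rect_flip[OF orthoframe_swap[OF ef], of p b a] rect_swap]])
      ultimately show ?thesis by simp
    next
      assume left: "(x - p) \<bullet> e = 0"
      show ?thesis
        unfolding rect_swap[of p e f] by (rule *[OF orthoframe_swap[OF ef] ab(2,1) left F(3,4)])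
    next
      assume right: "(x - p) \<bullet> e = a"
      have shift: "(x - (p + a *\<^sub>R e)) \<bullet> v = (x - p) \<bullet> v - a * (e \<bullet> v)" for v
        by (simp add: inner_diff_left inner_add_left)
      have "has_graph_chart (rect (p + a *\<^sub>R e) f (- e) b a) x"
        by (rule *[OF orthoframe_swap[OF orthoframe_flip[OF ef]] ab(2,1)])
          (use right F(3,4) in \<open>simp_all add: shift co\<close>)
      moreover have "?R = rect (p + a *\<^sub>R e) f (- e) b a"
        by (rule trans[OF rect_flip[OF ef] rect_swap])
      ultimately show ?thesis by simp
    qed
  qed
  then show ?thesis
    using op conn ne bdd unfolding bounded_lipschitz_domain_def lipschitz_boundary_def has_graph_chart_def by blast
qed

lemma area_rect:
  assumes ef: "orthoframe e f" and ab: "a > 0" "b > 0"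
  shows "area (rect p e f a b) = a * b"
proof -
  have "emeasure lborel (rect p e f a b) = (\<integral>\<^sup>+x\<in>rect p e f a b. 1 \<partial>lborel)" by (simp add: rect_def)
  also have "\<dots> = ennreal (a * b)"
    unfolding rect_def
    by (subst nn_integral_chart_box[OF ef])
       (use ab in \<open>auto simp: nn_integral_cmult_indicator ennreal_mult[symmetric] mult.commute\<close>)
  finally show ?thesis using ab by (simp add: area_def measure_def)
qed

lemma nn_integral_Icc_Ioo:
  fixes F :: "real \<Rightarrow> ennreal"
  shows "(\<integral>\<^sup>+s\<in>{a..b}. F s \<partial>lborel) = (\<integral>\<^sup>+s\<in>{a<..<b}. F s \<partial>lborel)"
proof (rule nn_integral_cong_AE)
  show "AE s in lborel. F s * indicator {a..b} s = F s * indicator {a<..<b} s"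
    using AE_lborel_singleton[of a] AE_lborel_singleton[of b]
    by eventually_elim (auto split: split_indicator)
qed

context
  fixes p e f :: "real^2" and a b :: real
  assumes ef: "orthoframe e f" and ab: "a > 0" "b > 0"
begin

abbreviation "rect_pt s t \<equiv> chart p e f (\<lambda>_. 0) s t"

lemma rect_param: "(rect_pt s t - p) \<bullet> e = s" "(rect_pt s t - p) \<bullet> f = t"
  using chart_coords[OF ef, of p "\<lambda>_. 0" s t] by simp_all

lemma dist_sides: "dist (rect_pt s t) (rect_pt s' t) = \<bar>s - s'\<bar>" "dist (rect_pt s t) (rect_pt s t') = \<bar>t - t'\<bar>"
proof -
  have "rect_pt s t - rect_pt s' t = (s - s') *\<^sub>R e" "rect_pt s t - rect_pt s t' = (t - t') *\<^sub>R f" by (simp_all add: chart_def algebra_simps)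
  then show "dist (rect_pt s t) (rect_pt s' t) = \<bar>s - s'\<bar>" "dist (rect_pt s t) (rect_pt s t') = \<bar>t - t'\<bar>"
    using ef by (simp_all add: dist_norm orthoframe_def)
qed

lemma long_side_in_frontier:
  assumes s: "0 < s" "s < a" and t: "t = 0 \<or> t = b"
  shows "rect_pt s t \<in> frontier (rect p e f a b)"
proof -
  have n: "rect_pt s t \<notin> rect p e f a b" using t ab by (auto simp: mem_rect rect_param)
  have "rect_pt s t \<in> closure (rect p e f a b)"
    unfolding closure_approachable
  proof (intro allI impI)
    fix \<epsilon> :: real assume \<epsilon>: "\<epsilon> > 0"
    define d where "d = min (\<epsilon> / 2) (b / 2)"
    have d: "0 < d" "d < \<epsilon>" "d < b" using \<epsilon> ab by (auto simp: d_def)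
    define t' where "t' = (if t = 0 then d else b - d)"
    have "rect_pt s t' \<in> rect p e f a b" using s d by (auto simp: mem_rect rect_param t'_def)
    moreover have "dist (rect_pt s t') (rect_pt s t) < \<epsilon>" unfolding dist_sides using t d by (auto simp: t'_def)
    ultimately show "\<exists>y\<in>rect p e f a b. dist y (rect_pt s t) < \<epsilon>" by blast
  qed
  then show ?thesis using n interior_subset by (auto simp: frontier_def)
qed

lemma frontier_rect_integral_ge:
  assumes [measurable]: "F \<in> borel_measurable borel"
  shows "(\<integral>\<^sup>+s\<in>{0<..<a}. F (rect_pt s 0) \<partial>lborel) + (\<integral>\<^sup>+s\<in>{0<..<a}. F (rect_pt s b) \<partial>lborel)
    \<le> (\<integral>\<^sup>+x\<in>frontier (rect p e f a b). F x \<partial>length_measure)"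
proof -
  let ?\<Gamma> = "\<lambda>t. frontier (rect p e f a b) \<inter> {x. (x - p) \<bullet> f = t}"
  have m[measurable]: "?\<Gamma> t \<in> sets borel" for t
    by (intro borel_closed closed_Int frontier_closed closed_Collect_eq continuous_intros)
  have side: "(\<integral>\<^sup>+s\<in>{0<..<a}. F (rect_pt s t) \<partial>lborel) \<le> (\<integral>\<^sup>+x\<in>?\<Gamma> t. F x \<partial>length_measure)" if "t = 0 \<or> t = b" for t
    by (rule nn_integral_param_le_length)
       (use that long_side_in_frontier m in \<open>auto simp: dist_sides dist_real_def rect_param\<close>)
  have "(\<integral>\<^sup>+s\<in>{0<..<a}. F (rect_pt s 0) \<partial>lborel) + (\<integral>\<^sup>+s\<in>{0<..<a}. F (rect_pt s b) \<partial>lborel)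
      \<le> (\<integral>\<^sup>+x\<in>?\<Gamma> 0. F x \<partial>length_measure) + (\<integral>\<^sup>+x\<in>?\<Gamma> b. F x \<partial>length_measure)"
    by (intro add_mono side) auto
  also have "\<dots> = (\<integral>\<^sup>+x. F x * indicator (?\<Gamma> 0) x + F x * indicator (?\<Gamma> b) x \<partial>length_measure)"
    by (rule nn_integral_add[symmetric]) auto
  also have "\<dots> \<le> (\<integral>\<^sup>+x\<in>frontier (rect p e f a b). F x \<partial>length_measure)"
    using ab by (intro nn_integral_mono) (auto split: split_indicator)
  finally show ?thesis .
qed

lemma frontier_rect_integral_le:
  assumes [measurable]: "F \<in> borel_measurable borel"
  shows "(\<integral>\<^sup>+x\<in>frontier (rect p e f a b). F x \<partial>length_measure)
    \<le> ((\<integral>\<^sup>+s\<in>{0<..<a}. F (rect_pt s 0) \<partial>lborel) + (\<integral>\<^sup>+s\<in>{0<..<a}. F (rect_pt s b) \<partial>lborel))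
      + ((\<integral>\<^sup>+t\<in>{0<..<b}. F (rect_pt 0 t) \<partial>lborel) + (\<integral>\<^sup>+t\<in>{0<..<b}. F (rect_pt a t) \<partial>lborel))"
proof -
  let ?F = "frontier (rect p e f a b)"
  let ?A = "\<lambda>t. ?F \<inter> {x. (x - p) \<bullet> f = t}" and ?B = "\<lambda>s. ?F \<inter> {x. (x - p) \<bullet> e = s}"
  have mA[measurable]: "?A t \<in> sets borel" "?B t \<in> sets borel" for t
    by (intro borel_closed closed_Int frontier_closed closed_Collect_eq continuous_intros)+
  have inv: "x = rect_pt ((x - p) \<bullet> e) ((x - p) \<bullet> f)" for x
    using chart_inverse[OF ef, of p "\<lambda>_. 0" x] by simp
  have A: "(\<integral>\<^sup>+x\<in>?A t. F x \<partial>length_measure) \<le> (\<integral>\<^sup>+s\<in>{0<..<a}. F (rect_pt s t) \<partial>lborel)" for t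
  proof -
    have "(\<integral>\<^sup>+x\<in>?A t. F x \<partial>length_measure) \<le> ennreal 1 * (\<integral>\<^sup>+s\<in>{0..a}. F (rect_pt s t) \<partial>lborel)"
    proof (rule nn_integral_length_le_param)
      show "?A t \<subseteq> (\<lambda>s. rect_pt s t) ` {0..a}"
      proof
        fix x assume x: "x \<in> ?A t"
        then have "x = rect_pt ((x - p) \<bullet> e) t" using inv[of x] by simp
        then show "x \<in> (\<lambda>s. rect_pt s t) ` {0..a}" using frontier_rect_subset(1,2)[OF ef, of x p a b] x by auto
      qed
    qed (auto simp: dist_sides dist_real_def)
    then show ?thesis by (simp add: nn_integral_Icc_Ioo)
  qed
  have B: "(\<integral>\<^sup>+x\<in>?B s. F x \<partial>length_measure) \<le> (\<integral>\<^sup>+t\<in>{0<..<b}. F (rect_pt s t) \<partial>lborel)" for s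
  proof -
    have "(\<integral>\<^sup>+x\<in>?B s. F x \<partial>length_measure) \<le> ennreal 1 * (\<integral>\<^sup>+t\<in>{0..b}. F (rect_pt s t) \<partial>lborel)"
    proof (rule nn_integral_length_le_param)
      show "?B s \<subseteq> (\<lambda>t. rect_pt s t) ` {0..b}"
      proof
        fix x assume x: "x \<in> ?B s"
        then have "x = rect_pt s ((x - p) \<bullet> f)" using inv[of x] by simp
        then show "x \<in> (\<lambda>t. rect_pt s t) ` {0..b}" using frontier_rect_subset(3,4)[OF ef, of x p a b] x by auto
      qed
    qed (auto simp: dist_sides dist_real_def)
    then show ?thesis by (simp add: nn_integral_Icc_Ioo)
  qed
  have "(\<integral>\<^sup>+x\<in>?F. F x \<partial>length_measure)
      \<le> (\<integral>\<^sup>+x. (F x * indicator (?A 0) x + F x * indicator (?A b) x) + (F x * indicator (?B 0) x + F x * indicator (?B a) x) \<partial>length_measure)"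
  proof (intro nn_integral_mono)
    fix x
    show "F x * indicator ?F x \<le> (F x * indicator (?A 0) x + F x * indicator (?A b) x) + (F x * indicator (?B 0) x + F x * indicator (?B a) x)"
    proof (cases "x \<in> ?F")
      case True
      show ?thesis
        using frontier_rect_subset(5)[OF ef True] True
        by (elim disjE) (auto simp: add_increasing add_increasing2)
    qed simp
  qed
  also have "\<dots> = ((\<integral>\<^sup>+x\<in>?A 0. F x \<partial>length_measure) + (\<integral>\<^sup>+x\<in>?A b. F x \<partial>length_measure))
      + ((\<integral>\<^sup>+x\<in>?B 0. F x \<partial>length_measure) + (\<integral>\<^sup>+x\<in>?B a. F x \<partial>length_measure))"
    by (simp add: nn_integral_add)
  also have "\<dots> \<le> ((\<integral>\<^sup>+s\<in>{0<..<a}. F (rect_pt s 0) \<partial>lborel) + (\<integral>\<^sup>+s\<in>{0<..<a}. F (rect_pt s b) \<partial>lborel))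
      + ((\<integral>\<^sup>+t\<in>{0<..<b}. F (rect_pt 0 t) \<partial>lborel) + (\<integral>\<^sup>+t\<in>{0<..<b}. F (rect_pt a t) \<partial>lborel))"
    by (intro add_mono A B)
  finally show ?thesis .
qed

text \<open>The long sides alone bound the perimeter from below. The gap of \<open>2 * b\<close> between the bounds
  disappears relative to \<open>a\<close> in the limit of thin rectangles.\<close>

lemma perimeter_rect_bounds: "2 * a \<le> perimeter (rect p e f a b)" "perimeter (rect p e f a b) \<le> 2 * (a + b)"
proof -
  let ?L = "emeasure length_measure (frontier (rect p e f a b))"
  have L: "?L = (\<integral>\<^sup>+x\<in>frontier (rect p e f a b). 1 \<partial>length_measure)" by simp
  have fin: "?L < \<infinity>" by (rule frontier_length_finite[OF rect_lipschitz_domain[OF ef ab]])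
  then have P: "ennreal (perimeter (rect p e f a b)) = ?L" by (simp add: perimeter_def emeasure_eq_ennreal_measure less_top)
  have "ennreal a + ennreal a \<le> ?L"
    using frontier_rect_integral_ge[of "\<lambda>_. 1"] ab unfolding L by simp
  then have "ennreal (2 * a) \<le> ennreal (perimeter (rect p e f a b))"
    unfolding P using ab by (simp add: ennreal_plus[symmetric] del: ennreal_plus)
  then show "2 * a \<le> perimeter (rect p e f a b)" by (simp add: perimeter_def)
  have "?L \<le> (ennreal a + ennreal a) + (ennreal b + ennreal b)"
    using frontier_rect_integral_le[of "\<lambda>_. 1"] ab unfolding L by simp
  also have "\<dots> = ennreal ((a + a) + (b + b))"
    by (simp only: ennreal_plus add_nonneg_nonneg less_imp_le[OF ab(1)] less_imp_le[OF ab(2)])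
  finally have "ennreal (perimeter (rect p e f a b)) \<le> ennreal ((a + a) + (b + b))" unfolding P .
  then have "perimeter (rect p e f a b) \<le> (a + a) + (b + b)" by (subst (asm) ennreal_le_iff) (use ab in auto)
  then show "perimeter (rect p e f a b) \<le> 2 * (a + b)" using ab by simp
qed

text \<open>The energy is split by direction, because each side is controlled by the derivative
  perpendicular to it.\<close>

context
  fixes \<phi> :: "real^2 \<Rightarrow> real" and D :: "real^2 \<Rightarrow> real^2"
  assumes C1: "C1_grad \<phi> D"
begin

abbreviation "the_rect \<equiv> rect p e f a b"

lemma dom: "bounded_lipschitz_domain the_rect"
  by (rule rect_lipschitz_domain[OF ef ab])

lemma C1_components:
  assumes "norm v = 1"
  shows "square_integrable_on lborel the_rect (\<lambda>x. D x \<bullet> v)"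
proof -
  note F = domain_facts[OF dom]
  show ?thesis
    by (rule continuous_bounded_set_finite_sq[OF sets_lborel F(7) F(2) F(4)])
       (intro continuous_on_inner C1_gradD(2)[OF C1] continuous_on_const)
qed

definition partial_energy :: "real^2 \<Rightarrow> real" where
  "partial_energy v = (LINT x:the_rect|lborel. (norm (D x \<bullet> v))\<^sup>2)"

lemma partial_energy_nonneg: "partial_energy v \<ge> 0"
  unfolding partial_energy_def set_integral_norm_L2
  by (rule Bochner_Integration.integral_nonneg) (rule zero_le_power2)

lemma nn_partial_energy:
  assumes "norm v = 1"
  shows "(\<integral>\<^sup>+x\<in>the_rect. ennreal ((D x \<bullet> v)\<^sup>2) \<partial>lborel) = ennreal (partial_energy v)"
  using nn_integral_set_sq[OF C1_components[OF assms]] by (simp add: partial_energy_def)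

lemma dirichlet_split: "dirichlet the_rect D = partial_energy e + partial_energy f"
proof -
  have n: "norm e = 1" "norm f = 1" using ef by (auto simp: orthoframe_def)
  have i: "set_integrable lborel the_rect (\<lambda>x. (norm (D x \<bullet> v))\<^sup>2)" if "norm v = 1" for v
    by (rule conjunct2[OF C1_components[OF that, unfolded square_integrable_on_def]])
  have "dirichlet the_rect D = (LINT x:the_rect|lborel. (norm (D x \<bullet> e))\<^sup>2 + (norm (D x \<bullet> f))\<^sup>2)"
    unfolding dirichlet_def[OF dom] by (simp add: norm_orthoframe[OF ef])
  then show ?thesis
    unfolding partial_energy_def using set_integral_add(2)[OF i[OF n(1)] i[OF n(2)]] by simp
qed

definition side :: "(real \<Rightarrow> real^2) \<Rightarrow> real \<Rightarrow> real" where
  "side T c = enn2real (\<integral>\<^sup>+s\<in>{0<..<c}. ennreal ((\<phi> (T s))\<^sup>2) \<partial>lborel)"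

lemma side_nonneg: "side T c \<ge> 0"
  by (simp add: side_def)

lemma nn_mass: "(\<integral>\<^sup>+x\<in>the_rect. ennreal ((\<phi> x)\<^sup>2) \<partial>lborel) = ennreal (mass the_rect \<phi>)"
  using nn_integral_set_sq[OF C1_square_integrable(1)[OF dom C1]] by (simp add: mass_def[OF dom])

lemma nn_boundary_mass: "(\<integral>\<^sup>+x\<in>frontier the_rect. ennreal ((\<phi> x)\<^sup>2) \<partial>length_measure) = ennreal (boundary_mass the_rect \<phi>)"
  using nn_integral_set_sq[OF C1_square_integrable(3)[OF dom C1]]
  by (simp add: boundary_mass_def[OF dom])

text \<open>Finiteness is part of the claim because \<open>side\<close> is a real number, which would be zero for an
  infinite integral.\<close>

lemma trace_on_side:
  assumes fr: "orthoframe e' f'" and l: "l > 0" and y: "y \<in> {0..l}" and \<kappa>: "\<kappa> > 0"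
    and sub: "chart_box q e' f' (\<lambda>_. 0) {0<..<c} {0<..<l} \<subseteq> the_rect"
  shows "(\<integral>\<^sup>+s\<in>{0<..<c}. ennreal ((\<phi> (chart q e' f' (\<lambda>_. 0) s y))\<^sup>2) \<partial>lborel) < \<infinity>"
    and "side (\<lambda>s. chart q e' f' (\<lambda>_. 0) s y) c
      \<le> (1 + \<kappa>) / l * mass the_rect \<phi> + (1 + 1 / \<kappa>) * l * partial_energy f'"
proof -
  let ?S = "\<integral>\<^sup>+s\<in>{0<..<c}. ennreal ((\<phi> (chart q e' f' (\<lambda>_. 0) s y))\<^sup>2) \<partial>lborel"
  let ?B = "(1 + \<kappa>) / l * mass the_rect \<phi> + (1 + 1 / \<kappa>) * l * partial_energy f'"
  note nn = masses_nonneg(1)[OF dom, of \<phi>] partial_energy_nonneg[of f']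
  have n: "norm f' = 1" using fr by (simp add: orthoframe_def)
  have "?S \<le> ennreal ((1 + \<kappa>) / l) * (\<integral>\<^sup>+x\<in>chart_box q e' f' (\<lambda>_. 0) {0<..<c} {0<..<l}. ennreal ((\<phi> x)\<^sup>2) \<partial>lborel)
      + ennreal ((1 + 1 / \<kappa>) * l) * (\<integral>\<^sup>+x\<in>chart_box q e' f' (\<lambda>_. 0) {0<..<c} {0<..<l}. ennreal ((D x \<bullet> f')\<^sup>2) \<partial>lborel)"
    by (rule chart_trace[OF fr _ _ l C1 y \<kappa>]) auto
  also have "\<dots> \<le> ennreal ((1 + \<kappa>) / l) * (\<integral>\<^sup>+x\<in>the_rect. ennreal ((\<phi> x)\<^sup>2) \<partial>lborel)
      + ennreal ((1 + 1 / \<kappa>) * l) * (\<integral>\<^sup>+x\<in>the_rect. ennreal ((D x \<bullet> f')\<^sup>2) \<partial>lborel)"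
    using sub by (intro add_mono mult_left_mono nn_integral_mono_set) auto
  also have "\<dots> = ennreal ?B"
    unfolding nn_mass nn_partial_energy[OF n] using l \<kappa> nn
    by (simp add: ennreal_mult[symmetric] ennreal_plus[symmetric] del: ennreal_plus)
  finally have le: "?S \<le> ennreal ?B" .
  then show "?S < \<infinity>" using le_less_trans[OF le, of \<infinity>] by simp
  have "?B \<ge> 0" using l \<kappa> nn by simp
  then show "side (\<lambda>s. chart q e' f' (\<lambda>_. 0) s y) c \<le> ?B"
    unfolding side_def using le by (simp add: enn2real_leI)
qed

lemma rect_as_box: "the_rect = chart_box p e f (\<lambda>_. 0) {0<..<a} {0<..<b}"
  by (simp add: rect_def)

lemma long_side:
  assumes t: "t \<in> {0..b}" and \<kappa>: "\<kappa> > 0"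
  shows "(\<integral>\<^sup>+s\<in>{0<..<a}. ennreal ((\<phi> (rect_pt s t))\<^sup>2) \<partial>lborel) < \<infinity>"
    and "side (\<lambda>s. rect_pt s t) a \<le> (1 + \<kappa>) / b * mass the_rect \<phi> + (1 + 1 / \<kappa>) * b * partial_energy f"
    and "mass the_rect \<phi> \<le> (1 + \<kappa>) * b * side (\<lambda>s. rect_pt s t) a + (1 + 1 / \<kappa>) * b\<^sup>2 * partial_energy f"
proof -
  have sub: "chart_box p e f (\<lambda>_. 0) {0<..<a} {0<..<b} \<subseteq> the_rect" by (simp add: rect_def)
  show fin: "(\<integral>\<^sup>+s\<in>{0<..<a}. ennreal ((\<phi> (rect_pt s t))\<^sup>2) \<partial>lborel) < \<infinity>"
    and "side (\<lambda>s. rect_pt s t) a \<le> (1 + \<kappa>) / b * mass the_rect \<phi> + (1 + 1 / \<kappa>) * b * partial_energy f"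
    using trace_on_side[OF ef ab(2) t \<kappa> sub] by auto
  have n: "norm f = 1" using ef by (simp add: orthoframe_def)
  note nn = side_nonneg[of "\<lambda>s. rect_pt s t" a] partial_energy_nonneg[of f]
  have "(\<integral>\<^sup>+x\<in>chart_box p e f (\<lambda>_. 0) {0<..<a} {0<..<b}. ennreal ((\<phi> x)\<^sup>2) \<partial>lborel)
    \<le> ennreal ((1 + \<kappa>) * b) * (\<integral>\<^sup>+s\<in>{0<..<a}. ennreal ((\<phi> (rect_pt s t))\<^sup>2) \<partial>lborel)
      + ennreal ((1 + 1 / \<kappa>) * b\<^sup>2) * (\<integral>\<^sup>+x\<in>chart_box p e f (\<lambda>_. 0) {0<..<a} {0<..<b}. ennreal ((D x \<bullet> f)\<^sup>2) \<partial>lborel)"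
    by (rule chart_norm[OF ef _ _ ab(2) C1 t \<kappa>]) auto
  also have "(\<integral>\<^sup>+s\<in>{0<..<a}. ennreal ((\<phi> (rect_pt s t))\<^sup>2) \<partial>lborel) = ennreal (side (\<lambda>s. rect_pt s t) a)"
    unfolding side_def using fin by simp
  finally have "ennreal (mass the_rect \<phi>) \<le> ennreal ((1 + \<kappa>) * b * side (\<lambda>s. rect_pt s t) a + (1 + 1 / \<kappa>) * b\<^sup>2 * partial_energy f)"
    unfolding rect_as_box[symmetric] nn_mass nn_partial_energy[OF n] using ab \<kappa> nn
    by (simp add: ennreal_mult[symmetric] ennreal_plus[symmetric] del: ennreal_plus)
  then show "mass the_rect \<phi> \<le> (1 + \<kappa>) * b * side (\<lambda>s. rect_pt s t) a + (1 + 1 / \<kappa>) * b\<^sup>2 * partial_energy f"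
    by (subst (asm) ennreal_le_iff) (use ab \<kappa> nn in auto)
qed

text \<open>The layer along a short side may have any width \<open>l\<close> up to \<open>a\<close>, and \<open>\<kappa> = 1\<close> is good enough: the
  short sides only matter to lower order.\<close>

lemma short_sides:
  assumes l: "0 < l" "l \<le> a"
  shows "(\<integral>\<^sup>+t\<in>{0<..<b}. ennreal ((\<phi> (rect_pt 0 t))\<^sup>2) \<partial>lborel) < \<infinity>"
    "(\<integral>\<^sup>+t\<in>{0<..<b}. ennreal ((\<phi> (rect_pt a t))\<^sup>2) \<partial>lborel) < \<infinity>"
    "side (\<lambda>t. rect_pt 0 t) b \<le> 2 / l * mass the_rect \<phi> + 2 * l * partial_energy e"
    "side (\<lambda>t. rect_pt a t) b \<le> 2 / l * mass the_rect \<phi> + 2 * l * partial_energy e"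
proof -
  have 0: "rect_pt 0 t = chart p f e (\<lambda>_. 0) t 0" for t by (simp add: chart_def)
  have a: "rect_pt a t = chart (p + a *\<^sub>R e) f (- e) (\<lambda>_. 0) t 0" for t by (simp add: chart_def)
  have sub0: "chart_box p f e (\<lambda>_. 0) {0<..<b} {0<..<l} \<subseteq> the_rect"
    using l by (auto simp: rect_def chart_box_def)
  have suba: "chart_box (p + a *\<^sub>R e) f (- e) (\<lambda>_. 0) {0<..<b} {0<..<l} \<subseteq> the_rect"
    unfolding rect_flip[OF ef] using l by (auto simp: rect_def chart_box_def)
  have y: "0 \<in> {0..l}" using l by simp
  have pe: "partial_energy (- e) = partial_energy e" by (simp add: partial_energy_def)
  note T0 = trace_on_side[OF orthoframe_swap[OF ef] l(1) y zero_less_one sub0]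
  note Ta = trace_on_side[OF orthoframe_swap[OF orthoframe_flip[OF ef]] l(1) y zero_less_one suba]
  show "(\<integral>\<^sup>+t\<in>{0<..<b}. ennreal ((\<phi> (rect_pt 0 t))\<^sup>2) \<partial>lborel) < \<infinity>" unfolding 0 by (rule T0(1))
  show "(\<integral>\<^sup>+t\<in>{0<..<b}. ennreal ((\<phi> (rect_pt a t))\<^sup>2) \<partial>lborel) < \<infinity>" unfolding a by (rule Ta(1))
  show "side (\<lambda>t. rect_pt 0 t) b \<le> 2 / l * mass the_rect \<phi> + 2 * l * partial_energy e"
    unfolding 0 using T0(2) by simp
  show "side (\<lambda>t. rect_pt a t) b \<le> 2 / l * mass the_rect \<phi> + 2 * l * partial_energy e"
    unfolding a using Ta(2) by (simp add: pe)
qed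

lemma boundary_mass_ge_long_sides: "side (\<lambda>s. rect_pt s 0) a + side (\<lambda>s. rect_pt s b) a \<le> boundary_mass the_rect \<phi>"
proof -
  note [measurable] = C1_grad_measurable(1)[OF C1]
  have "ennreal (side (\<lambda>s. rect_pt s 0) a) + ennreal (side (\<lambda>s. rect_pt s b) a) \<le> ennreal (boundary_mass the_rect \<phi>)"
    using frontier_rect_integral_ge[of "\<lambda>x. ennreal ((\<phi> x)\<^sup>2)"] long_side(1)[of 0 1] long_side(1)[of b 1] ab
    by (simp add: side_def nn_boundary_mass)
  then have "ennreal (side (\<lambda>s. rect_pt s 0) a + side (\<lambda>s. rect_pt s b) a) \<le> ennreal (boundary_mass the_rect \<phi>)"
    by (simp add: side_nonneg)
  then show ?thesis
    by (subst (asm) ennreal_le_iff) (rule masses_nonneg(3)[OF dom])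
qed

lemma boundary_mass_le_sides:
  "boundary_mass the_rect \<phi> \<le> (side (\<lambda>s. rect_pt s 0) a + side (\<lambda>s. rect_pt s b) a) + (side (\<lambda>t. rect_pt 0 t) b + side (\<lambda>t. rect_pt a t) b)"
proof -
  note [measurable] = C1_grad_measurable(1)[OF C1]
  have "ennreal (boundary_mass the_rect \<phi>) \<le> (ennreal (side (\<lambda>s. rect_pt s 0) a) + ennreal (side (\<lambda>s. rect_pt s b) a))
      + (ennreal (side (\<lambda>t. rect_pt 0 t) b) + ennreal (side (\<lambda>t. rect_pt a t) b))"
    using frontier_rect_integral_le[of "\<lambda>x. ennreal ((\<phi> x)\<^sup>2)"] long_side(1)[of 0 1] long_side(1)[of b 1]
      short_sides(1,2)[OF ab(1) order_refl] ab
    by (simp add: side_def nn_boundary_mass)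
  then have "ennreal (boundary_mass the_rect \<phi>) \<le> ennreal ((side (\<lambda>s. rect_pt s 0) a + side (\<lambda>s. rect_pt s b) a)
      + (side (\<lambda>t. rect_pt 0 t) b + side (\<lambda>t. rect_pt a t) b))"
    by (simp add: side_nonneg)
  then show ?thesis by (subst (asm) ennreal_le_iff) (simp_all add: side_nonneg)
qed

text \<open>For a positive parameter only the long sides are kept; the weight \<open>\<kappa> = 2 \<beta> b\<close> makes the
  gradient term exactly absorbable.\<close>

lemma form_ge_pos:
  assumes \<beta>: "\<beta> > 0"
  shows "2 * \<beta> / (b * (1 + 2 * \<beta> * b)) * mass the_rect \<phi> \<le> robin_form the_rect \<beta> D \<phi>"
proof -
  define \<kappa> where "\<kappa> = 2 * \<beta> * b"
  have \<kappa>: "\<kappa> > 0" using \<beta> ab by (simp add: \<kappa>_def)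
  define m where "m = 2 * \<beta> / (b * (1 + \<kappa>))"
  have m: "m > 0" using \<beta> ab \<kappa> by (simp add: m_def)
  have "2 * mass the_rect \<phi> \<le> (1 + \<kappa>) * b * (side (\<lambda>s. rect_pt s 0) a + side (\<lambda>s. rect_pt s b) a) + 2 * ((1 + 1 / \<kappa>) * b\<^sup>2) * partial_energy f"
    using long_side(3)[of 0 \<kappa>] long_side(3)[of b \<kappa>] \<kappa> ab by (simp add: distrib_left)
  also have "\<dots> \<le> (1 + \<kappa>) * b * boundary_mass the_rect \<phi> + 2 * ((1 + 1 / \<kappa>) * b\<^sup>2) * dirichlet the_rect D"
    using boundary_mass_ge_long_sides dirichlet_split partial_energy_nonneg[of e] \<kappa> ab
    by (intro add_mono mult_left_mono) auto
  finally have "m / 2 * (2 * mass the_rect \<phi>) \<le> m / 2 * ((1 + \<kappa>) * b * boundary_mass the_rect \<phi> + 2 * ((1 + 1 / \<kappa>) * b\<^sup>2) * dirichlet the_rect D)"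
    using m by (intro mult_left_mono) auto
  also have "\<dots> = (m * (1 + \<kappa>) * b / 2) * boundary_mass the_rect \<phi> + (m * (1 + 1 / \<kappa>) * b\<^sup>2) * dirichlet the_rect D"
    by (simp add: algebra_simps)
  also have "m * (1 + \<kappa>) * b / 2 = \<beta>" using ab \<kappa> by (simp add: m_def)
  also have "m * (1 + 1 / \<kappa>) * b\<^sup>2 = 1"
  proof -
    have "1 + 1 / \<kappa> = (1 + \<kappa>) / \<kappa>" using \<kappa> by (simp add: field_simps)
    then have "m * (1 + 1 / \<kappa>) * b\<^sup>2 = 2 * \<beta> * b / \<kappa>" using ab \<kappa> by (simp add: m_def power2_eq_square)
    moreover have "2 * \<beta> * b / \<kappa> = 1" using \<beta> ab by (simp add: \<kappa>_def)
    ultimately show ?thesis by simp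
  qed
  finally have "m * mass the_rect \<phi> \<le> \<beta> * boundary_mass the_rect \<phi> + dirichlet the_rect D" by simp
  then show ?thesis unfolding robin_form_def[OF dom] m_def \<kappa>_def by linarith
qed

text \<open>For a negative parameter the long sides are controlled by the derivative across the
  rectangle and the short sides by the derivative along it, so neither part of the energy is used twice.\<close>

lemma form_ge_neg:
  assumes c: "c > 0" "c * b \<le> 1 / 4" and l: "0 < l" "l \<le> a" "4 * c * l \<le> 1"
  shows "- (2 * c * (1 + 4 * c * b) / b + 4 * c / l) * mass the_rect \<phi> \<le> robin_form the_rect (- c) D \<phi>"
proof -
  define \<kappa> where "\<kappa> = 4 * c * b"
  have \<kappa>: "\<kappa> > 0" using c ab by (simp add: \<kappa>_def)
  have k1: "2 * c * ((1 + 1 / \<kappa>) * b) \<le> 1"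
  proof -
    have "2 * c * ((1 + 1 / \<kappa>) * b) = 2 * (c * b) + 2 * c * b / \<kappa>" by (simp add: algebra_simps)
    also have "2 * c * b / \<kappa> = 1 / 2" using c ab by (simp add: \<kappa>_def)
    finally show ?thesis using c by simp
  qed
  have "boundary_mass the_rect \<phi> \<le> 2 * ((1 + \<kappa>) / b * mass the_rect \<phi> + (1 + 1 / \<kappa>) * b * partial_energy f)
      + 2 * (2 / l * mass the_rect \<phi> + 2 * l * partial_energy e)"
    using boundary_mass_le_sides long_side(2)[of 0 \<kappa>] long_side(2)[of b \<kappa>] short_sides(3,4)[OF l(1,2)] \<kappa> ab
    by simp
  then have "c * boundary_mass the_rect \<phi> \<le> c * (2 * ((1 + \<kappa>) / b * mass the_rect \<phi> + (1 + 1 / \<kappa>) * b * partial_energy f)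
      + 2 * (2 / l * mass the_rect \<phi> + 2 * l * partial_energy e))"
    using c by (intro mult_left_mono) auto
  also have "\<dots> = (2 * c * (1 + \<kappa>) / b + 4 * c / l) * mass the_rect \<phi> + (2 * c * ((1 + 1 / \<kappa>) * b)) * partial_energy f
      + (4 * c * l) * partial_energy e"
    by (simp add: algebra_simps add_divide_distrib)
  also have "\<dots> \<le> (2 * c * (1 + \<kappa>) / b + 4 * c / l) * mass the_rect \<phi> + 1 * partial_energy f + 1 * partial_energy e"
    by (intro add_mono mult_right_mono order_refl k1 l(3) partial_energy_nonneg)
  finally show ?thesis
    unfolding robin_form_def[OF dom] dirichlet_split \<kappa>_def[symmetric] by (simp add: algebra_simps)
qed

end

end

text \<open>With \<open>2 a \<le> L \<le> 2 (a + b)\<close> the bound for the form depends on \<open>b / a\<close> alone.\<close>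

lemma rect_eigenvalue_ge_pos:
  assumes ef: "orthoframe e f" and ab: "a > 0" "b > 0" and \<alpha>: "\<alpha> > 0"
  shows "\<alpha> / ((1 + b / a) * (1 + \<alpha> * (b / a)))
    \<le> robin_eigenvalue 1 (rect p e f a b) (\<alpha> / perimeter (rect p e f a b)) * area (rect p e f a b)"
proof -
  let ?R = "rect p e f a b"
  define L where "L = perimeter ?R"
  define \<beta> where "\<beta> = \<alpha> / L"
  have L: "2 * a \<le> L" "L \<le> 2 * (a + b)" using perimeter_rect_bounds[OF ef ab] by (auto simp: L_def)
  have Lpos: "L > 0" using L ab by simp
  have \<beta>: "\<beta> > 0" using \<alpha> Lpos by (simp add: \<beta>_def)
  have "2 * \<beta> / (b * (1 + 2 * \<beta> * b)) \<le> robin_bottom ?R \<beta>"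
    by (rule robin_bottom_greatest[OF rect_lipschitz_domain[OF ef ab]]) (rule form_ge_pos[OF ef ab _ \<beta>])
  then have "2 * \<beta> / (b * (1 + 2 * \<beta> * b)) * (a * b) \<le> robin_bottom ?R \<beta> * (a * b)"
    using ab by (intro mult_right_mono) auto
  moreover have "2 * \<beta> / (b * (1 + 2 * \<beta> * b)) * (a * b) = 2 * \<beta> * a / (1 + 2 * \<beta> * b)" using ab by simp
  moreover have "\<alpha> / ((1 + b / a) * (1 + \<alpha> * (b / a))) \<le> 2 * \<beta> * a / (1 + 2 * \<beta> * b)"
  proof -
    have "\<alpha> / (1 + b / a) = \<alpha> * (2 * a) / (2 * (a + b))" using ab by (simp add: field_simps)
    also have "\<dots> \<le> \<alpha> * (2 * a) / L" using L Lpos \<alpha> ab by (intro divide_left_mono) auto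
    finally have 1: "\<alpha> / (1 + b / a) \<le> 2 * \<beta> * a" by (simp add: \<beta>_def mult_ac)
    have "2 * \<beta> * b = \<alpha> * (2 * b) / L" by (simp add: \<beta>_def)
    also have "\<dots> \<le> \<alpha> * (2 * b) / (2 * a)" using L Lpos \<alpha> ab by (intro divide_left_mono) auto
    also have "\<dots> = \<alpha> * (b / a)" by simp
    finally have 2: "2 * \<beta> * b \<le> \<alpha> * (b / a)" .
    have "\<alpha> / ((1 + b / a) * (1 + \<alpha> * (b / a))) = (\<alpha> / (1 + b / a)) / (1 + \<alpha> * (b / a))" by simp
    also have "\<dots> \<le> 2 * \<beta> * a / (1 + 2 * \<beta> * b)"
      using 1 2 \<beta> ab by (intro frac_le) (auto simp: add_pos_nonneg)
    finally show ?thesis .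
  qed
  ultimately show ?thesis
    unfolding robin_eigenvalue_eq_bottom[OF rect_lipschitz_domain[OF ef ab]] area_rect[OF ef ab] L_def[symmetric] \<beta>_def[symmetric]
    by linarith
qed

text \<open>The layers at the short sides have width \<open>q a\<close>, with \<open>q\<close> as large as \<open>l \<le> a\<close> and
  \<open>4 c l \<le> 1\<close> permit for \<open>c = - \<beta> \<le> \<bar>\<alpha>\<bar> / (2 a)\<close>. As \<open>q\<close> does not depend on the rectangle, their cost is of order \<open>b / a\<close>.\<close>

lemma rect_eigenvalue_ge_neg:
  assumes ef: "orthoframe e f" and ab: "a > 0" "b > 0" and \<alpha>: "\<alpha> < 0" and thin: "\<bar>\<alpha>\<bar> * (b / a) \<le> 1 / 2"
  defines "q \<equiv> min 1 (1 / (2 * \<bar>\<alpha>\<bar>))"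
  shows "- (\<bar>\<alpha>\<bar> * (1 + 2 * \<bar>\<alpha>\<bar> * (b / a)) + 2 * \<bar>\<alpha>\<bar> / q * (b / a))
    \<le> robin_eigenvalue 1 (rect p e f a b) (\<alpha> / perimeter (rect p e f a b)) * area (rect p e f a b)"
proof -
  let ?R = "rect p e f a b"
  define L where "L = perimeter ?R"
  define c where "c = \<bar>\<alpha>\<bar> / L"
  define \<rho> where "\<rho> = b / a"
  have L: "2 * a \<le> L" using perimeter_rect_bounds[OF ef ab] by (auto simp: L_def)
  have Lpos: "L > 0" using L ab by simp
  have c: "c > 0" using \<alpha> Lpos by (simp add: c_def divide_neg_pos)
  have q: "0 < q" "q \<le> 1" "2 * \<bar>\<alpha>\<bar> * q \<le> 1" using \<alpha> by (auto simp: q_def min_def field_simps)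
  have ca: "c * a \<le> \<bar>\<alpha>\<bar> / 2"
  proof -
    have "c * a = \<bar>\<alpha>\<bar> * a / L" by (simp add: c_def)
    also have "\<dots> \<le> \<bar>\<alpha>\<bar> * a / (2 * a)" using L ab Lpos by (intro divide_left_mono) auto
    finally show ?thesis using ab by simp
  qed
  have b\<rho>: "b = a * \<rho>" using ab by (simp add: \<rho>_def)
  have \<rho>: "\<rho> > 0" using ab by (simp add: \<rho>_def)
  have cb: "c * b \<le> \<bar>\<alpha>\<bar> / 2 * \<rho>" unfolding b\<rho> using mult_right_mono[OF ca, of \<rho>] \<rho> by (simp add: mult.assoc)
  define l where "l = a * q"
  have l: "0 < l" "l \<le> a" using q ab by (auto simp: l_def mult_left_le)
  have cl: "4 * c * l \<le> 1"
  proof -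
    have "4 * c * l = 4 * (c * a) * q" by (simp add: l_def)
    also have "\<dots> \<le> 4 * (\<bar>\<alpha>\<bar> / 2) * q" using ca q by (intro mult_right_mono mult_left_mono) auto
    also have "\<dots> = 2 * \<bar>\<alpha>\<bar> * q" by simp
    finally show ?thesis using q(3) by linarith
  qed
  have cb4: "c * b \<le> 1 / 4" using cb thin unfolding \<rho>_def[symmetric] by simp
  have "- (2 * c * (1 + 4 * c * b) / b + 4 * c / l) \<le> robin_bottom ?R (- c)"
    by (rule robin_bottom_greatest[OF rect_lipschitz_domain[OF ef ab]]) (rule form_ge_neg[OF ef ab _ c cb4 l cl])
  then have "- (2 * c * (1 + 4 * c * b) / b + 4 * c / l) * (a * b) \<le> robin_bottom ?R (- c) * (a * b)"
    using ab by (intro mult_right_mono) auto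
  moreover have "- (2 * c * (1 + 4 * c * b) / b + 4 * c / l) * (a * b) = - (2 * (c * a) * (1 + 4 * (c * b)) + 4 * (c * b) / q)"
    using ab q by (simp add: l_def field_simps)
  moreover have "2 * (c * a) * (1 + 4 * (c * b)) + 4 * (c * b) / q \<le> 2 * (\<bar>\<alpha>\<bar> / 2) * (1 + 4 * (\<bar>\<alpha>\<bar> / 2 * \<rho>)) + 4 * (\<bar>\<alpha>\<bar> / 2 * \<rho>) / q"
  proof -
    have mono: "2 * X * (1 + 4 * Y) + 4 * Y / q \<le> 2 * X' * (1 + 4 * Y') + 4 * Y' / q"
      if "X \<le> X'" "Y \<le> Y'" "0 \<le> X" "0 \<le> Y" for X X' Y Y'
      using that q by (intro add_mono mult_mono divide_right_mono) auto
    show ?thesis by (rule mono[OF ca cb]) (use c ab in auto)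
  qed
  moreover have "2 * (\<bar>\<alpha>\<bar> / 2) * (1 + 4 * (\<bar>\<alpha>\<bar> / 2 * \<rho>)) + 4 * (\<bar>\<alpha>\<bar> / 2 * \<rho>) / q
      = \<bar>\<alpha>\<bar> * (1 + 2 * \<bar>\<alpha>\<bar> * \<rho>) + 2 * \<bar>\<alpha>\<bar> / q * \<rho>"
    using q(1) by (simp add: field_simps)
  ultimately have "- (\<bar>\<alpha>\<bar> * (1 + 2 * \<bar>\<alpha>\<bar> * \<rho>) + 2 * \<bar>\<alpha>\<bar> / q * \<rho>) \<le> robin_bottom ?R (- c) * (a * b)"
    by linarith
  moreover have "\<alpha> / perimeter ?R = - c" using \<alpha> by (simp add: c_def L_def)
  ultimately show ?thesis
    unfolding robin_eigenvalue_eq_bottom[OF rect_lipschitz_domain[OF ef ab]] area_rect[OF ef ab] \<rho>_def by simp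
qed

section \<open>The bound and its sharpness\<close>

theorem theoremA:
  fixes \<alpha> :: real
  assumes "\<alpha> \<noteq> 0"
  shows "(\<forall>\<Omega> :: (real^2) set. bounded_lipschitz_domain \<Omega> \<longrightarrow>
             robin_eigenvalue 1 \<Omega> (\<alpha> / perimeter \<Omega>) * area \<Omega> < \<alpha>) \<and>
         (\<forall>(\<Omega> :: nat \<Rightarrow> (real^2) set) (a :: nat \<Rightarrow> real) (b :: nat \<Rightarrow> real).
             (\<forall>j. 0 < b j \<and> b j \<le> a j \<and> open_rectangle (\<Omega> j) (a j) (b j)) \<longrightarrow>
             (\<lambda>j. b j / a j) \<longlonglongrightarrow> 0 \<longrightarrow>
             (\<lambda>j. robin_eigenvalue 1 (\<Omega> j) (\<alpha> / perimeter (\<Omega> j)) * area (\<Omega> j)) \<longlonglongrightarrow> \<alpha>)"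
proof (intro conjI allI impI)
  fix \<Omega> :: "(real^2) set" assume "bounded_lipschitz_domain \<Omega>"
  then show "robin_eigenvalue 1 \<Omega> (\<alpha> / perimeter \<Omega>) * area \<Omega> < \<alpha>"
    using assms by (rule robin_eigenvalue_strict_upper_bound)
next
  fix \<Omega> :: "nat \<Rightarrow> (real^2) set" and a b :: "nat \<Rightarrow> real"
  assume rects: "\<forall>j. 0 < b j \<and> b j \<le> a j \<and> open_rectangle (\<Omega> j) (a j) (b j)"
    and thin: "(\<lambda>j. b j / a j) \<longlonglongrightarrow> 0"
  have pos: "0 < b j" "0 < a j" for j using rects by (meson less_le_trans)+
  have "\<exists>p e f. orthoframe e f \<and> \<Omega> j = rect p e f (a j) (b j)" for j
    using rects open_rectangle_rect by metis
  then obtain p e f where ef: "\<And>j. orthoframe (e j) (f j)" and \<Omega>: "\<And>j. \<Omega> j = rect (p j) (e j) (f j) (a j) (b j)"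
    by metis
  let ?ev = "\<lambda>j. robin_eigenvalue 1 (\<Omega> j) (\<alpha> / perimeter (\<Omega> j)) * area (\<Omega> j)"
  have upper: "?ev j \<le> \<alpha>" for j
    unfolding \<Omega> by (intro less_imp_le robin_eigenvalue_strict_upper_bound rect_lipschitz_domain ef pos assms)
  show "?ev \<longlonglongrightarrow> \<alpha>"
  proof (cases "\<alpha> > 0")
    case True
    show ?thesis
    proof (rule tendsto_sandwich)
      show "\<forall>\<^sub>F j in sequentially. \<alpha> / ((1 + b j / a j) * (1 + \<alpha> * (b j / a j))) \<le> ?ev j"
        unfolding \<Omega> by (intro always_eventually allI rect_eigenvalue_ge_pos ef pos True)
      have "(\<lambda>j. \<alpha> / ((1 + b j / a j) * (1 + \<alpha> * (b j / a j)))) \<longlonglongrightarrow> \<alpha> / ((1 + 0) * (1 + \<alpha> * 0))"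
        by (intro tendsto_intros thin) auto
      then show "(\<lambda>j. \<alpha> / ((1 + b j / a j) * (1 + \<alpha> * (b j / a j)))) \<longlonglongrightarrow> \<alpha>" by simp
    qed (use upper in auto)
  next
    case False
    then have neg: "\<alpha> < 0" using assms by simp
    let ?q = "min 1 (1 / (2 * \<bar>\<alpha>\<bar>))"
    let ?lo = "\<lambda>j. - (\<bar>\<alpha>\<bar> * (1 + 2 * \<bar>\<alpha>\<bar> * (b j / a j)) + 2 * \<bar>\<alpha>\<bar> / ?q * (b j / a j))"
    show ?thesis
    proof (rule tendsto_sandwich)
      have "(\<lambda>j. \<bar>\<alpha>\<bar> * (b j / a j)) \<longlonglongrightarrow> \<bar>\<alpha>\<bar> * 0" by (intro tendsto_intros thin)
      then have "\<forall>\<^sub>F j in sequentially. \<bar>\<alpha>\<bar> * (b j / a j) < 1 / 2"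
        by (rule order_tendstoD(2)) simp
      then show "\<forall>\<^sub>F j in sequentially. ?lo j \<le> ?ev j"
      proof eventually_elim
        case (elim j)
        then show ?case unfolding \<Omega> by (intro rect_eigenvalue_ge_neg ef pos neg) auto
      qed
      have "?lo \<longlonglongrightarrow> - (\<bar>\<alpha>\<bar> * (1 + 2 * \<bar>\<alpha>\<bar> * 0) + 2 * \<bar>\<alpha>\<bar> / ?q * 0)"
        by (intro tendsto_minus tendsto_add tendsto_mult tendsto_const thin)
      then show "?lo \<longlonglongrightarrow> \<alpha>" using neg by simp
    qed (use upper in auto)
  qed
qed

end
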